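(* Let $n\in\mathbb N$, and let $q_0,1/q_0\in AC[0,1]$, $q_k\in W_1^{1-k}$ for $k=\overline{1,n}$, and $p_k\in W_1^{-k}$ for $k=\overline{0,n}$. For $y\in W_\infty^n$ consider $$\ell_{2n+1}y:=i\sum_{k=0}^n\Big(\big(q_ky^{(n-k+1)}\big)^{(n-k)}+\big(q_ky^{(n-k)}\big)^{(n-k+1)}\Big)+\sum_{k=0}^n\big(p_ky^{(n-k)}\big)^{(n-k)},$$ a functional on $\mathring W_\infty^{n+1}$. Then $$\ell_{2n+1}y=\frac{d^{n+1}}{dx^{n+1}}\Big(By^{(n)}+Cy\Big),\ \text{ i.e. } (\ell_{2n+1}y,\varphi)=(-1)^{n+1}\int_0^1(By^{(n)}+Cy)\varphi^{(n+1)}dx\ \ \forall\varphi\in\mathring W^{n+1}_\infty,$$ where $B$ maps $L_\infty(0,1)$ bijectively onto $L_\infty(0,1)$, $$Bf(x)=2iq_0(x)f(x)+\int_0^xK(x,t)f(t)\,dt,\qquad |K(x,t)|\le a(t)\ \text{ with some } a\in L(0,1),$$ $$Cy=\sum_{\nu=0}^{n-1}y^{(\nu)}(0)u_\nu(x),\quad u_\nu\in W_1^1[0,1],$$ and $$K(x,t)=\sum_{k=0}^n(-1)^k\frac{(x-t)^k}{k!}\big(P_k(t)-iQ_k(t)\big)+\sum_{k=1}^n\int_t^x\big(P_k(\tau)+iQ_k(\tau)\big)\frac{(\tau-t)^{k-1}}{(k-1)!}\,d\tau$$ $$+\sum_{k=2}^n\sum_{\nu=1}^{k-1}(-1)^\nu\int_t^x\frac{(x-\tau)^\nu}{\nu!}\Big(\tbinom{k}{\nu}P_k(\tau)+i\big(\tbinom{k-1}{\nu}-\tbinom{k-1}{\nu-1}\big)Q_k(\tau)\Big)\frac{(\tau-t)^{k-1-\nu}}{(k-1-\nu)!}\,d\tau,$$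 where $P_0=p_0$, $Q_0=q_0'$, and $P_k,Q_k\in L(0,1)$ are any functions with $P_k^{(k)}=p_k$, $Q_k^{(k-1)}=q_k$ (generalized derivatives), $k=\overline{1,n}$; $K$ does not depend on the choice of these primitives.
   Context: Here weight $b=1$ and the indices are $p=\infty$, $p^*=1$. $W^k_p$ ($k\ge0$): functions $g$ with $g,\dots,g^{(k-1)}\in AC[0,1]$, $g^{(k)}\in L_p(0,1)$; $\mathring W^k_\infty$: those $g\in W^k_\infty$ with $g^{(\nu)}(0)=g^{(\nu)}(1)=0$, $\nu<k$. For $k\ge0$, $W_1^{-k}$ is the set of functionals $f$ on $\mathring W_\infty^k$ of the form $(f,\varphi)=(-1)^k\int_0^1\sigma\varphi^{(k)}dx$ with $\sigma\in L(0,1)$; we write $f=\sigma^{(k)}$ (for $k=0$ it is the function $\sigma$; $W^1_1$ for $k=-1$ means $AC[0,1]$). Derivative of a functional: $(f',\varphi):=-(f,\varphi')$; product of a functional $f$ with a function $y$: $(fy,\varphi):=(f,\varphi y)$ whenever $\varphi y$ lies in the test space of $f$. In particular $y^{(n+1)}$ is the generalized derivative of $y^{(n)}\in L_\infty$. Each term of $\ell_{2n+1}y$ is a functional regarded on $\mathring W_\infty^{n+1}$. *)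

theory Defs
  imports "HOL-Analysis.Analysis"
begin

text \<open>All functions live on [0,1]; values outside [0,1] are irrelevant.
  Integrals are Lebesgue integrals w.r.t. the (complete) Lebesgue measure.\<close>

definition AC :: "(real \<Rightarrow> 'a::real_normed_vector) \<Rightarrow> bool" where
  "AC g \<longleftrightarrow> (\<forall>e>0. \<exists>d>0. \<forall>(m::nat) (a::nat \<Rightarrow> real) b.
      (\<forall>i<m. 0 \<le> a i \<and> a i \<le> b i \<and> b i \<le> 1) \<and>
      (\<forall>i<m. \<forall>j<m. i \<noteq> j \<longrightarrow> b i \<le> a j \<or> b j \<le> a i) \<and>
      (\<Sum>i<m. b i - a i) < d
      \<longrightarrow> (\<Sum>i<m. norm (g (b i) - g (a i))) < e)"

definition L1 :: "(real \<Rightarrow> 'a::{banach,second_countable_topology}) \<Rightarrow> bool" where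
  "L1 f \<longleftrightarrow> set_integrable lebesgue {0..1} f"

definition Linf :: "(real \<Rightarrow> 'a::{banach,second_countable_topology}) \<Rightarrow> bool" where
  "Linf f \<longleftrightarrow> set_borel_measurable lebesgue {0..1} f \<and>
     (\<exists>M. AE x in lebesgue. x \<in> {0..1} \<longrightarrow> norm (f x) \<le> M)"

definition is_deriv :: "(real \<Rightarrow> complex) \<Rightarrow> (real \<Rightarrow> complex) \<Rightarrow> bool" where
  "is_deriv g h \<longleftrightarrow> (AE x in lebesgue. x \<in> {0..1} \<longrightarrow>
      (g has_vector_derivative h x) (at x within {0..1}))"

text \<open>The derivative of g as a function: the (unique on [0,1]) absolutely continuous
  representative if there is one, otherwise some a.e. derivative.\<close>
definition wder :: "(real \<Rightarrow> complex) \<Rightarrow> real \<Rightarrow> complex" where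
  "wder g = (if \<exists>h. is_deriv g h \<and> AC h then (SOME h. is_deriv g h \<and> AC h)
             else (SOME h. is_deriv g h))"

definition Wsob :: "nat \<Rightarrow> ((real \<Rightarrow> complex) \<Rightarrow> bool) \<Rightarrow> (real \<Rightarrow> complex) \<Rightarrow> bool" where
  "Wsob k P g \<longleftrightarrow> (\<exists>D. (\<forall>x\<in>{0..1}. D 0 x = g x) \<and>
      (\<forall>j<k. AC (D j) \<and> is_deriv (D j) (D (Suc j))) \<and> P (D k))"

definition W0inf :: "nat \<Rightarrow> (real \<Rightarrow> complex) \<Rightarrow> bool" where
  "W0inf k g \<longleftrightarrow> (\<exists>D. (\<forall>x\<in>{0..1}. D 0 x = g x) \<and>
      (\<forall>j<k. AC (D j) \<and> is_deriv (D j) (D (Suc j))) \<and> Linf (D k) \<and>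
      (\<forall>\<nu><k. D \<nu> 0 = 0 \<and> D \<nu> 1 = 0))"

type_synonym fnl = "(real \<Rightarrow> complex) \<Rightarrow> complex"

definition fnl_of :: "(real \<Rightarrow> complex) \<Rightarrow> fnl" where
  "fnl_of \<sigma> = (\<lambda>\<phi>. LINT x:{0..1}|lebesgue. \<sigma> x * \<phi> x)"

definition fder :: "fnl \<Rightarrow> fnl" where
  "fder f = (\<lambda>\<phi>. - f (wder \<phi>))"

definition fmul :: "fnl \<Rightarrow> (real \<Rightarrow> complex) \<Rightarrow> fnl" where
  "fmul f y = (\<lambda>\<phi>. f (\<lambda>x. \<phi> x * y x))"

definition gder :: "nat \<Rightarrow> (real \<Rightarrow> complex) \<Rightarrow> fnl" where
  "gder k \<sigma> = (fder ^^ k) (fnl_of \<sigma>)"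

definition Wneg :: "nat \<Rightarrow> fnl \<Rightarrow> bool" where
  "Wneg k f \<longleftrightarrow> (\<exists>\<sigma>. L1 \<sigma> \<and> (\<forall>\<phi>. W0inf k \<phi> \<longrightarrow> f \<phi> = gder k \<sigma> \<phi>))"

text \<open>The functional l_{2n+1} y. The coefficient q_0 is a function (q0), the q_k (k>=1)
  and p_k are functionals. y^(n+1) is the generalized derivative fder (fnl_of y^(n)).\<close>
definition ell :: "nat \<Rightarrow> (real \<Rightarrow> complex) \<Rightarrow> (nat \<Rightarrow> fnl) \<Rightarrow> (nat \<Rightarrow> fnl)
                   \<Rightarrow> (real \<Rightarrow> complex) \<Rightarrow> fnl" where
  "ell n q0 q p y = (\<lambda>\<phi>.
     \<i> * ( (fder ^^ n) (fmul (fder (fnl_of ((wder ^^ n) y))) q0) \<phi>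
         + (fder ^^ (n + 1)) (fmul (fnl_of q0) ((wder ^^ n) y)) \<phi>
         + (\<Sum>k\<in>{1..n}. (fder ^^ (n - k)) (fmul (q k) ((wder ^^ (n - k + 1)) y)) \<phi>
                      + (fder ^^ (n - k + 1)) (fmul (q k) ((wder ^^ (n - k)) y)) \<phi>))
     + (\<Sum>k\<le>n. (fder ^^ (n - k)) (fmul (p k) ((wder ^^ (n - k)) y)) \<phi>))"

definition prims :: "nat \<Rightarrow> (real \<Rightarrow> complex) \<Rightarrow> (nat \<Rightarrow> fnl) \<Rightarrow> (nat \<Rightarrow> fnl)
                     \<Rightarrow> (nat \<Rightarrow> real \<Rightarrow> complex) \<Rightarrow> (nat \<Rightarrow> real \<Rightarrow> complex) \<Rightarrow> bool" where
  "prims n q0 q p P Q \<longleftrightarrow>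
     (\<forall>k\<le>n. L1 (P k) \<and> (\<forall>\<phi>. W0inf k \<phi> \<longrightarrow> p k \<phi> = gder k (P k) \<phi>)) \<and>
     (\<forall>k\<in>{1..n}. L1 (Q k) \<and> (\<forall>\<phi>. W0inf (k - 1) \<phi> \<longrightarrow> q k \<phi> = gder (k - 1) (Q k) \<phi>)) \<and>
     is_deriv q0 (Q 0)"

text \<open>The kernel K(x,t), for 0 <= t <= x <= 1.\<close>
definition Kker :: "nat \<Rightarrow> (nat \<Rightarrow> real \<Rightarrow> complex) \<Rightarrow> (nat \<Rightarrow> real \<Rightarrow> complex)
                    \<Rightarrow> real \<Rightarrow> real \<Rightarrow> complex" where
  "Kker n P Q x t =
     (\<Sum>k\<le>n. (-1) ^ k * complex_of_real ((x - t) ^ k / fact k) * (P k t - \<i> * Q k t))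
   + (\<Sum>k\<in>{1..n}. LINT \<tau>:{t..x}|lebesgue.
         (P k \<tau> + \<i> * Q k \<tau>) * complex_of_real ((\<tau> - t) ^ (k - 1) / fact (k - 1)))
   + (\<Sum>k\<in>{2..n}. \<Sum>\<nu>\<in>{1..k-1}. (-1) ^ \<nu> *
        (LINT \<tau>:{t..x}|lebesgue.
           complex_of_real ((x - \<tau>) ^ \<nu> / fact \<nu>) *
           (of_nat (k choose \<nu>) * P k \<tau>
             + \<i> * of_int (int ((k - 1) choose \<nu>) - int ((k - 1) choose (\<nu> - 1))) * Q k \<tau>) *
           complex_of_real ((\<tau> - t) ^ (k - 1 - \<nu>) / fact (k - 1 - \<nu>))))"

definition Bop :: "(real \<Rightarrow> complex) \<Rightarrow> (real \<Rightarrow> real \<Rightarrow> complex) \<Rightarrow> (real \<Rightarrow> complex)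
                   \<Rightarrow> real \<Rightarrow> complex" where
  "Bop q0 K f x = 2 * \<i> * q0 x * f x + (LINT t:{0..x}|lebesgue. K x t * f t)"

end

theory Submission
  imports Defs
begin

text \<open>By Leibniz' rule every term of the expression becomes an integral of W y^(n-k+nu) phi^(n-nu) with
  W integrable. Taylor's formula with integral remainder, at 0 for y and at 1 for phi, writes both factors through
  y^(n), the initial values of y and phi^(n+1); exchanging the order of integration gives the Volterra
  kernel K and the coefficients of the initial values. As |K(x,t)| is bounded by an integrable function of t alone, the iterates of the
  Volterra operator decrease like b^m / m!, so the Neumann series inverts B. Independence of
  the primitives follows without computing kernels: the expression itself does not see them, so for y with
  zero initial values the difference of the two Volterra integrals annihilates all phi^(n+1) and is
  a polynomial; if y^(n) vanishes near 0 so does this polynomial.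

  Two facts of Lebesgue theory on the line are needed on the way: an indefinite integral is
  absolutely continuous and differentiable almost everywhere, and an absolutely continuous function is the integral of its derivative.\<close>

section \<open>Lebesgue differentiation on the line\<close>

text \<open>The primitives are determined only up to polynomials and null sets, while the dominating
  function and the coefficients u_\<nu> have to serve all choices at once. Both are therefore built
  from one fixed choice, and independence of the kernel carries them over to any other. For each x
  separately, independence holds for almost every t; continuity in x and rational points turn this
  into one null set of t for all x >= t.

  Two further constraints shape the proof. The derivative \<open>wder\<close> is a choice,
  determined everywhere only below the top order, so y and phi enter through chains of absolutely
  continuous functions. And all kernels are polynomial in x and t around integrable factors of a
  single variable, hence finite sums of products: regularity in x and changes in the order of
  integration reduce to indefinite integrals of one variable, with no measurability on the square.
  The expansion points are dictated by the data: at 1 phi has no boundary terms and leaves integrals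
  over [0,x], at 0 y brings exactly its initial values.\<close>

text \<open>Henstock's lemma bounds the sum of the oscillations over a disjoint family of intervals that are
  bad for the difference quotient; Vitali's covering lemma extracts such a family whose fivefold
  enlargement covers the bad points.\<close>

lemma negligible_bad_difference_quotient:
  fixes f :: "real \<Rightarrow> 'a::euclidean_space"
  assumes f: "f integrable_on {a..b}" and e: "e > 0"
  defines "F \<equiv> \<lambda>x. integral {a..x} f"
  shows "negligible {x\<in>{a..b}. \<forall>d>0. \<exists>y\<in>{a..b}. \<bar>y - x\<bar> < d \<and>
           norm (F y - F x - (y - x) *\<^sub>R f x) > e * \<bar>y - x\<bar>}" (is "negligible ?B")
  unfolding negligible_outer_le
proof (intro allI impI)
  fix \<eta> :: real assume \<eta>: "\<eta> > 0"
  have "f integrable_on cbox a b" using f by simp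
  \<comment> \<open>The 5 pays for Vitali's enlargement, the factor \<open>e\<close> for the defect
    of each bad interval per unit of length.\<close>
  moreover have "e * \<eta> / 5 > 0" using e \<eta> by simp
  ultimately obtain \<gamma> where \<gamma>: "gauge \<gamma>"
    and H: "\<And>p. p tagged_partial_division_of cbox a b \<Longrightarrow> \<gamma> fine p \<Longrightarrow>
             (\<Sum>(x,k)\<in>p. norm (measure lborel k *\<^sub>R f x - integral k f)) < e * \<eta> / 5"
    by (rule Henstock_lemma) blast
  \<comment> \<open>A pair (x,y) stands for the interval \<open>I\<close> between x and y with tag
    x, described as a ball with centre \<open>c\<close> and radius \<open>r\<close> for Vitali's
    lemma. With the tag at an endpoint, the Henstock error of the interval is exactly the defect of
    the difference quotient.\<close>
  define c where "c = (\<lambda>(x::real,y). (x + y) / 2)"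
  define r where "r = (\<lambda>(x::real,y). \<bar>y - x\<bar> / 2)"
  define I where "I = (\<lambda>(x::real,y). {min x y..max x y})"
  have cb: "cball (c z) (r z) = I z" for z
  proof (cases z)
    case (Pair x y)
    show ?thesis
      by (cases "x \<le> y") (simp_all add: Pair c_def r_def I_def cball_eq_atLeastAtMost field_simps)
  qed
  define K where "K = {(x,y). x \<in> {a..b} \<and> y \<in> {a..b} \<and> y \<noteq> x \<and> I (x,y) \<subseteq> \<gamma> x \<and>
      norm (F y - F x - (y - x) *\<^sub>R f x) > e * \<bar>y - x\<bar>}"
  have cov: "?B \<subseteq> (\<Union>z\<in>K. cball (c z) (r z))"
  proof
    fix x assume x: "x \<in> ?B"
    obtain d where d: "d > 0" "ball x d \<subseteq> \<gamma> x"
      using \<gamma> unfolding gauge_def by (metis open_contains_ball)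
    with x obtain y where y: "y \<in> {a..b}" "\<bar>y - x\<bar> < d" "norm (F y - F x - (y - x) *\<^sub>R f x) > e * \<bar>y - x\<bar>"
      by blast
    have "y \<noteq> x" using y(3) by auto
    moreover have "I (x,y) \<subseteq> ball x d" using y(2) by (auto simp: I_def dist_real_def)
    ultimately have "(x,y) \<in> K" using x y d unfolding K_def by auto
    moreover have "x \<in> I (x,y)" by (auto simp: I_def)
    ultimately show "x \<in> (\<Union>z\<in>K. cball (c z) (r z))" unfolding cb by blast
  qed
  have rb: "0 < r z \<and> r z \<le> b - a" if "z \<in> K" for z
    using that by (cases z) (auto simp: K_def r_def)
  obtain C where C: "countable C" "C \<subseteq> K"
     "pairwise (\<lambda>i j. disjnt (cball (c i) (r i)) (cball (c j) (r j))) C"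
     "?B \<subseteq> (\<Union>i\<in>C. cball (c i) (5 * r i))"
    by (rule Vitali_covering_lemma_cballs[OF cov rb])
  \<comment> \<open>Henstock's lemma speaks of finite partial divisions, so the countable union is
    bounded through its finite subfamilies. On a bad interval the error exceeds \<open>e\<close>
    times the length \<open>2 * r i\<close>, and disjointness lets the errors be summed.\<close>
  have fin: "measure lebesgue (\<Union>i\<in>C'. cball (c i) (5 * r i)) \<le> \<eta>" if C': "C' \<subseteq> C" "finite C'" for C'
  proof -
    have pw: "disjnt (I i) (I j)" if "i \<in> C'" "j \<in> C'" "i \<noteq> j" for i j
      using C(3) C' that unfolding cb pairwise_def by blast
    have K': "i \<in> K" if "i \<in> C'" for i using that C C' by blast
    have ne: "fst i \<in> I i" for i by (cases i) (auto simp: I_def)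
    define p where "p = (\<lambda>i. (fst i, I i)) ` C'"
    have inj: "inj_on (\<lambda>i. (fst i, I i)) C'"
    proof (rule inj_onI)
      fix i j assume ij: "i \<in> C'" "j \<in> C'" "(fst i, I i) = (fst j, I j)"
      show "i = j"
      proof (rule ccontr)
        assume "i \<noteq> j"
        then have "disjnt (I i) (I j)" using pw ij by blast
        then show False using ne[of i] ij(3) by (auto simp: disjnt_def)
      qed
    qed
    have Iab: "I i \<subseteq> cbox a b" if "i \<in> C'" for i
      using K'[OF that] by (cases i) (auto simp: K_def I_def)
    have "p tagged_partial_division_of cbox a b"
      unfolding tagged_partial_division_of_def p_def
    proof (intro conjI allI impI)
      show "finite ((\<lambda>i. (fst i, I i)) ` C')" using C' by simp
    next
      fix x k assume "(x,k) \<in> (\<lambda>i. (fst i, I i)) ` C'"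
      then obtain i where i: "i \<in> C'" "x = fst i" "k = I i" by auto
      show "x \<in> k" using i ne by simp
      show "k \<subseteq> cbox a b" using i Iab by simp
      show "\<exists>a b. k = cbox a b" using i by (cases i) (auto simp: I_def)
    next
      fix x1 k1 x2 k2
      assume A: "(x1,k1) \<in> (\<lambda>i. (fst i, I i)) ` C' \<and> (x2,k2) \<in> (\<lambda>i. (fst i, I i)) ` C' \<and> (x1,k1) \<noteq> (x2,k2)"
      then obtain i j where ij: "i \<in> C'" "x1 = fst i" "k1 = I i" "j \<in> C'" "x2 = fst j" "k2 = I j" by auto
      have "i \<noteq> j" using A ij by auto
      then have "disjnt (I i) (I j)" using pw ij(1,4) by simp
      then show "interior k1 \<inter> interior k2 = {}"
        using ij interior_subset[of k1] interior_subset[of k2] unfolding disjnt_def by blast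
    qed
    moreover have "\<gamma> fine p"
      using K' unfolding p_def fine_def K_def by fastforce
    ultimately have S: "(\<Sum>(x,k)\<in>p. norm (measure lborel k *\<^sub>R f x - integral k f)) < e * \<eta> / 5" by (rule H)
    have "(\<Sum>i\<in>C'. e * (2 * r i)) \<le> (\<Sum>i\<in>C'. norm (measure lborel (I i) *\<^sub>R f (fst i) - integral (I i) f))"
    proof (rule sum_mono)
      fix i assume i: "i \<in> C'"
      obtain x y where xy: "i = (x,y)" by (cases i)
      have k: "x \<in> {a..b}" "y \<in> {a..b}" "norm (F y - F x - (y - x) *\<^sub>R f x) > e * \<bar>y - x\<bar>"
        using K'[OF i] xy by (auto simp: K_def)
      have int: "integral {u..v} f = F v - F u" if "u \<in> {a..b}" "v \<in> {a..b}" "u \<le> v" for u v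
      proof -
        have "f integrable_on {a..v}" using f that integrable_subinterval_real by fastforce
        then have "integral {a..u} f + integral {u..v} f = integral {a..v} f"
          using that by (intro Henstock_Kurzweil_Integration.integral_combine) auto
        then show ?thesis unfolding F_def by (simp add: algebra_simps)
      qed
      have "norm (measure lborel (I i) *\<^sub>R f (fst i) - integral (I i) f) = norm (F y - F x - (y - x) *\<^sub>R f x)"
      proof (cases "x \<le> y")
        case True
        then show ?thesis using int[of x y] k by (simp add: xy I_def norm_minus_commute)
      next
        case False
        then have "measure lborel (I i) *\<^sub>R f (fst i) - integral (I i) f = F y - F x - (y - x) *\<^sub>R f x"
          using int[of y x] k by (simp add: xy I_def algebra_simps)
        then show ?thesis by simp
      qed
      then show "e * (2 * r i) \<le> norm (measure lborel (I i) *\<^sub>R f (fst i) - integral (I i) f)"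
        using k by (simp add: xy r_def)
    qed
    also have "\<dots> = (\<Sum>(x,k)\<in>p. norm (measure lborel k *\<^sub>R f x - integral k f))"
      unfolding p_def by (simp add: sum.reindex[OF inj])
    also note S
    finally have "e * (\<Sum>i\<in>C'. 2 * r i) < e * (\<eta> / 5)"
      by (simp add: sum_distrib_left)
    then have sm: "(\<Sum>i\<in>C'. 2 * r i) \<le> \<eta> / 5"
      using e by simp
    have "measure lebesgue (\<Union>i\<in>C'. cball (c i) (5 * r i)) \<le> (\<Sum>i\<in>C'. measure lebesgue (cball (c i) (5 * r i)))"
      using C' by (intro measure_UNION_le) auto
    also have "\<dots> = (\<Sum>i\<in>C'. 5 * (2 * r i))"
      using K' rb by (intro sum.cong) (auto simp: cball_eq_atLeastAtMost less_imp_le)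
    also have "\<dots> \<le> \<eta>" using sm by (simp flip: sum_distrib_left)
    finally show ?thesis .
  qed
  define \<D> where "\<D> = (\<lambda>i. cball (c i) (5 * r i)) ` C"
  have "\<Union>\<D> \<in> lmeasurable \<and> measure lebesgue (\<Union>\<D>) \<le> \<eta>"
  proof -
    have cD: "countable \<D>" using C by (simp add: \<D>_def)
    have m: "d \<in> lmeasurable" if "d \<in> \<D>" for d using that by (auto simp: \<D>_def)
    have fD: "measure lebesgue (\<Union>D') \<le> \<eta>" if D': "D' \<subseteq> \<D>" "finite D'" for D'
    proof -
      obtain C' where "C' \<subseteq> C" "finite C'" "D' = (\<lambda>i. cball (c i) (5 * r i)) ` C'"
        using finite_subset_image[OF D'(2,1)[unfolded \<D>_def]] by blast
      then show ?thesis using fin by simp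
    qed
    show ?thesis
      by (intro conjI fmeasurable_Union_bound[OF cD m fD] measure_Union_bound[OF cD m fD])
  qed
  then show "\<exists>T. ?B \<subseteq> T \<and> T \<in> lmeasurable \<and> measure lebesgue T \<le> \<eta>"
    using C(4) unfolding \<D>_def by blast
qed

text \<open>If f x is not the derivative at x, some fixed error recurs arbitrarily close to x, and
  it may be lowered to some 1/(m+1). The exceptional set thus lies in a countable union of null
  sets.\<close>

lemma AE_indefinite_integral_has_vector_derivative:
  fixes f :: "real \<Rightarrow> 'a::euclidean_space"
  assumes f: "f integrable_on {a..b}"
  shows "AE x in lebesgue. x \<in> {a..b} \<longrightarrow>
           ((\<lambda>x. integral {a..x} f) has_vector_derivative f x) (at x within {a..b})"
proof -
  define F where "F = (\<lambda>x. integral {a..x} f)"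
  define B where "B = (\<lambda>e. {x\<in>{a..b}. \<forall>d>0. \<exists>y\<in>{a..b}. \<bar>y - x\<bar> < d \<and>
           norm (F y - F x - (y - x) *\<^sub>R f x) > e * \<bar>y - x\<bar>})"
  have "negligible (\<Union>m. B (inverse (real (Suc m))))"
    unfolding B_def F_def by (intro negligible_countable_Union) (auto simp del: atLeastAtMost_iff of_nat_Suc intro!: negligible_bad_difference_quotient[OF f])
  moreover have "{x. \<not> (x \<in> {a..b} \<longrightarrow> (F has_vector_derivative f x) (at x within {a..b}))}
      \<subseteq> (\<Union>m. B (inverse (real (Suc m))))"
  proof
    fix x assume "x \<in> {x. \<not> (x \<in> {a..b} \<longrightarrow> (F has_vector_derivative f x) (at x within {a..b}))}"
    then have x: "x \<in> {a..b}" and nd: "\<not> (F has_vector_derivative f x) (at x within {a..b})" by auto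
    from nd obtain e where e: "e > 0" "\<And>d. d > 0 \<Longrightarrow> \<exists>y\<in>{a..b}. norm (y - x) < d \<and>
        norm (F y - F x - (y - x) *\<^sub>R f x) > e * norm (y - x)"
      unfolding has_vector_derivative_def has_derivative_within_alt
      using bounded_linear_scaleR_left by (metis not_le)
    obtain m where m: "inverse (real (Suc m)) < e" using reals_Archimedean e(1) by blast
    have "x \<in> B (inverse (real (Suc m)))"
      unfolding B_def
    proof (intro CollectI conjI x allI impI)
      fix d :: real assume "d > 0"
      then obtain y where y: "y \<in> {a..b}" "\<bar>y - x\<bar> < d" "norm (F y - F x - (y - x) *\<^sub>R f x) > e * \<bar>y - x\<bar>"
        using e(2) unfolding real_norm_def by blast
      moreover have "inverse (real (Suc m)) * \<bar>y - x\<bar> \<le> e * \<bar>y - x\<bar>"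
        using m by (intro mult_right_mono) auto
      ultimately show "\<exists>y\<in>{a..b}. \<bar>y - x\<bar> < d \<and>
           norm (F y - F x - (y - x) *\<^sub>R f x) > inverse (real (Suc m)) * \<bar>y - x\<bar>" by force
    qed
    then show "x \<in> (\<Union>m. B (inverse (real (Suc m))))" by blast
  qed
  ultimately show ?thesis
    unfolding eventually_ae_filter_negligible F_def by blast
qed

section \<open>Absolutely continuous functions\<close>

text \<open>\<open>AC\<close> numbers its intervals by naturals; the intervals met below are members
  of divisions and tagged divisions. With an arbitrary finite index set they can index themselves,
  and \<open>AC_D\<close> pays for the renumbering once.\<close>

definition nonoverlapping :: "'i set \<Rightarrow> ('i \<Rightarrow> real) \<Rightarrow> ('i \<Rightarrow> real) \<Rightarrow> bool" where
  "nonoverlapping I a b \<longleftrightarrow> finite I \<and> (\<forall>i\<in>I. 0 \<le> a i \<and> a i \<le> b i \<and> b i \<le> 1) \<and>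
     (\<forall>i\<in>I. \<forall>j\<in>I. i \<noteq> j \<longrightarrow> b i \<le> a j \<or> b j \<le> a i)"

lemma AC_nonoverlapping:
  "AC g \<longleftrightarrow> (\<forall>e>0. \<exists>d>0. \<forall>(m::nat) a b. nonoverlapping {..<m} a b \<longrightarrow> (\<Sum>i<m. b i - a i) < d
      \<longrightarrow> (\<Sum>i<m. norm (g (b i) - g (a i))) < e)"
  unfolding AC_def nonoverlapping_def by (simp add: Ball_def conj_assoc imp_conjL)

lemma AC_D:
  assumes "AC g" "e > 0"
  shows "\<exists>d>0. \<forall>(I::'i set) a b. nonoverlapping I a b \<longrightarrow> (\<Sum>i\<in>I. b i - a i) < d
      \<longrightarrow> (\<Sum>i\<in>I. norm (g (b i) - g (a i))) < e"
proof -
  obtain d where d: "d > 0" and D: "\<forall>(m::nat) a b. nonoverlapping {..<m} a b \<longrightarrow> (\<Sum>i<m. b i - a i) < d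
      \<longrightarrow> (\<Sum>i<m. norm (g (b i) - g (a i))) < e"
    using assms unfolding AC_nonoverlapping by blast
  show ?thesis
  proof (intro exI[of _ d] conjI d allI impI)
    fix I :: "'i set" and a b
    assume I: "nonoverlapping I a b" and s: "(\<Sum>i\<in>I. b i - a i) < d"
    obtain h where h: "bij_betw h {..<card I} I"
      using ex_bij_betw_nat_finite[of I] I by (auto simp: atLeast0LessThan nonoverlapping_def)
    have hI: "h i \<in> I" if "i < card I" for i using h that by (auto simp: bij_betw_def)
    have hn: "h i \<noteq> h j" if "i < card I" "j < card I" "i \<noteq> j" for i j
      using h that by (auto simp: bij_betw_def inj_on_def)
    have "nonoverlapping {..<card I} (a \<circ> h) (b \<circ> h)"
      using I hI hn by (auto simp: nonoverlapping_def)
    moreover have "(\<Sum>i<card I. (b \<circ> h) i - (a \<circ> h) i) < d"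
      using s sum.reindex_bij_betw[OF h, of "\<lambda>i. b i - a i"] by simp
    ultimately have "(\<Sum>i<card I. norm (g ((b \<circ> h) i) - g ((a \<circ> h) i))) < e"
      using D by blast
    then show "(\<Sum>i\<in>I. norm (g (b i) - g (a i))) < e"
      using sum.reindex_bij_betw[OF h, of "\<lambda>i. norm (g (b i) - g (a i))"] by simp
  qed
qed

lemma AC_continuous_on:
  assumes "AC g" shows "continuous_on {0..1} g"
  unfolding continuous_on_iff
proof (intro ballI allI impI)
  fix x :: real and e :: real assume x: "x \<in> {0..1}" and e: "e > 0"
  obtain d where d: "d > 0" and D: "\<forall>(I::unit set) a b. nonoverlapping I a b \<longrightarrow> (\<Sum>i\<in>I. b i - a i) < d
      \<longrightarrow> (\<Sum>i\<in>I. norm (g (b i) - g (a i))) < e"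
    using AC_D[OF assms e] by blast
  have "dist (g y) (g x) < e" if "y \<in> {0..1}" "dist y x < d" for y
    using D[THEN spec[of _ UNIV], THEN spec[of _ "\<lambda>_. min x y"], THEN spec[of _ "\<lambda>_. max x y"]] that x
    by (cases "x \<le> y") (auto simp: min_def max_def dist_norm norm_minus_commute nonoverlapping_def)
  then show "\<exists>d>0. \<forall>y\<in>{0..1}. dist y x < d \<longrightarrow> dist (g y) (g x) < e"
    using d by blast
qed

lemma AC_bounded:
  assumes "AC g" obtains M where "M > 0" "\<And>x. x \<in> {0..1} \<Longrightarrow> norm (g x) \<le> M"
proof -
  have "bounded (g ` {0..1})"
    using AC_continuous_on[OF assms] by (intro compact_imp_bounded compact_continuous_image) auto
  then show ?thesis using that by (auto simp: bounded_pos)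
qed

text \<open>A single criterion on increments, from which congruence, sums and products follow
  without handling families of intervals again.\<close>

lemma AC_dominated:
  fixes g :: "real \<Rightarrow> 'a::real_normed_vector" and f :: "real \<Rightarrow> 'b::real_normed_vector"
    and h :: "real \<Rightarrow> 'c::real_normed_vector"
  assumes "AC f" "AC h" and C: "C \<ge> 0"
    and le: "\<And>x y. 0 \<le> x \<Longrightarrow> x \<le> y \<Longrightarrow> y \<le> 1 \<Longrightarrow>
        norm (g y - g x) \<le> C * (norm (f y - f x) + norm (h y - h x))"
  shows "AC g"
  unfolding AC_nonoverlapping
proof (intro allI impI)
  fix e :: real assume e: "e > 0"
  \<comment> \<open>Two sums, each below \<open>e'\<close> and weighted by C, give C * e / (C + 1) <
    e; the summand 1 keeps the denominator positive for C = 0.\<close>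
  define e' where "e' = e / (2 * (C + 1))"
  have e': "e' > 0" using e C by (simp add: e'_def)
  obtain d1 where d1: "d1 > 0" and D1: "\<forall>(I::nat set) a b. nonoverlapping I a b \<longrightarrow> (\<Sum>i\<in>I. b i - a i) < d1
      \<longrightarrow> (\<Sum>i\<in>I. norm (f (b i) - f (a i))) < e'"
    using AC_D[OF \<open>AC f\<close> e'] by blast
  obtain d2 where d2: "d2 > 0" and D2: "\<forall>(I::nat set) a b. nonoverlapping I a b \<longrightarrow> (\<Sum>i\<in>I. b i - a i) < d2
      \<longrightarrow> (\<Sum>i\<in>I. norm (h (b i) - h (a i))) < e'"
    using AC_D[OF \<open>AC h\<close> e'] by blast
  show "\<exists>d>0. \<forall>(m::nat) a b. nonoverlapping {..<m} a b \<longrightarrow> (\<Sum>i<m. b i - a i) < d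
      \<longrightarrow> (\<Sum>i<m. norm (g (b i) - g (a i))) < e"
  proof (intro exI[of _ "min d1 d2"] conjI allI impI)
    fix m :: nat and a b :: "nat \<Rightarrow> real"
    assume ab: "nonoverlapping {..<m} a b" and s: "(\<Sum>i<m. b i - a i) < min d1 d2"
    have 1: "(\<Sum>i<m. norm (f (b i) - f (a i))) < e'" using D1 ab s by simp
    have 2: "(\<Sum>i<m. norm (h (b i) - h (a i))) < e'" using D2 ab s by simp
    have "(\<Sum>i<m. norm (g (b i) - g (a i))) \<le> (\<Sum>i<m. C * (norm (f (b i) - f (a i)) + norm (h (b i) - h (a i))))"
      using ab le by (intro sum_mono) (auto simp: nonoverlapping_def)
    also have "\<dots> = C * ((\<Sum>i<m. norm (f (b i) - f (a i))) + (\<Sum>i<m. norm (h (b i) - h (a i))))"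
      by (simp only: sum.distrib[symmetric] sum_distrib_left)
    also have "\<dots> \<le> C * (2 * e')"
      using 1 2 C by (intro mult_left_mono) auto
    also have "\<dots> < e"
      using C e by (simp add: e'_def field_simps)
    finally show "(\<Sum>i<m. norm (g (b i) - g (a i))) < e" .
  qed (use d1 d2 in auto)
qed

section \<open>Examples and closure properties of absolutely continuous functions\<close>

lemma AC_const: "AC (\<lambda>x. c)"
  unfolding AC_nonoverlapping by (auto intro!: exI[of _ 1])

lemma AC_of_real: "AC complex_of_real"
  unfolding AC_nonoverlapping
proof (intro allI impI)
  fix e :: real assume e: "e > 0"
  have "(\<Sum>i<m. norm (complex_of_real (b i) - complex_of_real (a i))) = (\<Sum>i<m. b i - a i)"
    if "nonoverlapping {..<m} a b" for m and a b :: "nat \<Rightarrow> real"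
    using that by (intro sum.cong) (auto simp: nonoverlapping_def simp flip: of_real_diff)
  then show "\<exists>d>0. \<forall>(m::nat) a b. nonoverlapping {..<m} a b \<longrightarrow> (\<Sum>i<m. b i - a i) < d
      \<longrightarrow> (\<Sum>i<m. norm (complex_of_real (b i) - complex_of_real (a i))) < e"
    using e by (intro exI[of _ e]) auto
qed

lemma AC_cong:
  assumes "\<And>x. x \<in> {0..1} \<Longrightarrow> g x = h x" "AC g" shows "AC h"
  by (rule AC_dominated[OF assms(2) assms(2), of 1]) (use assms(1) in auto)

lemma AC_add: assumes "AC g" "AC h" shows "AC (\<lambda>x. g x + h x)"
  by (rule AC_dominated[OF assms, of 1]) (auto simp: norm_diff_triangle_ineq)

lemma AC_mult:
  fixes g h :: "real \<Rightarrow> complex"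
  assumes "AC g" "AC h" shows "AC (\<lambda>x. g x * h x)"
proof -
  obtain M where M: "M > 0" "\<And>x. x \<in> {0..1} \<Longrightarrow> norm (g x) \<le> M"
    using AC_bounded[OF assms(1)] by blast
  obtain N where N: "N > 0" "\<And>x. x \<in> {0..1} \<Longrightarrow> norm (h x) \<le> N"
    using AC_bounded[OF assms(2)] by blast
  show ?thesis
  proof (rule AC_dominated[OF assms, of "max M N"])
    fix x y :: real assume xy: "0 \<le> x" "x \<le> y" "y \<le> 1"
    have "g y * h y - g x * h x = (g y - g x) * h y + g x * (h y - h x)" by (simp add: algebra_simps)
    then have "norm (g y * h y - g x * h x) \<le> norm (g y - g x) * norm (h y) + norm (g x) * norm (h y - h x)"
      by (metis norm_mult norm_triangle_ineq)
    also have "\<dots> \<le> norm (g y - g x) * max M N + max M N * norm (h y - h x)"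
      using M(2)[of x] N(2)[of y] xy by (intro add_mono mult_left_mono mult_right_mono) auto
    finally show "norm (g y * h y - g x * h x) \<le> max M N * (norm (g y - g x) + norm (h y - h x))"
      by (simp add: algebra_simps)
  qed (use M in auto)
qed

lemma AC_sum:
  fixes g :: "'i \<Rightarrow> real \<Rightarrow> complex"
  assumes "\<And>i. i \<in> S \<Longrightarrow> AC (g i)" shows "AC (\<lambda>x. \<Sum>i\<in>S. g i x)"
  using assms by (induction S rule: infinite_finite_induct) (auto intro: AC_const AC_add)

lemma AC_power:
  fixes g :: "real \<Rightarrow> complex"
  assumes "AC g" shows "AC (\<lambda>x. g x ^ m)"
  by (induction m) (auto intro: AC_const AC_mult assms)

subsection \<open>The fundamental theorem of calculus\<close>

text \<open>The gauge treats two kinds of tags differently. At a point of differentiability the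
  increment over a small interval is close to derivative times length. Tags in the exceptional null
  set are confined to an open set whose measure is below the \<delta> of absolute continuity, so the
  increments there are small in total; setting the derivative to 0 on this set leaves nothing else.
  Integrability of h is not presupposed: the gauge integral delivers it.\<close>

lemma AC_has_integral_derivative:
  fixes g :: "real \<Rightarrow> complex"
  assumes g: "AC g" and h: "is_deriv g h" and cd: "0 \<le> c" "c \<le> d" "d \<le> 1"
  shows "(h has_integral (g d - g c)) {c..d}"
proof -
  obtain N where N: "negligible N" and hN: "\<And>x. x \<in> {0..1} \<Longrightarrow> x \<notin> N \<Longrightarrow> (g has_vector_derivative h x) (at x within {0..1})"
    using h unfolding is_deriv_def eventually_ae_filter_negligible by blast
  define h' where "h' = (\<lambda>x. if x \<in> N then 0 else h x)"
  have "(h' has_integral (g d - g c)) (cbox c d)"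
    unfolding has_integral
  proof (intro allI impI)
    fix e :: real assume e: "e > 0"
    obtain \<delta> where \<delta>: "\<delta> > 0" and D: "\<forall>(I::(real \<times> real set) set) a b. nonoverlapping I a b \<longrightarrow>
        (\<Sum>i\<in>I. b i - a i) < \<delta> \<longrightarrow> (\<Sum>i\<in>I. norm (g (b i) - g (a i))) < e / 2"
      using AC_D[OF g half_gt_zero[OF e]] by blast
    obtain U where U: "open U" "N \<subseteq> U" "U \<in> lmeasurable" "measure lebesgue U < \<delta>"
    proof -
      obtain U where U: "open U" "N \<subseteq> U" "U - N \<in> lmeasurable" "emeasure lebesgue (U - N) < ennreal \<delta>"
        using sets_lebesgue_outer_open[OF negligible_imp_sets[OF N] \<delta>] by metis
      have "(U - N) \<union> N = U" using U by blast
      then have "U \<in> lmeasurable" using fmeasurable.Un[OF U(3) negligible_imp_measurable[OF N]] by simp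
      moreover have "measure lebesgue U \<le> measure lebesgue (U - N)"
        using measure_Un_le[of "U - N" lebesgue N] U(3) N \<open>(U - N) \<union> N = U\<close>
        by (simp add: fmeasurableD negligible_imp_sets negligible_imp_measure0)
      moreover have "measure lebesgue (U - N) < \<delta>"
        using U(3,4) by (simp add: emeasure_eq_measure2 ennreal_less_iff)
      ultimately show ?thesis using that U by auto
    qed
    \<comment> \<open>The errors at good tags add up to at most \<epsilon> * (d - c), one half of e;
      the summand 1 covers c = d.\<close>
    define \<epsilon> where "\<epsilon> = e / (2 * (d - c + 1))"
    have \<epsilon>: "\<epsilon> > 0" using e cd by (simp add: \<epsilon>_def)
    have "\<exists>r>0. \<forall>y\<in>{0..1}. \<bar>y - x\<bar> < r \<longrightarrow> norm (g y - g x - (y - x) *\<^sub>R h x) \<le> \<epsilon> * \<bar>y - x\<bar>"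
      if "x \<in> {0..1}" "x \<notin> N" for x
      using hN[OF that] \<epsilon> unfolding has_vector_derivative_def has_derivative_within_alt real_norm_def by blast
    then obtain r where r: "\<And>x. x \<in> {0..1} \<Longrightarrow> x \<notin> N \<Longrightarrow> r x > 0"
      "\<And>x y. x \<in> {0..1} \<Longrightarrow> x \<notin> N \<Longrightarrow> y \<in> {0..1} \<Longrightarrow> \<bar>y - x\<bar> < r x \<Longrightarrow> norm (g y - g x - (y - x) *\<^sub>R h x) \<le> \<epsilon> * \<bar>y - x\<bar>"
      by metis
    \<comment> \<open>The last case is never met by a tag in [c,d]; it only completes the
      gauge.\<close>
    define \<gamma> where "\<gamma> = (\<lambda>x. if x \<in> N then U else if x \<in> {0..1} then ball x (r x) else ball x 1)"
    have "gauge \<gamma>" using U r unfolding gauge_def \<gamma>_def by auto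
    moreover have est: "norm ((\<Sum>(x,k)\<in>\<D>. measure lborel k *\<^sub>R h' x) - (g d - g c)) < e"
      if \<D>: "\<D> tagged_division_of cbox c d" and fine: "\<gamma> fine \<D>" for \<D>
    proof -
      have fin: "finite \<D>" using \<D> by blast
      have elt: "\<exists>u v. k = {u..v} \<and> c \<le> u \<and> u \<le> x \<and> x \<le> v \<and> v \<le> d" if xk: "(x,k) \<in> \<D>" for x k
      proof -
        obtain u v where "k = cbox u v" using tagged_division_ofD(4)[OF \<D> xk] by blast
        moreover have "x \<in> k" "k \<subseteq> cbox c d" using tagged_division_ofD(2,3)[OF \<D> xk] by auto
        ultimately show ?thesis by (intro exI[of _ u] exI[of _ v]) auto
      qed
      have Sup: "Sup k = v" "Inf k = u" if "k = {u..v}" "u \<le> v" for k and u v :: real using that by auto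
      define T where "T = (\<lambda>(x::real,k::real set). measure lborel k *\<^sub>R h' x - (g (Sup k) - g (Inf k)))"
      have "(\<Sum>(x,k)\<in>\<D>. measure lborel k *\<^sub>R h' x) - (g d - g c) = (\<Sum>z\<in>\<D>. T z)"
        using additive_tagged_division_1[of c d \<D> g] \<D> cd
        by (simp add: T_def split_def sum_subtractf)
      also have "\<dots> = (\<Sum>z\<in>{z\<in>\<D>. fst z \<in> N}. T z) + (\<Sum>z\<in>{z\<in>\<D>. fst z \<notin> N}. T z)"
        using fin by (subst sum.union_disjoint[symmetric]) (auto intro!: sum.cong)
      finally have eq: "(\<Sum>(x,k)\<in>\<D>. measure lborel k *\<^sub>R h' x) - (g d - g c) = \<dots>" .
      have 2: "norm (\<Sum>z\<in>{z\<in>\<D>. fst z \<notin> N}. T z) \<le> \<epsilon> * (d - c)"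
      proof -
        have "norm (\<Sum>z\<in>{z\<in>\<D>. fst z \<notin> N}. T z) \<le> (\<Sum>z\<in>{z\<in>\<D>. fst z \<notin> N}. \<epsilon> * measure lborel (snd z))"
        proof (rule sum_norm_le)
          fix z assume "z \<in> {z\<in>\<D>. fst z \<notin> N}"
          then obtain x k where z: "z = (x,k)" "(x,k) \<in> \<D>" "x \<notin> N" by (cases z) auto
          obtain u v where k: "k = {u..v}" "c \<le> u" "u \<le> x" "x \<le> v" "v \<le> d" using elt[OF z(2)] by blast
          have x01: "x \<in> {0..1}" "u \<in> {0..1}" "v \<in> {0..1}" using k cd by auto
          have sub: "k \<subseteq> ball x (r x)" using fine z x01 by (force simp: fine_def \<gamma>_def)
          have "u \<in> k" "v \<in> k" using k by auto
          then have "\<bar>u - x\<bar> < r x" "\<bar>v - x\<bar> < r x" using sub by (auto simp: dist_real_def subset_iff)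
          then have "norm (g u - g x - (u - x) *\<^sub>R h x) \<le> \<epsilon> * \<bar>u - x\<bar>" "norm (g v - g x - (v - x) *\<^sub>R h x) \<le> \<epsilon> * \<bar>v - x\<bar>"
            using r(2) x01 z(3) by blast+
          \<comment> \<open>Splitting at the tag works because u \<le> x \<le> v, so the two
            distances to x add up to the length of the interval.\<close>
          moreover have "T z = (g u - g x - (u - x) *\<^sub>R h x) - (g v - g x - (v - x) *\<^sub>R h x)"
            using k z(3) by (simp add: T_def z h'_def algebra_simps)
          ultimately have "norm (T z) \<le> \<epsilon> * \<bar>u - x\<bar> + \<epsilon> * \<bar>v - x\<bar>"
            using norm_triangle_ineq4 order_trans add_mono by metis
          then show "norm (T z) \<le> \<epsilon> * measure lborel (snd z)" using k by (simp add: z algebra_simps)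
        qed
        also have "\<dots> \<le> (\<Sum>z\<in>\<D>. \<epsilon> * measure lborel (snd z))"
          using fin \<epsilon> by (intro sum_mono2) auto
        also have "\<dots> = \<epsilon> * (d - c)"
          using additive_content_tagged_division[OF \<D>] cd by (simp add: split_def flip: sum_distrib_left)
        finally show ?thesis .
      qed
      \<comment> \<open>A degenerate interval may lie inside another one, since disjointness of
        interiors does not see it. Its term vanishes, and without such intervals the family is
        non-overlapping in the sense of \<open>AC_D\<close>.\<close>
      define I where "I = {z\<in>\<D>. fst z \<in> N \<and> Inf (snd z) < Sup (snd z)}"
      have elI: "\<exists>u v. k = {u..v} \<and> u < v \<and> c \<le> u \<and> u \<le> x \<and> x \<le> v \<and> v \<le> d" if "(x,k) \<in> I" for x k
        using elt[of x k] that by (fastforce simp: I_def)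
      have 1: "norm (\<Sum>z\<in>{z\<in>\<D>. fst z \<in> N}. T z) < e / 2"
      proof -
        have "(\<Sum>z\<in>{z\<in>\<D>. fst z \<in> N}. T z) = (\<Sum>z\<in>I. T z)"
        proof (rule sum.mono_neutral_right)
          show "\<forall>z\<in>{z\<in>\<D>. fst z \<in> N} - I. T z = 0"
          proof
            fix z assume z: "z \<in> {z\<in>\<D>. fst z \<in> N} - I"
            obtain x k where xk: "z = (x,k)" by (cases z)
            then obtain u v where k: "k = {u..v}" "u \<le> x" "x \<le> v" using elt[of x k] z by blast
            then have "u = v" using z by (auto simp: I_def xk)
            then show "T z = 0" using z k by (simp add: xk T_def h'_def)
          qed
        qed (use fin in \<open>auto simp: I_def\<close>)
        also have "norm \<dots> \<le> (\<Sum>z\<in>I. norm (g (Sup (snd z)) - g (Inf (snd z))))"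
          by (rule sum_norm_le) (auto simp: I_def T_def h'_def norm_minus_commute)
        also have "\<dots> < e / 2"
        proof (rule D[THEN spec, THEN spec, THEN spec, THEN mp, THEN mp])
          have "finite I" using fin by (simp add: I_def)
          moreover have "0 \<le> Inf (snd z) \<and> Inf (snd z) \<le> Sup (snd z) \<and> Sup (snd z) \<le> 1" if zI: "z \<in> I" for z
          proof -
            obtain x k where xk: "z = (x,k)" by (cases z)
            then obtain u v where k: "k = {u..v}" "u < v" "c \<le> u" "v \<le> d" using elI zI by blast
            then show ?thesis using cd by (simp add: xk)
          qed
          moreover have "Sup (snd z) \<le> Inf (snd w) \<or> Sup (snd w) \<le> Inf (snd z)" if zw: "z \<in> I" "w \<in> I" "z \<noteq> w" for z w
          proof -
            obtain x k y l where xk: "z = (x,k)" "w = (y,l)" by (metis surj_pair)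
            then obtain u v where k: "k = {u..v}" "u < v" using elI zw by blast
            obtain u' v' where l: "l = {u'..v'}" "u' < v'" using elI zw xk by blast
            have "interior k \<inter> interior l = {}"
              using tagged_division_ofD(5)[OF \<D>, of x k y l] zw xk by (auto simp: I_def)
            then have "{max u u'<..<min v v'} = {}" by (auto simp: k l)
            then have "\<not> max u u' < min v v'" using greaterThanLessThan_empty_iff2 dense by fastforce
            then show ?thesis using k l by (auto simp: xk max_def min_def split: if_splits)
          qed
          ultimately show "nonoverlapping I (\<lambda>z. Inf (snd z)) (\<lambda>z. Sup (snd z))"
            unfolding nonoverlapping_def by blast
          have "(\<Sum>z\<in>I. Sup (snd z) - Inf (snd z)) = (\<Sum>z\<in>I. measure lebesgue (snd z))"
            using elI by (intro sum.cong) (force simp: split_paired_all)+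
          also have "\<dots> = (\<Sum>k\<in>snd ` I. measure lebesgue k)"
          proof (rule sum.reindex[symmetric, unfolded comp_def], rule inj_onI)
            fix z w assume zw: "z \<in> I" "w \<in> I" "snd z = snd w"
            obtain x k y where xk: "z = (x,k)" "w = (y,k)" using zw by (metis surj_pair snd_conv)
            obtain u v where k: "k = {u..v}" "u < v" using elI zw xk by blast
            have "interior k \<noteq> {}" using k by simp
            then show "z = w"
              using tagged_division_ofD(5)[OF \<D>, of x k y k] zw xk by (auto simp: I_def)
          qed
          also have "\<dots> = measure lebesgue (\<Union>(snd ` I))"
          proof (rule content_division)
            have "I tagged_partial_division_of cbox c d"
              using \<D> tagged_partial_division_subset[of \<D> "cbox c d" I] by (auto simp: I_def tagged_division_of_def)
            then show "(snd ` I) division_of \<Union>(snd ` I)"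
              using tagged_partial_division_of_Union_self division_of_tagged_division by blast
          qed
          also have "\<dots> \<le> measure lebesgue U"
          proof (rule measure_mono_fmeasurable[OF _ _ U(3)])
            have "k \<subseteq> U" if "(x,k) \<in> I" for x k
              using fine that unfolding I_def fine_def \<gamma>_def by fastforce
            then show "\<Union>(snd ` I) \<subseteq> U" by fastforce
            show "\<Union>(snd ` I) \<in> sets lebesgue"
            proof (rule sets.finite_Union)
              have "k \<in> sets lebesgue" if "(x,k) \<in> I" for x k
                using elI[OF that] by auto
              then show "snd ` I \<subseteq> sets lebesgue" by auto
            qed (use fin in \<open>simp add: I_def\<close>)
          qed
          also have "\<dots> < \<delta>" by (rule U)
          finally show "(\<Sum>z\<in>I. Sup (snd z) - Inf (snd z)) < \<delta>" .
        qed
        finally show ?thesis .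
      qed
      have "norm ((\<Sum>(x,k)\<in>\<D>. measure lborel k *\<^sub>R h' x) - (g d - g c)) < e / 2 + \<epsilon> * (d - c)"
        unfolding eq using 1 2 norm_triangle_ineq by (smt (verit))
      also have "\<epsilon> * (d - c) \<le> e / 2" using cd e by (simp add: \<epsilon>_def field_simps)
      finally show ?thesis by simp
    qed
    ultimately show "\<exists>\<gamma>. gauge \<gamma> \<and> (\<forall>\<D>. \<D> tagged_division_of cbox c d \<and> \<gamma> fine \<D> \<longrightarrow>
        norm ((\<Sum>(x,k)\<in>\<D>. measure lborel k *\<^sub>R h' x) - (g d - g c)) < e)"
      using est by (intro exI[of _ \<gamma>] conjI allI impI) auto
  qed
  then have "(h has_integral (g d - g c)) (cbox c d)"
    by (rule has_integral_spike[OF N, rotated]) (auto simp: h'_def)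
  then show ?thesis by simp
qed

subsection \<open>Bounded variation\<close>

text \<open>Clamping t to the i-th cell of the grid of mesh 1/N cuts an increment of G at the grid
  points. This spares a common refinement of the grid with a given division.\<close>

lemma telescope_clamped:
  fixes G :: "real \<Rightarrow> 'a::real_normed_vector"
  assumes N: "N > 0" and t: "0 \<le> t"
  shows "(\<Sum>i<M. G (max (real i / real N) (min t (real (Suc i) / real N))) - G (real i / real N))
       = G (min t (real M / real N)) - G 0"
proof (induction M)
  case (Suc M)
  have le: "real M / real N \<le> real (Suc M) / real N" using N by (simp add: field_simps)
  have "G (max (real M / real N) (min t (real (Suc M) / real N))) - G (real M / real N)
      = G (min t (real (Suc M) / real N)) - G (min t (real M / real N))"
    using le by (cases "t \<le> real M / real N") (auto simp: min_def max_def)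
  then show ?case using Suc by simp
qed (use t in auto)

lemma sum_division_telescope:
  fixes G :: "real \<Rightarrow> 'a::real_normed_vector"
  assumes d: "d division_of {0..1}"
  shows "(\<Sum>K\<in>d. G (Sup K) - G (Inf K)) = G 1 - G 0"
proof -
  define p where "p = (\<lambda>K::real set. (Inf K, K)) ` d"
  have cb: "\<exists>u v. K = {u..v} \<and> u \<le> v" if "K \<in> d" for K
    using division_ofD(3,4)[OF d that] by (metis atLeastatMost_empty_iff cbox_interval)
  have "p tagged_division_of {0..1}"
    unfolding tagged_division_of p_def
  proof (intro conjI allI impI)
    show "finite ((\<lambda>K. (Inf K, K)) ` d)" using d by auto
  next
    fix x K assume xk: "(x,K) \<in> (\<lambda>K. (Inf K, K)) ` d"
    then obtain u v where "K = {u..v}" "u \<le> v" using cb by blast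
    then show "x \<in> K" "\<exists>a b. K = cbox a b" using xk by auto
    show "K \<subseteq> {0..1}" using xk division_ofD(2)[OF d] by blast
  next
    fix x1 K1 x2 K2
    assume "(x1,K1) \<in> (\<lambda>K. (Inf K, K)) ` d \<and> (x2,K2) \<in> (\<lambda>K. (Inf K, K)) ` d \<and> (x1,K1) \<noteq> (x2,K2)"
    then have "K1 \<in> d" "K2 \<in> d" "K1 \<noteq> K2" by auto
    then show "interior K1 \<inter> interior K2 = {}" using division_ofD(5)[OF d] by blast
  next
    have "{K. \<exists>x. (x,K) \<in> (\<lambda>K. (Inf K, K)) ` d} = d" by auto
    then show "\<Union>{K. \<exists>x. (x,K) \<in> (\<lambda>K. (Inf K, K)) ` d} = {0..1}" using division_ofD(6)[OF d] by simp
  qed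
  then have "(\<Sum>(x,K)\<in>p. G (Sup K) - G (Inf K)) = G 1 - G 0"
    by (intro additive_tagged_division_1) auto
  moreover have "inj_on (\<lambda>K::real set. (Inf K, K)) d" by (auto simp: inj_on_def)
  ultimately show ?thesis by (simp add: p_def sum.reindex)
qed

text \<open>In each of N cells shorter than \<delta>, the clamped intervals of any division have
  total length below \<delta>, so the variation there is below 1; N bounds the whole. The
  formulation by divisions is the one needed to pass from gauge to absolute integrability.\<close>

lemma AC_bounded_variation:
  assumes g: "AC g"
  shows "\<exists>B. \<forall>d. d division_of {0..1} \<longrightarrow> (\<Sum>K\<in>d. norm (g (Sup K) - g (Inf K))) \<le> B"
proof -
  obtain \<delta> where \<delta>: "\<delta> > 0" and D: "\<forall>(I::real set set) a b. nonoverlapping I a b \<longrightarrow>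
        (\<Sum>i\<in>I. b i - a i) < \<delta> \<longrightarrow> (\<Sum>i\<in>I. norm (g (b i) - g (a i))) < 1"
    using AC_D[OF g zero_less_one] by blast
  obtain N0 where N0: "inverse (real (Suc N0)) < \<delta>" using reals_Archimedean[OF \<delta>] by blast
  define N where "N = Suc N0"
  have N: "N > 0" "1 / real N < \<delta>" using N0 by (auto simp: N_def inverse_eq_divide)
  define c where "c = (\<lambda>i t. max (real i / real N) (min t (real (Suc i) / real N)))"
  have "(\<Sum>K\<in>d. norm (g (Sup K) - g (Inf K))) \<le> real N" if d: "d division_of {0..1}" for d
  proof -
    have fin: "finite d" using d by auto
    have cb: "\<exists>u v. K = {u..v} \<and> 0 \<le> u \<and> u \<le> v \<and> v \<le> 1" if K: "K \<in> d" for K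
    proof -
      obtain u v where "K = {u..v}" using division_ofD(4)[OF d K] by auto
      moreover have "K \<noteq> {}" "K \<subseteq> {0..1}" using division_ofD(2,3)[OF d K] by auto
      ultimately show ?thesis by auto
    qed
    have mono: "c i u \<le> c i v" if "u \<le> v" for i u v using that by (auto simp: c_def min_def max_def)
    have c01: "0 \<le> c i u" "c i u \<le> 1" if "i < N" "0 \<le> u" "u \<le> 1" for i u
      using that N by (auto simp: c_def field_simps min_def max_def)
    have tel: "(\<Sum>i<N. g (c i t) - g (real i / real N)) = g t - g 0" if "0 \<le> t" "t \<le> 1" for t
      using telescope_clamped[OF N(1) that(1), of g N] that N by (simp add: c_def)
    have "norm (g (Sup K) - g (Inf K)) \<le> (\<Sum>i<N. norm (g (c i (Sup K)) - g (c i (Inf K))))" if K: "K \<in> d" for K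
    proof -
      obtain u v where k: "K = {u..v}" "0 \<le> u" "u \<le> v" "v \<le> 1" using cb K by blast
      have "g v - g u = (\<Sum>i<N. g (c i v) - g (c i u))"
      proof -
        have "(\<Sum>i<N. g (c i v) - g (c i u))
            = (\<Sum>i<N. g (c i v) - g (real i / real N)) - (\<Sum>i<N. g (c i u) - g (real i / real N))"
          by (simp add: sum_subtractf)
        also have "\<dots> = g v - g u" using tel[of u] tel[of v] k by simp
        finally show ?thesis by simp
      qed
      then show ?thesis using k by (simp add: norm_sum)
    qed
    then have "(\<Sum>K\<in>d. norm (g (Sup K) - g (Inf K))) \<le> (\<Sum>K\<in>d. \<Sum>i<N. norm (g (c i (Sup K)) - g (c i (Inf K))))"
      by (rule sum_mono)
    also have "\<dots> = (\<Sum>i<N. \<Sum>K\<in>d. norm (g (c i (Sup K)) - g (c i (Inf K))))" by (rule sum.swap)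
    also have "\<dots> \<le> (\<Sum>i<N. 1)"
    proof (rule sum_mono)
      fix i assume i: "i \<in> {..<N}"
      define I where "I = {K\<in>d. Inf K < Sup K}"
      have "(\<Sum>K\<in>d. norm (g (c i (Sup K)) - g (c i (Inf K)))) = (\<Sum>K\<in>I. norm (g (c i (Sup K)) - g (c i (Inf K))))"
        using fin cb by (intro sum.mono_neutral_right) (fastforce simp: I_def)+
      also have "\<dots> < 1"
      proof (rule D[THEN spec, THEN spec, THEN spec, THEN mp, THEN mp])
        have sep: "Sup K \<le> Inf L \<or> Sup L \<le> Inf K" if KL: "K \<in> I" "L \<in> I" "K \<noteq> L" for K L
        proof -
          have d2: "K \<in> d" "L \<in> d" using KL by (auto simp: I_def)
          obtain u v where k: "K = {u..v}" "u \<le> v" using cb[OF d2(1)] by blast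
          obtain u' v' where l: "L = {u'..v'}" "u' \<le> v'" using cb[OF d2(2)] by blast
          have uv: "u < v" "u' < v'" using KL k l by (auto simp: I_def)
          have "interior K \<inter> interior L = {}"
            using division_ofD(5)[OF d] KL by (auto simp: I_def)
          then have "{max u u'<..<min v v'} = {}" by (auto simp: k l)
          then have "\<not> max u u' < min v v'" using greaterThanLessThan_empty_iff2 dense by fastforce
          then show ?thesis using k l uv by (auto simp: max_def min_def split: if_splits)
        qed
        have K01: "0 \<le> Inf K \<and> Inf K \<le> Sup K \<and> Sup K \<le> 1" if "K \<in> I" for K
        proof -
          have "K \<in> d" using that by (simp add: I_def)
          from cb[OF this] obtain u v where "K = {u..v}" "0 \<le> u" "u \<le> v" "v \<le> 1" by blast
          then show ?thesis by simp
        qed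
        show "nonoverlapping I (\<lambda>K. c i (Inf K)) (\<lambda>K. c i (Sup K))"
          unfolding nonoverlapping_def
        proof (intro conjI ballI impI)
          show "finite I" using fin by (simp add: I_def)
          show "0 \<le> c i (Inf K)" "c i (Inf K) \<le> c i (Sup K)" "c i (Sup K) \<le> 1" if "K \<in> I" for K
            using K01[OF that] c01[of i "Inf K"] c01[of i "Sup K"] i by (auto intro: mono)
          show "c i (Sup K) \<le> c i (Inf L) \<or> c i (Sup L) \<le> c i (Inf K)" if "K \<in> I" "L \<in> I" "K \<noteq> L" for K L
            using sep[OF that] mono by blast
        qed
        \<comment> \<open>The clamp itself is telescoped over the division: the total length is that
          of one cell.\<close>
        have "(\<Sum>K\<in>I. c i (Sup K) - c i (Inf K)) = (\<Sum>K\<in>d. c i (Sup K) - c i (Inf K))"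
          using fin cb by (intro sum.mono_neutral_left) (fastforce simp: I_def)+
        also have "\<dots> = c i 1 - c i 0" by (rule sum_division_telescope[OF d])
        also have "\<dots> \<le> real (Suc i) / real N - real i / real N"
          using i N by (auto simp: c_def field_simps min_def max_def)
        also have "\<dots> = 1 / real N" by (simp flip: diff_divide_distrib)
        finally show "(\<Sum>K\<in>I. c i (Sup K) - c i (Inf K)) < \<delta>" using N by simp
      qed
      finally show "(\<Sum>K\<in>d. norm (g (c i (Sup K)) - g (c i (Inf K)))) \<le> 1" by simp
    qed
    finally show ?thesis by simp
  qed
  then show ?thesis by blast
qed

text \<open>The fundamental theorem gives only gauge integrability. The integrals of h over the
  members of a division are increments of g, so bounded variation makes h absolutely
  integrable.\<close>

lemma L1_derivative_of_AC:
  assumes g: "AC g" and h: "is_deriv g h"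
  shows "L1 h"
proof -
  obtain B where B: "\<And>d. d division_of {0..1} \<Longrightarrow> (\<Sum>K\<in>d. norm (g (Sup K) - g (Inf K))) \<le> B"
    using AC_bounded_variation[OF g] by blast
  have "h absolutely_integrable_on cbox 0 1"
  proof (rule bounded_variation_absolutely_integrable_interval)
    show "h integrable_on cbox 0 1" using AC_has_integral_derivative[OF g h, of 0 1] by auto
    fix d assume d: "d division_of cbox 0 (1::real)"
    have "integral K h = g (Sup K) - g (Inf K)" if K: "K \<in> d" for K
    proof -
      obtain u v where k: "K = {u..v}" using division_ofD(4)[OF d K] by auto
      moreover have "K \<noteq> {}" "K \<subseteq> {0..1}" using division_ofD(2,3)[OF d K] by auto
      ultimately have "0 \<le> u" "u \<le> v" "v \<le> 1" by auto
      then show ?thesis using AC_has_integral_derivative[OF g h, of u v] k by (simp add: integral_unique)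
    qed
    then have "(\<Sum>K\<in>d. norm (integral K h)) = (\<Sum>K\<in>d. norm (g (Sup K) - g (Inf K)))" by simp
    also have "\<dots> \<le> B" using B d by simp
    finally show "(\<Sum>K\<in>d. norm (integral K h)) \<le> B" .
  qed
  then show ?thesis by (simp add: L1_def)
qed

section \<open>Indefinite integrals\<close>

definition Int0 :: "(real \<Rightarrow> complex) \<Rightarrow> real \<Rightarrow> complex" where
  "Int0 h x = (LINT t:{0..x}|lebesgue. h t)"

lemma L1_subinterval: "L1 h \<Longrightarrow> 0 \<le> a \<Longrightarrow> b \<le> 1 \<Longrightarrow> set_integrable lebesgue {a..b} h"
  unfolding L1_def by (rule set_integrable_subset) auto

lemma Int0_eq_integral:
  assumes "L1 h" "x \<le> 1"
  shows "Int0 h x = integral {0..x} h"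
  unfolding Int0_def by (intro set_lebesgue_integral_eq_integral L1_subinterval assms) auto

lemma AC_FTC:
  assumes g: "AC g" and h: "is_deriv g h" and x: "x \<in> {0..1}"
  shows "Int0 h x = g x - g 0"
  using AC_has_integral_derivative[OF g h, of 0 x] L1_derivative_of_AC[OF g h] x
  by (simp add: Int0_eq_integral integral_unique)

lemma Int0_at_0 [simp]: "Int0 h 0 = 0"
proof -
  have "{0} \<in> null_sets lebesgue" by (simp flip: negligible_iff_null_sets)
  then have "AE t in lebesgue. t \<notin> {0::real}" by (rule AE_not_in)
  then show ?thesis unfolding Int0_def set_lebesgue_integral_def
    by (intro integral_eq_zero_AE, elim eventually_mono) (auto simp: indicator_def)
qed

lemma is_deriv_Int0:
  assumes "L1 h" shows "is_deriv (Int0 h) h"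
proof -
  have "h integrable_on {0..1}"
    using assms set_lebesgue_integral_eq_integral(1) by (auto simp: L1_def)
  from AE_indefinite_integral_has_vector_derivative[OF this] show ?thesis
    unfolding is_deriv_def
  proof (rule eventually_mono, intro impI)
    fix x :: real assume x: "x \<in> {0..1}"
      and *: "x \<in> {0..1} \<longrightarrow> ((\<lambda>x. integral {0..x} h) has_vector_derivative h x) (at x within {0..1})"
    show "(Int0 h has_vector_derivative h x) (at x within {0..1})"
      by (rule has_vector_derivative_transform[OF x _ *[THEN mp, OF x]]) (simp add: Int0_eq_integral assms)
  qed
qed

text \<open>Half-open intervals turn non-overlapping intervals into disjoint sets, so that in the
  proof of absolute continuity the indicators sum to at most 1 at every point.\<close>

lemma Int0_diff:
  assumes h: "L1 h" and ab: "0 \<le> a" "a \<le> b" "b \<le> 1"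
  shows "Int0 h b - Int0 h a = (\<integral>x. indicator {a<..b} x *\<^sub>R h x \<partial>lebesgue)"
proof -
  have "integrable lebesgue (\<lambda>x. indicator {0..b} x *\<^sub>R h x)" "integrable lebesgue (\<lambda>x. indicator {0..a} x *\<^sub>R h x)"
    using L1_subinterval[OF h, of 0] ab by (auto simp: set_integrable_def)
  then have "Int0 h b - Int0 h a = (\<integral>x. indicator {0..b} x *\<^sub>R h x - indicator {0..a} x *\<^sub>R h x \<partial>lebesgue)"
    unfolding Int0_def set_lebesgue_integral_def by simp
  also have "\<dots> = (\<integral>x. indicator {a<..b} x *\<^sub>R h x \<partial>lebesgue)"
    using ab by (intro Bochner_Integration.integral_cong) (auto simp: indicator_def)
  finally show ?thesis .
qed

text \<open>Cut the integrand at height M: the part above has small integral, the part below is Lipschitz.\<close>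

lemma AC_Int0:
  assumes h: "L1 h" shows "AC (Int0 h)"
  unfolding AC_nonoverlapping
proof (intro allI impI)
  fix e :: real assume e: "e > 0"
  define H where "H = (\<lambda>x. indicator {0..1} x * norm (h x))"
  have Hi: "integrable lebesgue H"
    using integrable_norm[of lebesgue "\<lambda>x. indicator {0..1} x *\<^sub>R h x"] h by (simp add: H_def L1_def set_integrable_def)
  then have Hm: "H \<in> borel_measurable lebesgue" by auto
  define r where "r = (\<lambda>(k::nat) x. if H x \<le> real k then 0 else H x)"
  have H0: "H x \<ge> 0" for x by (simp add: H_def)
  have rm: "r k \<in> borel_measurable lebesgue" for k
    unfolding r_def using Hm by measurable
  have ri: "integrable lebesgue (r k)" for k
    by (rule Bochner_Integration.integrable_bound[OF Hi rm]) (auto simp: r_def H0)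
  have "(\<lambda>k. \<integral>x. r k x \<partial>lebesgue) \<longlonglongrightarrow> (\<integral>x. 0 \<partial>(lebesgue :: real measure))"
  proof (rule integral_dominated_convergence[where w = H])
    show "AE x in lebesgue. (\<lambda>k. r k x) \<longlonglongrightarrow> 0"
    proof (intro AE_I2)
      fix x
      obtain k0 where "H x \<le> real k0" using real_arch_simple by blast
      then have "eventually (\<lambda>k. r k x = 0) sequentially"
        unfolding eventually_sequentially r_def by (auto intro!: exI[of _ k0])
      then show "(\<lambda>k. r k x) \<longlonglongrightarrow> 0" by (rule tendsto_eventually)
    qed
  qed (use rm Hi H0 in \<open>auto simp: r_def\<close>)
  then have "eventually (\<lambda>k. (\<integral>x. r k x \<partial>lebesgue) < e / 2) sequentially"
    using e by (intro order_tendstoD) auto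
  then obtain k where k: "(\<integral>x. r k x \<partial>lebesgue) < e / 2" by (auto simp: eventually_sequentially)
  show "\<exists>d>0. \<forall>(m::nat) a b. nonoverlapping {..<m} a b \<longrightarrow> (\<Sum>i<m. b i - a i) < d
      \<longrightarrow> (\<Sum>i<m. norm (Int0 h (b i) - Int0 h (a i))) < e"
  \<comment> \<open>The part of the integrand below height k contributes at most k times the total
    length; the summand 1 admits k = 0.\<close>
  proof (intro exI[of _ "e / (2 * (real k + 1))"] conjI allI impI)
    show "e / (2 * (real k + 1)) > 0" using e by simp
    fix m :: nat and a b :: "nat \<Rightarrow> real"
    assume ab: "nonoverlapping {..<m} a b" and s: "(\<Sum>i<m. b i - a i) < e / (2 * (real k + 1))"
    have int: "integrable lebesgue (\<lambda>x. indicator {a i<..b i} x * r k x)" for i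
    proof (rule Bochner_Integration.integrable_bound[OF ri])
      show "(\<lambda>x. indicator {a i<..b i} x * r k x) \<in> borel_measurable lebesgue"
        by (intro borel_measurable_times borel_measurable_indicator rm) simp
    qed (auto simp: indicator_def)
    have "norm (Int0 h (b i) - Int0 h (a i)) \<le> (\<integral>x. indicator {a i<..b i} x * r k x \<partial>lebesgue) + real k * (b i - a i)"
      if i: "i < m" for i
    proof -
      have abi: "0 \<le> a i" "a i \<le> b i" "b i \<le> 1" using ab i by (auto simp: nonoverlapping_def)
      have "norm (Int0 h (b i) - Int0 h (a i)) \<le> (\<integral>x. norm (indicator {a i<..b i} x *\<^sub>R h x) \<partial>lebesgue)"
        unfolding Int0_diff[OF h abi] by (rule integral_norm_bound)
      also have "\<dots> \<le> (\<integral>x. indicator {a i<..b i} x * r k x + indicator {a i<..b i} x * real k \<partial>lebesgue)"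
      proof (rule integral_mono)
        have "set_integrable lebesgue {a i<..b i} h"
          using h unfolding L1_def by (rule set_integrable_subset) (use abi in auto)
        then show "integrable lebesgue (\<lambda>x. norm (indicator {a i<..b i} x *\<^sub>R h x))"
          unfolding set_integrable_def by (rule integrable_norm)
        show "integrable lebesgue (\<lambda>x. indicator {a i<..b i} x * r k x + indicator {a i<..b i} x * real k)"
          by (intro Bochner_Integration.integrable_add int) (simp add: emeasure_lborel_Ioc abi)
        show "norm (indicator {a i<..b i} x *\<^sub>R h x) \<le> indicator {a i<..b i} x * r k x + indicator {a i<..b i} x * real k" for x
          using abi by (auto simp: indicator_def r_def H_def)
      qed
      also have "\<dots> = (\<integral>x. indicator {a i<..b i} x * r k x \<partial>lebesgue) + real k * (b i - a i)"
        using abi by (subst Bochner_Integration.integral_add[OF int]) (auto simp: emeasure_lborel_Ioc)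
      finally show ?thesis .
    qed
    then have "(\<Sum>i<m. norm (Int0 h (b i) - Int0 h (a i)))
        \<le> (\<Sum>i<m. (\<integral>x. indicator {a i<..b i} x * r k x \<partial>lebesgue) + real k * (b i - a i))"
      by (intro sum_mono) auto
    also have "\<dots> = (\<integral>x. (\<Sum>i<m. indicator {a i<..b i} x * r k x) \<partial>lebesgue) + real k * (\<Sum>i<m. b i - a i)"
      by (subst Bochner_Integration.integral_sum) (auto simp: int sum.distrib sum_distrib_left)
    also have "\<dots> \<le> (\<integral>x. r k x \<partial>lebesgue) + real k * (\<Sum>i<m. b i - a i)"
    proof (intro add_right_mono integral_mono)
      show "integrable lebesgue (\<lambda>x. \<Sum>i<m. indicator {a i<..b i} x * r k x)" by (intro Bochner_Integration.integrable_sum int)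
      show "(\<Sum>i<m. indicator {a i<..b i} x * r k x) \<le> r k x" for x
      proof (cases "\<exists>i<m. x \<in> {a i<..b i}")
        case True
        then obtain i where i: "i < m" "x \<in> {a i<..b i}" by blast
        have "x \<notin> {a j<..b j}" if "j < m" "j \<noteq> i" for j
        proof -
          have "b i \<le> a j \<or> b j \<le> a i" using ab i that by (auto simp: nonoverlapping_def)
          then show ?thesis using i by auto
        qed
        then have eq: "(\<Sum>j<m. indicator {a j<..b j} x * r k x) = (\<Sum>j\<in>{i}. indicator {a j<..b j} x * r k x)"
          using i by (intro sum.mono_neutral_right) auto
        show ?thesis unfolding eq using i by simp
      next
        case False
        then have eq: "(\<Sum>j<m. indicator {a j<..b j} x * r k x) = 0" by (intro sum.neutral) auto
        show ?thesis unfolding eq by (simp add: r_def H0)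
      qed
    qed (rule ri)
    also have "real k * (\<Sum>i<m. b i - a i) \<le> (real k + 1) * (e / (2 * (real k + 1)))"
      using s ab by (intro mult_mono) (auto simp: nonoverlapping_def intro!: sum_nonneg)
    also have "\<dots> = e / 2" by (simp add: field_simps)
    finally show "(\<Sum>i<m. norm (Int0 h (b i) - Int0 h (a i))) < e" using k by linarith
  qed
qed

subsection \<open>Integrable and essentially bounded functions\<close>

lemma L1_cong_AE:
  fixes f g :: "real \<Rightarrow> complex"
  assumes "L1 f" "AE x\<in>{0..1} in lebesgue. f x = g x"
  shows "L1 g"
proof -
  obtain N where N: "negligible N" "{x. \<not> (x \<in> {0..1} \<longrightarrow> f x = g x)} \<subseteq> N"
    using assms(2) unfolding eventually_ae_filter_negligible by blast
  show ?thesis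
    using assms(1) unfolding L1_def by (rule absolutely_integrable_spike[OF _ N(1)]) (use N(2) in auto)
qed

lemma L1_measurable: "L1 f \<Longrightarrow> set_borel_measurable lebesgue {0..1} f"
  unfolding L1_def set_integrable_def set_borel_measurable_def by auto

lemma L1_I_bounded:
  fixes f :: "real \<Rightarrow> 'a::{banach,second_countable_topology}"
  assumes "set_borel_measurable lebesgue {0..1} f" "L1 (g :: real \<Rightarrow> real)"
    "AE x\<in>{0..1} in lebesgue. norm (f x) \<le> g x"
  shows "L1 f"
  unfolding L1_def set_integrable_def
proof (rule Bochner_Integration.integrable_bound)
  show "integrable lebesgue (\<lambda>x. indicator {0..1} x *\<^sub>R g x)"
    using assms(2) by (simp add: L1_def set_integrable_def)
  show "(\<lambda>x. indicator {0..1} x *\<^sub>R f x) \<in> borel_measurable lebesgue"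
    using assms(1) by (simp add: set_borel_measurable_def)
  show "AE x in lebesgue. norm (indicator {0..1} x *\<^sub>R f x) \<le> norm (indicator {0..1} x *\<^sub>R g x)"
    using assms(3) by eventually_elim (auto simp: indicator_def)
qed

lemma L1_const: "L1 (\<lambda>x. c)"
  unfolding L1_def set_integrable_def by auto

lemma L1_norm: "L1 f \<Longrightarrow> L1 (\<lambda>x. norm (f x))"
  unfolding L1_def by (rule set_integrable_norm)

lemma L1_cmult:
  fixes f :: "real \<Rightarrow> 'a::{banach,second_countable_topology,real_normed_field}"
  shows "L1 f \<Longrightarrow> L1 (\<lambda>x. c * f x)"
  unfolding L1_def by simp

lemma L1_add: "L1 f \<Longrightarrow> L1 g \<Longrightarrow> L1 (\<lambda>x. f x + g x)"
  unfolding L1_def by (rule set_integral_add)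

lemma L1_sum: "(\<And>i. i \<in> S \<Longrightarrow> L1 (f i)) \<Longrightarrow> L1 (\<lambda>x. \<Sum>i\<in>S. f i x)"
  by (induction S rule: infinite_finite_induct) (auto intro: L1_const L1_add)

text \<open>On a set of finite measure boundedness implies integrability, so facts about
  \<open>Linf\<close> split into the one about \<open>L1\<close> and an essential bound.\<close>

lemma Linf_iff: "Linf f \<longleftrightarrow> L1 f \<and> (\<exists>M. AE x\<in>{0..1} in lebesgue. norm (f x) \<le> M)"
  unfolding Linf_def using L1_measurable L1_I_bounded[OF _ L1_const] by blast

lemma Linf_imp_L1: "Linf f \<Longrightarrow> L1 f" by (simp add: Linf_iff)

lemma Linf_cong_AE:
  fixes f g :: "real \<Rightarrow> complex"
  assumes "Linf f" "AE x\<in>{0..1} in lebesgue. f x = g x"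
  shows "Linf g"
proof -
  obtain M where "AE x\<in>{0..1} in lebesgue. norm (f x) \<le> M" using assms by (auto simp: Linf_iff)
  then have "AE x\<in>{0..1} in lebesgue. norm (g x) \<le> M"
    using assms(2) by eventually_elim auto
  then show ?thesis using L1_cong_AE[OF _ assms(2)] assms(1) by (auto simp: Linf_iff)
qed

lemma L1_mult_Linf:
  fixes f g :: "real \<Rightarrow> complex"
  assumes "L1 f" "Linf g" shows "L1 (\<lambda>x. f x * g x)"
proof -
  obtain M where M: "AE x\<in>{0..1} in lebesgue. norm (g x) \<le> M" using assms by (auto simp: Linf_iff)
  show ?thesis
  proof (rule L1_I_bounded)
    have "(\<lambda>x. (indicator {0..1} x *\<^sub>R f x) * (indicator {0..1} x *\<^sub>R g x)) \<in> borel_measurable lebesgue"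
      using assms L1_measurable[OF assms(1)] by (intro borel_measurable_times) (auto simp: set_borel_measurable_def Linf_def)
    then show "set_borel_measurable lebesgue {0..1} (\<lambda>x. f x * g x)"
      unfolding set_borel_measurable_def by (rule back_subst[of "\<lambda>h. h \<in> _"]) (auto simp: indicator_def)
    show "L1 (\<lambda>x. M * norm (f x))" by (intro L1_cmult L1_norm assms)
    show "AE x\<in>{0..1} in lebesgue. norm (f x * g x) \<le> M * norm (f x)"
      using M by eventually_elim (auto simp: norm_mult mult.commute[of M] intro: mult_left_mono)
  qed
qed

lemma Linf_mult_L1:
  fixes f g :: "real \<Rightarrow> complex"
  assumes "Linf f" "L1 g" shows "L1 (\<lambda>x. f x * g x)"
  using L1_mult_Linf[OF assms(2,1)] by (simp add: mult.commute)

lemma Linf_mult: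
  fixes f g :: "real \<Rightarrow> complex"
  assumes "Linf f" "Linf g" shows "Linf (\<lambda>x. f x * g x)"
proof -
  obtain M where M: "AE x\<in>{0..1} in lebesgue. norm (f x) \<le> M" using assms by (auto simp: Linf_iff)
  obtain N where N: "AE x\<in>{0..1} in lebesgue. norm (g x) \<le> N" using assms by (auto simp: Linf_iff)
  have "AE x\<in>{0..1} in lebesgue. norm (f x * g x) \<le> M * N"
    using M N by eventually_elim (auto simp: norm_mult intro!: mult_mono intro: order_trans[OF norm_ge_zero])
  then show ?thesis using L1_mult_Linf[OF Linf_imp_L1 assms(2)] assms(1) by (auto simp: Linf_iff)
qed

lemma Linf_add:
  assumes "Linf f" "Linf g" shows "Linf (\<lambda>x. f x + g x)"
proof -
  obtain M where M: "AE x\<in>{0..1} in lebesgue. norm (f x) \<le> M" using assms by (auto simp: Linf_iff)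
  obtain N where N: "AE x\<in>{0..1} in lebesgue. norm (g x) \<le> N" using assms by (auto simp: Linf_iff)
  have "AE x\<in>{0..1} in lebesgue. norm (f x + g x) \<le> M + N"
    using M N by eventually_elim (auto intro: norm_triangle_mono)
  then show ?thesis using L1_add assms by (auto simp: Linf_iff)
qed

lemma Linf_const: "Linf (\<lambda>x. c)"
  unfolding Linf_iff using L1_const by (auto intro!: exI[of _ "norm c"])

lemma Linf_sum:
  assumes "\<And>i. i \<in> S \<Longrightarrow> Linf (f i)" shows "Linf (\<lambda>x. \<Sum>i\<in>S. f i x)"
  using assms by (induction S rule: infinite_finite_induct) (auto intro: Linf_const Linf_add)

lemma Linf_continuous:
  fixes f :: "real \<Rightarrow> complex"
  assumes "continuous_on {0..1} f" shows "Linf f"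
proof -
  have "L1 f" using absolutely_integrable_continuous_real[OF assms] by (simp add: L1_def)
  moreover have "bounded (f ` {0..1})"
    using assms by (intro compact_imp_bounded compact_continuous_image) auto
  then obtain M where "\<forall>x\<in>{0..1}. norm (f x) \<le> M" by (auto simp: bounded_iff)
  ultimately show ?thesis by (auto simp: Linf_iff intro!: exI[of _ M])
qed

lemma Linf_AC: "AC g \<Longrightarrow> Linf (g :: real \<Rightarrow> complex)"
  by (intro Linf_continuous AC_continuous_on)

lemma L1_LINT_cong_AE:
  fixes f g :: "real \<Rightarrow> complex"
  assumes f: "L1 f" and eq: "AE x\<in>{0..1} in lebesgue. f x = g x" and ab: "0 \<le> a" "b \<le> 1"
  shows "(LINT x:{a..b}|lebesgue. f x) = (LINT x:{a..b}|lebesgue. g x)"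
proof -
  have "set_integrable lebesgue {a..b} f" "set_integrable lebesgue {a..b} g"
    using L1_subinterval L1_cong_AE[OF f eq] f ab by auto
  moreover have "AE x in lebesgue. indicator {a..b} x *\<^sub>R f x = indicator {a..b} x *\<^sub>R g x"
    using eq by eventually_elim (use ab in \<open>auto simp: indicator_def\<close>)
  ultimately show ?thesis
    unfolding set_lebesgue_integral_def set_integrable_def by (intro integral_cong_AE) auto
qed

lemma Int0_cong_AE:
  assumes "L1 f" "AE x\<in>{0..1} in lebesgue. f x = g x" "x \<le> 1"
  shows "Int0 f x = Int0 g x"
  unfolding Int0_def using assms by (intro L1_LINT_cong_AE) auto

lemma Int0_cong:
  assumes "\<And>t. t \<in> {0..x} \<Longrightarrow> f t = g t"
  shows "Int0 f x = Int0 g x"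
  unfolding Int0_def by (rule set_lebesgue_integral_cong) (use assms in auto)

lemma Int0_add: "L1 f \<Longrightarrow> L1 g \<Longrightarrow> x \<le> 1 \<Longrightarrow> Int0 (\<lambda>t. f t + g t) x = Int0 f x + Int0 g x"
  unfolding Int0_def by (intro set_integral_add L1_subinterval) auto

lemma Int0_cmult: "Int0 (\<lambda>t. c * f t) x = c * Int0 f x"
  unfolding Int0_def by simp

lemma Int0_sum:
  assumes "\<And>i. i \<in> S \<Longrightarrow> L1 (f i)" "x \<le> 1"
  shows "Int0 (\<lambda>t. \<Sum>i\<in>S. f i t) x = (\<Sum>i\<in>S. Int0 (f i) x)"
  using assms(1)
proof (induction S rule: infinite_finite_induct)
  case (insert i S)
  then show ?case using Int0_add[OF _ _ assms(2), of "f i" "\<lambda>t. \<Sum>i\<in>S. f i t"] by (simp add: L1_sum)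
qed (auto simp: Int0_def)

lemma LINT_eq_Int0_diff:
  assumes "L1 h" "0 \<le> a" "a \<le> b" "b \<le> 1"
  shows "(LINT t:{a..b}|lebesgue. h t) = Int0 h b - Int0 h a"
proof -
  have "(LINT t:{a..b}|lebesgue. h t) = integral {a..b} h"
    using assms by (intro set_lebesgue_integral_eq_integral L1_subinterval) auto
  moreover have "integral {0..a} h + integral {a..b} h = integral {0..b} h"
    using assms L1_subinterval[of h 0 b] set_lebesgue_integral_eq_integral(1)
    by (intro Henstock_Kurzweil_Integration.integral_combine) auto
  ultimately show ?thesis using assms by (simp add: Int0_eq_integral algebra_simps)
qed

section \<open>Calculus of almost-everywhere derivatives\<close>

lemma is_deriv_mult:
  assumes "is_deriv f f'" "is_deriv g g'"
  shows "is_deriv (\<lambda>x. f x * g x) (\<lambda>x. f x * g' x + f' x * g x)"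
  using assms unfolding is_deriv_def by eventually_elim (auto intro: has_vector_derivative_mult)

lemma is_deriv_add:
  assumes "is_deriv f f'" "is_deriv g g'"
  shows "is_deriv (\<lambda>x. f x + g x) (\<lambda>x. f' x + g' x)"
  using assms unfolding is_deriv_def by eventually_elim (auto intro: has_vector_derivative_add)

lemma is_deriv_const: "is_deriv (\<lambda>x. c) (\<lambda>x. 0)"
  unfolding is_deriv_def by auto

lemma is_deriv_sum:
  assumes "\<And>i. i \<in> S \<Longrightarrow> is_deriv (f i) (f' i)"
  shows "is_deriv (\<lambda>x. \<Sum>i\<in>S. f i x) (\<lambda>x. \<Sum>i\<in>S. f' i x)"
  using assms by (induction S rule: infinite_finite_induct) (auto intro: is_deriv_add is_deriv_const)

lemma is_deriv_cmult:
  assumes "is_deriv f f'"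
  shows "is_deriv (\<lambda>x. c * f x) (\<lambda>x. c * f' x)"
  using assms unfolding is_deriv_def by eventually_elim (auto intro: has_vector_derivative_mult_right)

lemma is_deriv_cong:
  assumes "is_deriv f f'" "\<And>x. x \<in> {0..1} \<Longrightarrow> f x = g x" "AE x\<in>{0..1} in lebesgue. f' x = g' x"
  shows "is_deriv g g'"
  using assms(1,3) unfolding is_deriv_def
  by eventually_elim (auto intro!: has_vector_derivative_transform[of _ "{0..1}" g f] simp: assms(2))

lemma is_deriv_unique:
  assumes "is_deriv f f'" "is_deriv g g'" "\<And>x. x \<in> {0..1} \<Longrightarrow> f x = g x"
  shows "AE x\<in>{0..1} in lebesgue. f' x = g' x"
proof -
  have "is_deriv g f'" by (rule is_deriv_cong[OF assms(1,3)]) auto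
  then show ?thesis using assms(2) unfolding is_deriv_def
    by eventually_elim (auto intro: vector_derivative_unique_within_closed_interval[of 0 1])
qed

text \<open>Fubini's theorem on a triangle for a product integrand, read off from the fundamental
  theorem for the product of two primitives.\<close>

lemma Int0_by_parts:
  assumes A: "L1 A" and B: "L1 B" and x: "x \<in> {0..1}"
  shows "Int0 (\<lambda>t. A t * Int0 B t) x = Int0 (\<lambda>t. (Int0 A x - Int0 A t) * B t) x"
proof -
  have AA: "Linf (Int0 A)" and BB: "Linf (Int0 B)" using A B by (auto intro: Linf_AC AC_Int0)
  have i: "L1 (\<lambda>t. A t * Int0 B t)" "L1 (\<lambda>t. Int0 A t * B t)" using A B AA BB by (auto intro: L1_mult_Linf Linf_mult_L1)
  have "Int0 (\<lambda>t. Int0 A t * B t + A t * Int0 B t) x = Int0 A x * Int0 B x - Int0 A 0 * Int0 B 0"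
    by (intro AC_FTC[OF _ _ x] AC_mult is_deriv_mult AC_Int0 is_deriv_Int0 A B)
  then have 1: "Int0 (\<lambda>t. Int0 A t * B t) x + Int0 (\<lambda>t. A t * Int0 B t) x = Int0 A x * Int0 B x"
    using Int0_add[OF i(2,1)] x by simp
  have "Int0 (\<lambda>t. (Int0 A x - Int0 A t) * B t) x = Int0 (\<lambda>t. Int0 A x * B t + (- 1) * (Int0 A t * B t)) x"
    by (rule Int0_cong) (simp add: algebra_simps)
  also have "\<dots> = Int0 A x * Int0 B x - Int0 (\<lambda>t. Int0 A t * B t) x"
    using Int0_add[OF L1_cmult[OF B] L1_cmult[OF i(2)], of x "Int0 A x" "- 1"] x
      Int0_cmult[of "- 1" "\<lambda>t. Int0 A t * B t" x] by (simp add: Int0_cmult)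
  finally show ?thesis using 1 by (metis add_diff_cancel_left')
qed

section \<open>Chains of derivatives\<close>

text \<open>The common core of \<open>Wsob\<close> and \<open>W0inf\<close>. The last member
  \<open>D k\<close> is only an a.e. derivative; its integrability and the boundary values of the
  others are imposed separately.\<close>

definition deriv_chain :: "nat \<Rightarrow> (nat \<Rightarrow> real \<Rightarrow> complex) \<Rightarrow> bool" where
  "deriv_chain k D \<longleftrightarrow> (\<forall>j<k. AC (D j) \<and> is_deriv (D j) (D (Suc j)))"

text \<open>A null set contains no nondegenerate interval, whereas by continuity a point of
  difference would bring a whole interval of such points.\<close>

lemma continuous_AE_imp_eq:
  fixes f g :: "real \<Rightarrow> complex"
  assumes c: "continuous_on {0..1} f" "continuous_on {0..1} g"
    and eq: "AE x\<in>{0..1} in lebesgue. f x = g x" and x: "x \<in> {0..1}"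
  shows "f x = g x"
proof (rule ccontr)
  assume ne: "f x \<noteq> g x"
  have "continuous_on {0..1} (\<lambda>x. f x - g x)" by (intro continuous_intros c)
  then obtain d where d: "d > 0" "\<And>y. y \<in> {0..1} \<Longrightarrow> dist y x < d \<Longrightarrow> dist (f y - g y) (f x - g x) < norm (f x - g x)"
    using ne x unfolding continuous_on_iff by (metis right_minus_eq zero_less_norm_iff)
  obtain N where N: "negligible N" "{x. \<not> (x \<in> {0..1} \<longrightarrow> f x = g x)} \<subseteq> N"
    using eq unfolding eventually_ae_filter_negligible by blast
  define J where "J = {max 0 (x - d / 2)..min 1 (x + d / 2)}"
  have "J \<subseteq> N"
  proof
    fix y assume y: "y \<in> J"
    have "dist (f y - g y) (f x - g x) < norm (f x - g x)"
      using y d(1) by (intro d(2)) (auto simp: J_def dist_real_def)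
    then have "f y \<noteq> g y" by (auto simp: dist_norm norm_minus_commute)
    then show "y \<in> N" using N(2) y by (auto simp: J_def)
  qed
  then have "negligible J" using N(1) negligible_subset by blast
  moreover have "max 0 (x - d / 2) < min 1 (x + d / 2)" using x d(1) by auto
  ultimately show False unfolding J_def cbox_interval[symmetric] negligible_interval by auto
qed

section \<open>The derivative chosen by \<open>wder\<close> and its iterates\<close>

lemma is_deriv_wder: "is_deriv g h \<Longrightarrow> is_deriv g (wder g)"
proof (cases "\<exists>h. is_deriv g h \<and> AC h")
  case True
  then show ?thesis using someI_ex[OF True] by (simp add: wder_def)
next
  case False
  assume "is_deriv g h"
  moreover have "wder g = (SOME h. is_deriv g h)" unfolding wder_def using False by (rule if_not_P)
  ultimately show ?thesis using someI[of "is_deriv g" h] by simp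
qed

lemma AC_wder: "is_deriv g h \<Longrightarrow> AC h \<Longrightarrow> AC (wder g)"
  using someI_ex[of "\<lambda>h. is_deriv g h \<and> AC h"] by (auto simp: wder_def)

lemma wder_eq_AE: "is_deriv g h \<Longrightarrow> AE x\<in>{0..1} in lebesgue. wder g x = h x"
  by (rule is_deriv_unique[OF is_deriv_wder]) auto

lemma wder_eq: "is_deriv g h \<Longrightarrow> AC h \<Longrightarrow> x \<in> {0..1} \<Longrightarrow> wder g x = h x"
  by (rule continuous_AE_imp_eq[OF _ _ wder_eq_AE]) (auto intro: AC_continuous_on AC_wder)

text \<open>Below the top order the derivative has an absolutely continuous representative, which is
  unique, so the choices made by \<open>wder\<close> agree with any chain at every point. At order k
  only almost everywhere agreement remains.\<close>

lemma wder_chain: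
  assumes D: "deriv_chain k D" and g: "\<And>x. x \<in> {0..1} \<Longrightarrow> D 0 x = g x"
  shows "j < k \<Longrightarrow> x \<in> {0..1} \<Longrightarrow> (wder ^^ j) g x = D j x"
    and "AE x\<in>{0..1} in lebesgue. (wder ^^ k) g x = D k x"
proof -
  have *: "j < k \<Longrightarrow> \<forall>x\<in>{0..1}. (wder ^^ j) g x = D j x" for j
  proof (induction j)
    case (Suc j)
    then have "is_deriv ((wder ^^ j) g) (D (Suc j))" "AC (D (Suc j))"
      using D is_deriv_cong[of "D j" "D (Suc j)" "(wder ^^ j) g"] by (auto simp: deriv_chain_def)
    then show ?case using wder_eq by simp
  qed (use g in auto)
  then show "j < k \<Longrightarrow> x \<in> {0..1} \<Longrightarrow> (wder ^^ j) g x = D j x" by blast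
  show "AE x\<in>{0..1} in lebesgue. (wder ^^ k) g x = D k x"
  proof (cases k)
    case 0 then show ?thesis using g by auto
  next
    case (Suc j)
    then have "is_deriv ((wder ^^ j) g) (D k)"
      using D *[of j] is_deriv_cong[of "D j" "D (Suc j)" "(wder ^^ j) g"] by (auto simp: deriv_chain_def)
    then show ?thesis using wder_eq_AE Suc by simp
  qed
qed

lemma deriv_chain_wder:
  assumes D: "deriv_chain k D" and g: "\<And>x. x \<in> {0..1} \<Longrightarrow> D 0 x = g x"
  shows "deriv_chain k (\<lambda>j. (wder ^^ j) g)"
  unfolding deriv_chain_def
proof (intro allI impI conjI)
  fix j assume j: "j < k"
  have eq: "D j x = (wder ^^ j) g x" if "x \<in> {0..1}" for x using wder_chain(1)[OF D g j that] by simp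
  have D': "AC (D j)" "is_deriv (D j) (D (Suc j))" using D j by (auto simp: deriv_chain_def)
  show "AC ((wder ^^ j) g)" by (rule AC_cong[OF _ D'(1)]) (rule eq)
  have "AE x\<in>{0..1} in lebesgue. D (Suc j) x = (wder ^^ Suc j) g x"
  proof (cases "Suc j < k")
    case True
    then show ?thesis using wder_chain(1)[OF D g True] by auto
  next
    case False
    then have "k = Suc j" using j by simp
    then show ?thesis using wder_chain(2)[OF D g] by (auto elim: eventually_mono)
  qed
  then show "is_deriv ((wder ^^ j) g) ((wder ^^ Suc j) g)"
    by (intro is_deriv_cong[OF D'(2)] eq)
qed

lemma Wsob_Linf_wder:
  assumes "Wsob k Linf y"
  shows "deriv_chain k (\<lambda>j. (wder ^^ j) y)" "Linf ((wder ^^ k) y)"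
proof -
  obtain D where D: "\<forall>x\<in>{0..1}. D 0 x = y x" "deriv_chain k D" "Linf (D k)"
    using assms unfolding Wsob_def deriv_chain_def by auto
  note y = D(1)[rule_format]
  show "deriv_chain k (\<lambda>j. (wder ^^ j) y)" by (rule deriv_chain_wder[OF D(2) y])
  have "AE x\<in>{0..1} in lebesgue. D k x = (wder ^^ k) y x"
    using wder_chain(2)[OF D(2) y] by (auto elim: eventually_mono)
  then show "Linf ((wder ^^ k) y)" by (rule Linf_cong_AE[OF D(3)])
qed

lemma W0inf_wder:
  assumes "W0inf k \<phi>"
  shows "deriv_chain k (\<lambda>j. (wder ^^ j) \<phi>)" "Linf ((wder ^^ k) \<phi>)"
    "j < k \<Longrightarrow> (wder ^^ j) \<phi> 0 = 0" "j < k \<Longrightarrow> (wder ^^ j) \<phi> 1 = 0"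
proof -
  obtain D where D: "\<forall>x\<in>{0..1}. D 0 x = \<phi> x" "deriv_chain k D" "Linf (D k)"
    "\<forall>\<nu><k. D \<nu> 0 = 0 \<and> D \<nu> 1 = 0"
    using assms unfolding W0inf_def deriv_chain_def by auto
  then have "Wsob k Linf \<phi>" unfolding Wsob_def deriv_chain_def by blast
  from Wsob_Linf_wder[OF this]
  show "deriv_chain k (\<lambda>j. (wder ^^ j) \<phi>)" "Linf ((wder ^^ k) \<phi>)" by auto
  show "j < k \<Longrightarrow> (wder ^^ j) \<phi> 0 = 0" "j < k \<Longrightarrow> (wder ^^ j) \<phi> 1 = 0"
    using wder_chain(1)[OF D(2) D(1)[rule_format], of j] D(4) by auto
qed

section \<open>Leibniz' rule and products with test functions\<close>

lemma deriv_chain_shift: "deriv_chain n D \<Longrightarrow> s + m \<le> n \<Longrightarrow> deriv_chain m (\<lambda>j. D (s + j))"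
  by (auto simp: deriv_chain_def)

lemma deriv_chain_Linf: "deriv_chain n D \<Longrightarrow> Linf (D n) \<Longrightarrow> j \<le> n \<Longrightarrow> Linf (D j)"
  using Linf_AC by (cases "j = n") (auto simp: deriv_chain_def)

text \<open>Leibniz' formula is stated as a chain that starts at F 0 * G 0;
  \<open>wder_chain\<close> then identifies its members with iterated derivatives. The
  differentiation step is Pascal's rule.\<close>

lemma deriv_chain_leibniz:
  assumes F: "deriv_chain m F" and G: "deriv_chain m G"
  shows "deriv_chain m (\<lambda>j x. \<Sum>i\<le>j. of_nat (j choose i) * (F i x * G (j - i) x))"
  unfolding deriv_chain_def
proof (intro allI impI conjI)
  fix j assume j: "j < m"
  show "AC (\<lambda>x. \<Sum>i\<le>j. of_nat (j choose i) * (F i x * G (j - i) x))"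
    using F G j by (intro AC_sum AC_mult AC_const) (auto simp: deriv_chain_def)
  have "is_deriv (\<lambda>x. \<Sum>i\<le>j. of_nat (j choose i) * (F i x * G (j - i) x))
     (\<lambda>x. \<Sum>i\<le>j. of_nat (j choose i) * (F i x * G (Suc (j - i)) x + F (Suc i) x * G (j - i) x))"
    using F G j by (intro is_deriv_sum is_deriv_cmult is_deriv_mult) (auto simp: deriv_chain_def)
  also have "(\<lambda>x. \<Sum>i\<le>j. of_nat (j choose i) * (F i x * G (Suc (j - i)) x + F (Suc i) x * G (j - i) x))
     = (\<lambda>x. \<Sum>i\<le>Suc j. of_nat (Suc j choose i) * (F i x * G (Suc j - i) x))"
  proof
    fix x
    define a where "a = (\<lambda>i. F i x * G (Suc j - i) x)"
    have "(\<Sum>i\<le>Suc j. of_nat (Suc j choose i) * a i) = a 0 + (\<Sum>i\<le>j. of_nat (Suc j choose Suc i) * a (Suc i))"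
      by (subst sum.atMost_Suc_shift) simp
    also have "(\<Sum>i\<le>j. of_nat (Suc j choose Suc i) * a (Suc i))
       = (\<Sum>i\<le>j. of_nat (j choose i) * a (Suc i)) + (\<Sum>i\<le>j. of_nat (j choose Suc i) * a (Suc i))"
      by (simp add: sum.distrib algebra_simps)
    also have "a 0 + \<dots> = (\<Sum>i\<le>j. of_nat (j choose i) * a (Suc i)) + (\<Sum>i\<le>Suc j. of_nat (j choose i) * a i)"
      by (subst sum.atMost_Suc_shift) simp
    also have "\<dots> = (\<Sum>i\<le>j. of_nat (j choose i) * (a i + a (Suc i)))"
      by (simp add: sum.distrib algebra_simps binomial_eq_0)
    finally show "(\<Sum>i\<le>j. of_nat (j choose i) * (F i x * G (Suc (j - i)) x + F (Suc i) x * G (j - i) x))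
      = (\<Sum>i\<le>Suc j. of_nat (Suc j choose i) * (F i x * G (Suc j - i) x))"
      by (simp add: a_def Suc_diff_le)
  qed
  finally show "is_deriv (\<lambda>x. \<Sum>i\<le>j. of_nat (j choose i) * (F i x * G (j - i) x))
     (\<lambda>x. \<Sum>i\<le>Suc j. of_nat (Suc j choose i) * (F i x * G (Suc j - i) x))" .
qed

text \<open>Zeros of one factor suffice: a Leibniz term of order below m contains a derivative of F
  of order below m. This is what allows the coefficient functionals to be evaluated at phi *
  y.\<close>

lemma W0inf_mult:
  assumes F: "deriv_chain m F" "Linf (F m)" "\<And>j. j < m \<Longrightarrow> F j 0 = 0 \<and> F j 1 = 0"
    and G: "deriv_chain m G" "Linf (G m)"
  shows "W0inf m (\<lambda>x. F 0 x * G 0 x)"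
    and "AE x\<in>{0..1} in lebesgue.
      (wder ^^ m) (\<lambda>x. F 0 x * G 0 x) x = (\<Sum>i\<le>m. of_nat (m choose i) * (F i x * G (m - i) x))"
proof -
  define E where "E = (\<lambda>j x. \<Sum>i\<le>j. of_nat (j choose i) * (F i x * G (j - i) x))"
  have E: "deriv_chain m E" unfolding E_def by (rule deriv_chain_leibniz[OF F(1) G(1)])
  have E0: "E 0 x = F 0 x * G 0 x" for x by (simp add: E_def)
  have "Linf (E m)" unfolding E_def
    using deriv_chain_Linf[OF F(1,2)] deriv_chain_Linf[OF G] by (intro Linf_sum Linf_mult Linf_const) auto
  moreover have "\<forall>j<m. E j 0 = 0 \<and> E j 1 = 0" using F(3) by (auto simp: E_def intro!: sum.neutral)
  ultimately show "W0inf m (\<lambda>x. F 0 x * G 0 x)"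
    unfolding W0inf_def using E E0 by (intro exI[of _ E]) (auto simp: deriv_chain_def)
  show "AE x\<in>{0..1} in lebesgue.
      (wder ^^ m) (\<lambda>x. F 0 x * G 0 x) x = (\<Sum>i\<le>m. of_nat (m choose i) * (F i x * G (m - i) x))"
    using wder_chain(2)[OF E E0] by (simp add: E_def)
qed

lemma fder_pow: "(fder ^^ m) f \<phi> = (- 1) ^ m * f ((wder ^^ m) \<phi>)"
  by (induction m arbitrary: \<phi>) (simp_all add: fder_def funpow_swap1[of wder])

text \<open>All derivatives are moved to the product and expanded. Only integrals are left, in which
  the choice of the top derivative is invisible.\<close>

lemma gder_mult:
  assumes F: "deriv_chain m F" "Linf (F m)" "\<And>j. j < m \<Longrightarrow> F j 0 = 0 \<and> F j 1 = 0"
    and G: "deriv_chain m G" "Linf (G m)" and S: "L1 S"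
  shows "gder m S (\<lambda>x. F 0 x * G 0 x)
    = (- 1) ^ m * (\<Sum>i\<le>m. of_nat (m choose i) * (LINT x:{0..1}|lebesgue. S x * (F i x * G (m - i) x)))"
proof -
  have L: "L1 (\<lambda>x. S x * (F i x * G (m - i) x))" if "i \<le> m" for i
    using deriv_chain_Linf[OF F(1,2)] deriv_chain_Linf[OF G] that by (intro L1_mult_Linf S Linf_mult) auto
  have "AE x\<in>{0..1} in lebesgue.
      (wder ^^ m) (\<lambda>x. F 0 x * G 0 x) x = (\<Sum>i\<le>m. of_nat (m choose i) * (F i x * G (m - i) x))"
    by (rule W0inf_mult(2)[OF F G])
  then have "AE x\<in>{0..1} in lebesgue.
     (\<Sum>i\<le>m. of_nat (m choose i) * (S x * (F i x * G (m - i) x))) = S x * (wder ^^ m) (\<lambda>x. F 0 x * G 0 x) x"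
    by eventually_elim (auto simp: sum_distrib_left algebra_simps)
  then have "(LINT x:{0..1}|lebesgue. S x * (wder ^^ m) (\<lambda>x. F 0 x * G 0 x) x)
     = Int0 (\<lambda>x. \<Sum>i\<le>m. of_nat (m choose i) * (S x * (F i x * G (m - i) x))) 1"
    unfolding Int0_def by (intro L1_LINT_cong_AE[symmetric] L1_sum L1_cmult L) auto
  also have "\<dots> = (\<Sum>i\<le>m. of_nat (m choose i) * (LINT x:{0..1}|lebesgue. S x * (F i x * G (m - i) x)))"
    by (subst Int0_sum) (auto intro!: L1_cmult L simp only: Int0_cmult Int0_def atMost_iff order_refl)
  finally show ?thesis by (simp add: gder_def fder_pow fnl_of_def)
qed

subsection \<open>Taylor's formula\<close>

text \<open>The Taylor monomial with both variables kept: it is a polynomial in x in front of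
  initial values and a weight in t under the remainder integral.\<close>

definition tpow :: "nat \<Rightarrow> real \<Rightarrow> real \<Rightarrow> complex" where
  "tpow m x t = complex_of_real ((x - t) ^ m / fact m)"

lemma tpow_0 [simp]: "tpow 0 x t = 1" by (simp add: tpow_def)

lemma tpow_diag [simp]: "tpow (Suc m) x x = 0" by (simp add: tpow_def)

lemma tpow_swap: "tpow m x t = (- 1) ^ m * tpow m t x"
proof -
  have "(x - t) ^ m = (- 1) ^ m * (t - x) ^ m" by (simp flip: power_mult_distrib)
  then show ?thesis by (simp add: tpow_def)
qed

lemma AC_tpow1: "AC (\<lambda>x. tpow m x t)"
proof -
  have "AC (\<lambda>x. (complex_of_real x + (- complex_of_real t)) ^ m * (1 / fact m))"
    by (intro AC_mult AC_power AC_add AC_of_real AC_const)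
  then show ?thesis by (simp add: tpow_def)
qed

lemma AC_tpow2: "AC (tpow m x)"
proof -
  have "AC (\<lambda>t. (- 1) ^ m * tpow m t x)" by (intro AC_mult AC_const AC_tpow1)
  then show ?thesis by (rule AC_cong[rotated]) (simp add: tpow_swap[of m x])
qed

lemma is_deriv_tpow2: "is_deriv (tpow (Suc m) x) (\<lambda>t. - tpow m x t)"
proof -
  have "((\<lambda>t. (x - t) ^ Suc m / fact (Suc m)) has_real_derivative - ((x - t) ^ m / fact m)) (at t within {0..1})" for t
  proof -
    have "((\<lambda>t. (x - t) ^ Suc m / fact (Suc m)) has_real_derivative
        (real (Suc m) * (x - t) ^ m * (- 1)) / fact (Suc m)) (at t within {0..1})"
      by (rule DERIV_cong[OF DERIV_cdivide[OF DERIV_power[OF DERIV_diff[OF DERIV_const DERIV_ident], where n = "Suc m"]]]) simp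
    moreover have "(real (Suc m) * (x - t) ^ m * (- 1)) / fact (Suc m) = - ((x - t) ^ m / fact m)"
      using of_nat_neq_0[of m, where 'a = real] by (simp del: of_nat_Suc add: divide_simps)
    ultimately show ?thesis by simp
  qed
  then have "((\<lambda>t. complex_of_real ((x - t) ^ Suc m / fact (Suc m))) has_vector_derivative
      complex_of_real (- ((x - t) ^ m / fact m))) (at t within {0..1})" for t
    by (intro has_vector_derivative_of_real)
       (simp add: has_real_derivative_iff_has_vector_derivative)
  then show ?thesis unfolding is_deriv_def tpow_def[abs_def] by simp
qed

text \<open>Induction by parts. The remainder is a difference of two values of \<open>Int0\<close>,
  so c may lie on either side of x; c = 0 serves y and c = 1 serves phi.\<close>

lemma deriv_chain_taylor:
  assumes D: "deriv_chain (Suc m) D" and c: "c \<in> {0..1}" and x: "x \<in> {0..1}"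
  shows "D 0 x = (\<Sum>j\<le>m. D j c * tpow j x c)
     + (Int0 (\<lambda>t. tpow m x t * D (Suc m) t) x - Int0 (\<lambda>t. tpow m x t * D (Suc m) t) c)"
  using D
proof (induction m)
  case 0
  then have "AC (D 0)" "is_deriv (D 0) (D 1)" by (auto simp: deriv_chain_def)
  then show ?case using AC_FTC[of "D 0" "D 1"] x c by simp
next
  case (Suc m)
  then have "deriv_chain (Suc m) D" by (auto simp: deriv_chain_def)
  note IH = Suc.IH[OF this]
  have DA: "AC (D (Suc m))" and Dd: "is_deriv (D (Suc m)) (D (Suc (Suc m)))"
    using Suc.prems by (auto simp: deriv_chain_def)
  note DL = L1_derivative_of_AC[OF DA Dd]
  define G where "G = (\<lambda>t. tpow (Suc m) x t * D (Suc m) t)"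
  have L: "L1 (\<lambda>t. tpow (Suc m) x t * D (Suc (Suc m)) t)" "L1 (\<lambda>t. - tpow m x t * D (Suc m) t)"
    "L1 (\<lambda>t. tpow m x t * D (Suc m) t)"
    using Linf_mult_L1[OF Linf_AC[OF AC_tpow2] DL] L1_cmult[of _ "- 1"]
      Linf_mult_L1[OF Linf_AC[OF AC_tpow2] Linf_imp_L1[OF Linf_AC[OF DA]], of m x] by auto
  have "Int0 (\<lambda>t. tpow (Suc m) x t * D (Suc (Suc m)) t + - tpow m x t * D (Suc m) t) z = G z - G 0"
    if "z \<in> {0..1}" for z
    unfolding G_def by (intro AC_FTC[OF _ _ that] AC_mult AC_tpow2 DA is_deriv_mult is_deriv_tpow2 Dd)
  then have "Int0 (\<lambda>t. tpow (Suc m) x t * D (Suc (Suc m)) t) z - Int0 (\<lambda>t. tpow m x t * D (Suc m) t) z = G z - G 0"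
    if "z \<in> {0..1}" for z
    using that Int0_add[OF L(1,2), of z] Int0_cmult[of "-1" "\<lambda>t. tpow m x t * D (Suc m) t" z] by simp
  from this[OF x] this[OF c]
  have "Int0 (\<lambda>t. tpow m x t * D (Suc m) t) x - Int0 (\<lambda>t. tpow m x t * D (Suc m) t) c
    = Int0 (\<lambda>t. tpow (Suc m) x t * D (Suc (Suc m)) t) x - Int0 (\<lambda>t. tpow (Suc m) x t * D (Suc (Suc m)) t) c - (G x - G c)"
    by algebra
  then show ?case using IH by (simp add: G_def)
qed

text \<open>With x - t = (x - 0) + (0 - t) the kernel becomes degenerate, that is, a finite sum of
  products of functions of one variable.\<close>

lemma tpow_binomial: "tpow m x t = (\<Sum>i\<le>m. tpow i x 0 * tpow (m - i) 0 t)"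
proof -
  have "(x + (- t)) ^ m / fact m = (\<Sum>i\<le>m. of_nat (m choose i) * x ^ i * (- t) ^ (m - i) / fact m)"
    by (subst binomial_ring) (simp add: sum_divide_distrib)
  also have "\<dots> = (\<Sum>i\<le>m. (x ^ i / fact i) * ((- t) ^ (m - i) / fact (m - i)))"
    by (intro sum.cong) (auto simp: binomial_fact field_simps)
  finally have "complex_of_real ((x + (- t)) ^ m / fact m)
    = complex_of_real (\<Sum>i\<le>m. (x ^ i / fact i) * ((- t) ^ (m - i) / fact (m - i)))" by (simp only:)
  then show ?thesis by (simp add: tpow_def)
qed

lemma L1_tpow1: "L1 A \<Longrightarrow> L1 (\<lambda>x. A x * tpow m x t)"
  by (intro L1_mult_Linf Linf_AC AC_tpow1)

lemma L1_tpow2: "L1 A \<Longrightarrow> L1 (\<lambda>t. tpow m x t * A t)"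
  by (intro Linf_mult_L1 Linf_AC AC_tpow2)

text \<open>Here and in the mirror image below the parameter leaves the integral, and the integrands
  no longer contain it. The result is therefore absolutely continuous even where the parameter is
  also the upper limit.\<close>

lemma Int0_tpow_separate1:
  assumes "L1 A" "c \<le> 1"
  shows "Int0 (\<lambda>x. A x * tpow m x t) c = (\<Sum>i\<le>m. tpow (m - i) 0 t * Int0 (\<lambda>x. A x * tpow i x 0) c)"
proof -
  have "Int0 (\<lambda>x. A x * tpow m x t) c = Int0 (\<lambda>x. \<Sum>i\<le>m. tpow (m - i) 0 t * (A x * tpow i x 0)) c"
    by (rule Int0_cong, subst tpow_binomial) (simp add: sum_distrib_left mult_ac)
  also have "\<dots> = (\<Sum>i\<le>m. tpow (m - i) 0 t * Int0 (\<lambda>x. A x * tpow i x 0) c)"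
    by (subst Int0_sum) (use assms in \<open>auto intro!: L1_cmult L1_tpow1 simp: Int0_cmult\<close>)
  finally show ?thesis .
qed

lemma Int0_tpow_separate2:
  assumes "L1 A" "c \<le> 1"
  shows "Int0 (\<lambda>t. tpow m x t * A t) c = (\<Sum>i\<le>m. tpow i x 0 * Int0 (\<lambda>t. tpow (m - i) 0 t * A t) c)"
proof -
  have "Int0 (\<lambda>t. tpow m x t * A t) c = Int0 (\<lambda>t. \<Sum>i\<le>m. tpow i x 0 * (tpow (m - i) 0 t * A t)) c"
    by (rule Int0_cong, subst tpow_binomial) (simp add: sum_distrib_right mult.assoc)
  also have "\<dots> = (\<Sum>i\<le>m. tpow i x 0 * Int0 (\<lambda>t. tpow (m - i) 0 t * A t) c)"
    by (subst Int0_sum) (use assms in \<open>auto intro!: L1_cmult L1_tpow2 simp: Int0_cmult\<close>)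
  finally show ?thesis .
qed

text \<open>Multiplying out (\<tau> - t)^m separates the variables; this replaces Fubini's theorem by integration by parts.\<close>

lemma Int0_tpow_swap:
  assumes A: "L1 A" and f: "L1 f" and c: "c \<in> {0..1}"
  shows "Int0 (\<lambda>\<tau>. A \<tau> * Int0 (\<lambda>t. tpow m \<tau> t * f t) \<tau>) c
     = Int0 (\<lambda>t. (Int0 (\<lambda>\<tau>. A \<tau> * tpow m \<tau> t) c - Int0 (\<lambda>\<tau>. A \<tau> * tpow m \<tau> t) t) * f t) c"
proof -
  define Ai where "Ai = (\<lambda>i \<tau>. A \<tau> * tpow i \<tau> 0)"
  define Bi where "Bi = (\<lambda>i t. tpow (m - i) 0 t * f t)"
  have LA: "L1 (Ai i)" for i unfolding Ai_def by (rule L1_tpow1[OF A])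
  have LB: "L1 (Bi i)" for i unfolding Bi_def by (rule L1_tpow2[OF f])
  have AI: "Linf (Int0 (Bi i))" "Linf (Int0 (Ai i))" for i by (intro Linf_AC AC_Int0 LA LB)+
  have Ld: "Linf (\<lambda>t. Int0 (Ai i) c - Int0 (Ai i) t)" for i
    using Linf_add[OF Linf_const[of "Int0 (Ai i) c"] Linf_mult[OF Linf_const[of "-1"] AI(2)[of i]]] by simp
  have "Int0 (\<lambda>\<tau>. A \<tau> * Int0 (\<lambda>t. tpow m \<tau> t * f t) \<tau>) c = Int0 (\<lambda>\<tau>. \<Sum>i\<le>m. Ai i \<tau> * Int0 (Bi i) \<tau>) c"
    by (rule Int0_cong, subst Int0_tpow_separate2[OF f])
       (use c in \<open>auto simp: sum_distrib_left Ai_def Bi_def mult.assoc\<close>)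
  also have "\<dots> = (\<Sum>i\<le>m. Int0 (\<lambda>\<tau>. Ai i \<tau> * Int0 (Bi i) \<tau>) c)"
    using c by (intro Int0_sum L1_mult_Linf LA AI) auto
  also have "\<dots> = (\<Sum>i\<le>m. Int0 (\<lambda>t. (Int0 (Ai i) c - Int0 (Ai i) t) * Bi i t) c)"
    by (intro sum.cong refl Int0_by_parts LA LB c)
  also have "\<dots> = Int0 (\<lambda>t. \<Sum>i\<le>m. (Int0 (Ai i) c - Int0 (Ai i) t) * Bi i t) c"
    using c by (intro Int0_sum[symmetric] Linf_mult_L1 Ld LB) auto
  also have "\<dots> = Int0 (\<lambda>t. (Int0 (\<lambda>\<tau>. A \<tau> * tpow m \<tau> t) c - Int0 (\<lambda>\<tau>. A \<tau> * tpow m \<tau> t) t) * f t) c"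
  proof (rule Int0_cong)
    fix t assume "t \<in> {0..c}"
    then have "t \<le> 1" using c by auto
    then show "(\<Sum>i\<le>m. (Int0 (Ai i) c - Int0 (Ai i) t) * Bi i t)
      = (Int0 (\<lambda>\<tau>. A \<tau> * tpow m \<tau> t) c - Int0 (\<lambda>\<tau>. A \<tau> * tpow m \<tau> t) t) * f t"
    proof -
      have "Int0 (\<lambda>\<tau>. A \<tau> * tpow m \<tau> t) c - Int0 (\<lambda>\<tau>. A \<tau> * tpow m \<tau> t) t
        = (\<Sum>i\<le>m. tpow (m - i) 0 t * (Int0 (Ai i) c - Int0 (Ai i) t))"
        using \<open>t \<le> 1\<close> c by (simp add: Int0_tpow_separate1[OF A] Ai_def sum_subtractf right_diff_distrib)
      then show ?thesis by (simp add: sum_distrib_left Bi_def mult_ac)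
    qed
  qed
  finally show ?thesis .
qed

section \<open>The kernel\<close>

text \<open>The coefficient of y^(n-k+nu) phi^(n-nu) after Leibniz' rule; the q-part is the difference of
  two Leibniz expansions.\<close>

definition leib_coeff :: "(nat \<Rightarrow> real \<Rightarrow> complex) \<Rightarrow> (nat \<Rightarrow> real \<Rightarrow> complex) \<Rightarrow> nat \<Rightarrow> nat \<Rightarrow> real \<Rightarrow> complex" where
  "leib_coeff P Q k \<nu> t = (if k = 0 then P 0 t - \<i> * Q 0 t
     else of_nat (k choose \<nu>) * P k t
       + \<i> * (of_nat ((k - 1) choose \<nu>) - (if \<nu> = 0 then 0 else of_nat ((k - 1) choose (\<nu> - 1)))) * Q k t)"

text \<open>For \<nu> = k the factor y^(n) stands there already and needs no expansion, hence no
  integral. For \<nu> < k the order n-k+\<nu> lies k-\<nu> below n, so the Taylor remainder has the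
  exponent k-1-\<nu>.\<close>

definition Kpart :: "(nat \<Rightarrow> nat \<Rightarrow> real \<Rightarrow> complex) \<Rightarrow> nat \<Rightarrow> nat \<Rightarrow> real \<Rightarrow> real \<Rightarrow> complex" where
  "Kpart W k \<nu> x t = (if \<nu> = k then (- 1) ^ k * tpow k x t * W k k t
     else (- 1) ^ \<nu> * (LINT \<tau>:{t..x}|lebesgue. tpow \<nu> x \<tau> * W k \<nu> \<tau> * tpow (k - 1 - \<nu>) \<tau> t))"

lemma sum_atMost_split_first:
  fixes g :: "nat \<Rightarrow> nat \<Rightarrow> complex"
  shows "(\<Sum>k\<le>n. \<Sum>\<nu><k. g k \<nu>) = (\<Sum>k\<in>{1..n}. g k 0) + (\<Sum>k\<in>{2..n}. \<Sum>\<nu>\<in>{1..k-1}. g k \<nu>)"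
proof -
  have "(\<Sum>k\<le>n. \<Sum>\<nu><k. g k \<nu>) = (\<Sum>k\<in>{1..n}. \<Sum>\<nu><k. g k \<nu>)"
    by (intro sum.mono_neutral_right) (auto simp: Suc_le_eq)
  also have "\<dots> = (\<Sum>k\<in>{1..n}. g k 0 + (\<Sum>\<nu>\<in>{1..k-1}. g k \<nu>))"
  proof (rule sum.cong[OF refl])
    fix k assume "k \<in> {1..n}"
    then have "{..<k} = insert 0 {1..k-1}" by auto
    then show "(\<Sum>\<nu><k. g k \<nu>) = g k 0 + (\<Sum>\<nu>\<in>{1..k-1}. g k \<nu>)" by simp
  qed
  also have "\<dots> = (\<Sum>k\<in>{1..n}. g k 0) + (\<Sum>k\<in>{1..n}. \<Sum>\<nu>\<in>{1..k-1}. g k \<nu>)" by (rule sum.distrib)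
  also have "(\<Sum>k\<in>{1..n}. \<Sum>\<nu>\<in>{1..k-1}. g k \<nu>) = (\<Sum>k\<in>{2..n}. \<Sum>\<nu>\<in>{1..k-1}. g k \<nu>)"
  proof (rule sum.mono_neutral_right)
    show "\<forall>k\<in>{1..n} - {2..n}. (\<Sum>\<nu>\<in>{1..k-1}. g k \<nu>) = 0"
    proof
      fix k assume "k \<in> {1..n} - {2..n}"
      then have "k = 1" by auto
      then show "(\<Sum>\<nu>\<in>{1..k-1}. g k \<nu>) = 0" by simp
    qed
  qed auto
  finally show ?thesis .
qed

text \<open>The three groups of \<open>Kker\<close> are the diagonal \<nu> = k, the edge \<nu> = 0
  and the interior. For k > 0 the binomial difference is 0 - 1 on the diagonal, giving P - i Q, and
  1 - 0 on the edge, giving P + i Q; the edge is kept apart because \<nu> - 1 would be truncated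
  there.\<close>

lemma Kker_eq_sum_Kpart: "Kker n P Q x t = (\<Sum>k\<le>n. \<Sum>\<nu>\<le>k. Kpart (leib_coeff P Q) k \<nu> x t)"
proof -
  have "(\<Sum>k\<le>n. \<Sum>\<nu>\<le>k. Kpart (leib_coeff P Q) k \<nu> x t)
    = (\<Sum>k\<le>n. Kpart (leib_coeff P Q) k k x t) + (\<Sum>k\<le>n. \<Sum>\<nu><k. Kpart (leib_coeff P Q) k \<nu> x t)"
  proof -
    have "(\<Sum>\<nu>\<le>k. Kpart (leib_coeff P Q) k \<nu> x t) = Kpart (leib_coeff P Q) k k x t + (\<Sum>\<nu><k. Kpart (leib_coeff P Q) k \<nu> x t)" for k
      by (simp add: lessThan_Suc_atMost[symmetric])
    then show ?thesis by (simp add: sum.distrib)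
  qed
  also have "\<dots> = (\<Sum>k\<le>n. Kpart (leib_coeff P Q) k k x t)
      + ((\<Sum>k\<in>{1..n}. Kpart (leib_coeff P Q) k 0 x t)
      + (\<Sum>k\<in>{2..n}. \<Sum>\<nu>\<in>{1..k-1}. Kpart (leib_coeff P Q) k \<nu> x t))"
    by (simp only: sum_atMost_split_first)
  also have "(\<Sum>k\<le>n. Kpart (leib_coeff P Q) k k x t)
    = (\<Sum>k\<le>n. (-1) ^ k * complex_of_real ((x - t) ^ k / fact k) * (P k t - \<i> * Q k t))"
    by (intro sum.cong) (auto simp: Kpart_def leib_coeff_def tpow_def binomial_eq_0)
  also have "(\<Sum>k\<in>{1..n}. Kpart (leib_coeff P Q) k 0 x t)
    = (\<Sum>k\<in>{1..n}. LINT \<tau>:{t..x}|lebesgue.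
         (P k \<tau> + \<i> * Q k \<tau>) * complex_of_real ((\<tau> - t) ^ (k - 1) / fact (k - 1)))"
    by (intro sum.cong) (auto simp: Kpart_def leib_coeff_def tpow_def)
  also have "(\<Sum>k\<in>{2..n}. \<Sum>\<nu>\<in>{1..k-1}. Kpart (leib_coeff P Q) k \<nu> x t)
    = (\<Sum>k\<in>{2..n}. \<Sum>\<nu>\<in>{1..k-1}. (-1) ^ \<nu> *
        (LINT \<tau>:{t..x}|lebesgue.
           complex_of_real ((x - \<tau>) ^ \<nu> / fact \<nu>) *
           (of_nat (k choose \<nu>) * P k \<tau>
             + \<i> * of_int (int ((k - 1) choose \<nu>) - int ((k - 1) choose (\<nu> - 1))) * Q k \<tau>) *
           complex_of_real ((\<tau> - t) ^ (k - 1 - \<nu>) / fact (k - 1 - \<nu>))))"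
    by (intro sum.cong) (auto simp: Kpart_def leib_coeff_def tpow_def)
  finally show ?thesis by (simp only: Kker_def add.assoc)
qed

section \<open>Domination and regularity of the kernel\<close>

lemma norm_tpow_le: "0 \<le> t \<Longrightarrow> t \<le> x \<Longrightarrow> x \<le> 1 \<Longrightarrow> norm (tpow m x t) \<le> 1"
proof -
  assume a: "0 \<le> t" "t \<le> x" "x \<le> 1"
  have "(x - t) ^ m \<le> 1" using a by (intro power_le_one) auto
  also have "1 \<le> (fact m :: real)" by (rule fact_ge_1)
  finally have "(x - t) ^ m / fact m \<le> 1" by (simp add: divide_le_eq)
  moreover have "0 \<le> (x - t) ^ m / fact m" using a by simp
  ultimately show ?thesis unfolding tpow_def norm_of_real by (simp only: abs_of_nonneg)
qed

definition Kbound :: "nat \<Rightarrow> (nat \<Rightarrow> nat \<Rightarrow> real \<Rightarrow> complex) \<Rightarrow> real \<Rightarrow> real" where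
  "Kbound n W t = (\<Sum>k\<le>n. norm (W k k t)) + (\<Sum>k\<le>n. \<Sum>\<nu><k. LINT \<tau>:{0..1}|lebesgue. norm (W k \<nu> \<tau>))"

text \<open>The integral over [t,x] as a difference of primitives: for t > x it does not collapse to
  0, so it is absolutely continuous in t on all of [0,1].\<close>

definition Kfun :: "(nat \<Rightarrow> nat \<Rightarrow> real \<Rightarrow> complex) \<Rightarrow> nat \<Rightarrow> nat \<Rightarrow> real \<Rightarrow> real \<Rightarrow> complex" where
  "Kfun W k \<nu> x t = (- 1) ^ \<nu> * (Int0 (\<lambda>\<tau>. (tpow \<nu> x \<tau> * W k \<nu> \<tau>) * tpow (k - 1 - \<nu>) \<tau> t) x
      - Int0 (\<lambda>\<tau>. (tpow \<nu> x \<tau> * W k \<nu> \<tau>) * tpow (k - 1 - \<nu>) \<tau> t) t)"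

text \<open>The factor of y^(n-k+\<nu>+j)(0): the j-th term of the Taylor polynomial of
  y^(n-k+\<nu>) at 0, combined with the weight \<open>tpow \<nu> x\<close> that stems from phi.
  \<open>initial_coeff\<close> collects these by the total order i = n-k+\<nu>+j.\<close>

definition Cpart :: "(nat \<Rightarrow> nat \<Rightarrow> real \<Rightarrow> complex) \<Rightarrow> nat \<Rightarrow> nat \<Rightarrow> nat \<Rightarrow> real \<Rightarrow> complex" where
  "Cpart W k \<nu> j x = (- 1) ^ \<nu> * Int0 (\<lambda>\<tau>. tpow \<nu> x \<tau> * (W k \<nu> \<tau> * tpow j \<tau> 0)) x"

definition initial_coeff :: "nat \<Rightarrow> (nat \<Rightarrow> nat \<Rightarrow> real \<Rightarrow> complex) \<Rightarrow> nat \<Rightarrow> real \<Rightarrow> complex" where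
  "initial_coeff n W i x = (\<Sum>k\<le>n. \<Sum>\<nu><k. if n - k + \<nu> \<le> i then Cpart W k \<nu> (i - (n - k + \<nu>)) x else 0)"

locale kernel_coeffs =
  fixes n :: nat and W :: "nat \<Rightarrow> nat \<Rightarrow> real \<Rightarrow> complex"
  assumes W_L1: "\<And>k \<nu>. k \<le> n \<Longrightarrow> \<nu> \<le> k \<Longrightarrow> L1 (W k \<nu>)"
begin

definition K :: "real \<Rightarrow> real \<Rightarrow> complex" where "K x t = (\<Sum>k\<le>n. \<Sum>\<nu>\<le>k. Kpart W k \<nu> x t)"

lemma Kpart_eq_Kfun:
  assumes "k \<le> n" "\<nu> < k" "0 \<le> t" "t \<le> x" "x \<le> 1"
  shows "Kpart W k \<nu> x t = Kfun W k \<nu> x t"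
  using assms by (simp add: Kpart_def Kfun_def LINT_eq_Int0_diff L1_tpow1 L1_tpow2 W_L1)

lemma AC_Kfun:
  assumes "k \<le> n" "\<nu> < k" "x \<in> {0..1}"
  shows "AC (Kfun W k \<nu> x)"
proof -
  define A where "A = (\<lambda>\<tau>. tpow \<nu> x \<tau> * W k \<nu> \<tau>)"
  define m where "m = k - 1 - \<nu>"
  have A: "L1 A" unfolding A_def using assms by (intro L1_tpow2 W_L1) auto
  have "AC (\<lambda>t. (- 1) ^ \<nu> * (\<Sum>i\<le>m. tpow (m - i) 0 t * (Int0 (\<lambda>\<tau>. A \<tau> * tpow i \<tau> 0) x + (- 1) * Int0 (\<lambda>\<tau>. A \<tau> * tpow i \<tau> 0) t)))"
    by (intro AC_mult AC_const AC_sum AC_tpow2 AC_add AC_Int0 L1_tpow1 A)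
  then show ?thesis
  proof (rule AC_cong[rotated])
    fix t :: real assume t: "t \<in> {0..1}"
    have sep: "Int0 (\<lambda>\<tau>. A \<tau> * tpow m \<tau> t) c = (\<Sum>i\<le>m. tpow (m - i) 0 t * Int0 (\<lambda>\<tau>. A \<tau> * tpow i \<tau> 0) c)"
      if "c \<le> 1" for c by (rule Int0_tpow_separate1[OF A that])
    have "Kfun W k \<nu> x t = (- 1) ^ \<nu> * (Int0 (\<lambda>\<tau>. A \<tau> * tpow m \<tau> t) x - Int0 (\<lambda>\<tau>. A \<tau> * tpow m \<tau> t) t)"
      by (simp only: Kfun_def A_def m_def)
    also have "\<dots> = (- 1) ^ \<nu> * ((\<Sum>i\<le>m. tpow (m - i) 0 t * Int0 (\<lambda>\<tau>. A \<tau> * tpow i \<tau> 0) x)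
        - (\<Sum>i\<le>m. tpow (m - i) 0 t * Int0 (\<lambda>\<tau>. A \<tau> * tpow i \<tau> 0) t))"
      using sep[of x] sep[of t] assms t by simp
    also have "\<dots> = (- 1) ^ \<nu> * (\<Sum>i\<le>m. tpow (m - i) 0 t * (Int0 (\<lambda>\<tau>. A \<tau> * tpow i \<tau> 0) x + (- 1) * Int0 (\<lambda>\<tau>. A \<tau> * tpow i \<tau> 0) t))"
      by (simp add: sum_subtractf right_diff_distrib)
    finally show "(- 1) ^ \<nu> * (\<Sum>i\<le>m. tpow (m - i) 0 t * (Int0 (\<lambda>\<tau>. A \<tau> * tpow i \<tau> 0) x + (- 1) * Int0 (\<lambda>\<tau>. A \<tau> * tpow i \<tau> 0) t))
      = Kfun W k \<nu> x t" ..
  qed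
qed

text \<open>Taylor monomials are at most 1 in modulus here. The diagonal parts are then dominated by
  their coefficients at t, and every other part by a constant, the L1 norm of its
  coefficient.\<close>

lemma norm_K_le:
  assumes "0 \<le> t" "t \<le> x" "x \<le> 1"
  shows "norm (K x t) \<le> Kbound n W t"
proof -
  have off: "norm (Kpart W k \<nu> x t) \<le> (LINT \<tau>:{0..1}|lebesgue. norm (W k \<nu> \<tau>))" if k: "k \<le> n" "\<nu> < k" for k \<nu>
  proof -
    define h where "h = (\<lambda>\<tau>. tpow \<nu> x \<tau> * W k \<nu> \<tau> * tpow (k - 1 - \<nu>) \<tau> t)"
    have W: "L1 (W k \<nu>)" using k by (intro W_L1) auto
    then have h: "L1 h" unfolding h_def by (intro L1_tpow1 L1_tpow2)
    have "norm (LINT \<tau>:{t..x}|lebesgue. h \<tau>) \<le> (LINT \<tau>:{t..x}|lebesgue. norm (h \<tau>))"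
      using assms by (intro set_integral_norm_bound L1_subinterval h) auto
    also have "\<dots> \<le> (LINT \<tau>:{0..1}|lebesgue. norm (W k \<nu> \<tau>))"
      unfolding set_lebesgue_integral_def
    proof (rule integral_mono)
      show "integrable lebesgue (\<lambda>\<tau>. indicator {t..x} \<tau> *\<^sub>R norm (h \<tau>))"
        using L1_subinterval[OF L1_norm[OF h], of t x] assms by (simp add: set_integrable_def)
      show "integrable lebesgue (\<lambda>\<tau>. indicator {0..1} \<tau> *\<^sub>R norm (W k \<nu> \<tau>))"
        using L1_norm[OF W] by (simp add: L1_def set_integrable_def)
      show "indicator {t..x} \<tau> *\<^sub>R norm (h \<tau>) \<le> indicator {0..1} \<tau> *\<^sub>R norm (W k \<nu> \<tau>)" for \<tau>
      proof (cases "\<tau> \<in> {t..x}")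
        case True
        then have "norm (h \<tau>) \<le> 1 * norm (W k \<nu> \<tau>) * 1"
          unfolding h_def norm_mult using assms by (intro mult_mono norm_tpow_le) auto
        then show ?thesis using True assms by (simp add: indicator_def)
      qed (auto simp: indicator_def)
    qed
    finally show ?thesis using k by (simp add: Kpart_def h_def norm_mult norm_power)
  qed
  have diag: "norm (Kpart W k k x t) \<le> norm (W k k t)" for k
    using mult_right_mono[OF norm_tpow_le[OF assms, of k], of "norm (W k k t)"]
    by (simp add: Kpart_def norm_mult norm_power)
  have "norm (K x t) \<le> (\<Sum>k\<le>n. norm (\<Sum>\<nu>\<le>k. Kpart W k \<nu> x t))" unfolding K_def by (rule norm_sum)
  also have "\<dots> \<le> (\<Sum>k\<le>n. norm (W k k t) + (\<Sum>\<nu><k. LINT \<tau>:{0..1}|lebesgue. norm (W k \<nu> \<tau>)))"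
  proof (rule sum_mono)
    fix k assume k: "k \<in> {..n}"
    have "(\<Sum>\<nu>\<le>k. Kpart W k \<nu> x t) = (\<Sum>\<nu><k. Kpart W k \<nu> x t) + Kpart W k k x t"
      by (simp add: lessThan_Suc_atMost[symmetric])
    also have "norm \<dots> \<le> (\<Sum>\<nu><k. LINT \<tau>:{0..1}|lebesgue. norm (W k \<nu> \<tau>)) + norm (W k k t)"
      using off k diag by (intro norm_triangle_mono sum_norm_le) auto
    finally show "norm (\<Sum>\<nu>\<le>k. Kpart W k \<nu> x t) \<le> norm (W k k t) + (\<Sum>\<nu><k. LINT \<tau>:{0..1}|lebesgue. norm (W k \<nu> \<tau>))" by simp
  qed
  finally show ?thesis by (simp add: Kbound_def sum.distrib)
qed

lemma L1_Kbound: "L1 (Kbound n W)"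
proof -
  have "L1 (\<lambda>t. (\<Sum>k\<le>n. norm (W k k t)) + (\<Sum>k\<le>n. \<Sum>\<nu><k. LINT \<tau>:{0..1}|lebesgue. norm (W k \<nu> \<tau>)))"
    by (intro L1_add L1_const L1_sum L1_norm W_L1) auto
  then show ?thesis by (simp add: Kbound_def[abs_def])
qed

text \<open>Only t \<le> x matters for \<open>K\<close>. This variant agrees with it there and is
  integrable in t over [0,1], so the calculus of \<open>L1\<close> applies to it.\<close>

definition Kext :: "nat \<Rightarrow> nat \<Rightarrow> real \<Rightarrow> real \<Rightarrow> complex" where
  "Kext k \<nu> x t = (if \<nu> = k then (- 1) ^ k * tpow k x t * W k k t else Kfun W k \<nu> x t)"

lemma K_eq_Kext:
  assumes "0 \<le> t" "t \<le> x" "x \<le> 1"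
  shows "K x t = (\<Sum>k\<le>n. \<Sum>\<nu>\<le>k. Kext k \<nu> x t)"
  unfolding K_def
proof (intro sum.cong refl)
  fix k \<nu> assume "k \<in> {..n}" "\<nu> \<in> {..k}"
  then show "Kpart W k \<nu> x t = Kext k \<nu> x t"
    using Kpart_eq_Kfun[of k \<nu> t x] assms by (cases "\<nu> = k") (auto simp: Kext_def Kpart_def)
qed

lemma L1_Kext:
  assumes "k \<le> n" "\<nu> \<le> k" "x \<in> {0..1}"
  shows "L1 (Kext k \<nu> x)"
proof (cases "\<nu> = k")
  case True
  have "L1 (\<lambda>t. (- 1) ^ k * (tpow k x t * W k k t))" using assms by (intro L1_cmult L1_tpow2 W_L1) auto
  then show ?thesis using True by (simp add: Kext_def[abs_def] mult.assoc)
next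
  case False
  then have "AC (Kfun W k \<nu> x)" using assms by (intro AC_Kfun) auto
  then show ?thesis using False by (simp add: Kext_def[abs_def] Linf_AC Linf_imp_L1)
qed

lemma Int0_K:
  assumes x: "x \<in> {0..1}" and f: "Linf f"
  shows "Int0 (\<lambda>t. K x t * f t) x = (\<Sum>k\<le>n. \<Sum>\<nu>\<le>k. Int0 (\<lambda>t. Kext k \<nu> x t * f t) x)"
proof -
  have L: "L1 (\<lambda>t. Kext k \<nu> x t * f t)" if "k \<le> n" "\<nu> \<le> k" for k \<nu>
    using that x by (intro L1_mult_Linf L1_Kext f) auto
  have "Int0 (\<lambda>t. K x t * f t) x = Int0 (\<lambda>t. \<Sum>k\<le>n. \<Sum>\<nu>\<le>k. Kext k \<nu> x t * f t) x"
    by (rule Int0_cong) (use x K_eq_Kext in \<open>auto simp: sum_distrib_right\<close>)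
  also have "\<dots> = (\<Sum>k\<le>n. Int0 (\<lambda>t. \<Sum>\<nu>\<le>k. Kext k \<nu> x t * f t) x)"
    using x L by (intro Int0_sum L1_sum) auto
  also have "\<dots> = (\<Sum>k\<le>n. \<Sum>\<nu>\<le>k. Int0 (\<lambda>t. Kext k \<nu> x t * f t) x)"
    using x L by (intro sum.cong refl Int0_sum) auto
  finally show ?thesis .
qed

text \<open>Taylor's formula at 0 splits y^(n-k+\<nu>): the polynomial yields the initial values,
  and the remainder, after the integrations are exchanged, the kernel. For \<nu> = k there is
  nothing to expand and the sum over initial values is zero.\<close>

lemma y_side:
  assumes Y: "deriv_chain n Y" "Linf (Y n)" and k: "k \<le> n" "\<nu> \<le> k" and x: "x \<in> {0..1}"
  shows "(- 1) ^ \<nu> * Int0 (\<lambda>\<tau>. tpow \<nu> x \<tau> * (W k \<nu> \<tau> * Y (n - k + \<nu>) \<tau>)) x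
    = Int0 (\<lambda>t. Kext k \<nu> x t * Y n t) x
      + (\<Sum>i<n. Y i 0 * (if \<nu> < k \<and> n - k + \<nu> \<le> i then Cpart W k \<nu> (i - (n - k + \<nu>)) x else 0))"
proof (cases "\<nu> = k")
  case True
  then show ?thesis using k by (simp add: Kext_def Int0_cmult[symmetric] mult_ac)
next
  case False
  then have \<nu>: "\<nu> < k" using k by simp
  define s where "s = n - k + \<nu>"
  define m where "m = k - 1 - \<nu>"
  have sm: "s + Suc m = n" "Suc m = k - \<nu>" using k \<nu> by (auto simp: s_def m_def)
  define A where "A = (\<lambda>\<tau>. tpow \<nu> x \<tau> * W k \<nu> \<tau>)"
  have A: "L1 A" unfolding A_def using k by (intro L1_tpow2 W_L1)
  have Lf: "L1 (Y n)" using Y by (simp add: Linf_imp_L1)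
  have Y1: "Y s \<tau> = (\<Sum>j\<le>m. Y (s + j) 0 * tpow j \<tau> 0) + Int0 (\<lambda>t. tpow m \<tau> t * Y n t) \<tau>" if "\<tau> \<in> {0..1}" for \<tau>
    using deriv_chain_taylor[OF deriv_chain_shift[OF Y(1), of s "Suc m"], of 0 \<tau>] sm that by simp
  define R where "R = (\<lambda>\<tau>. Int0 (\<lambda>t. tpow m \<tau> t * Y n t) \<tau>)"
  have RC: "AC R"
  proof -
    have "AC (\<lambda>\<tau>. \<Sum>i\<le>m. tpow i \<tau> 0 * Int0 (\<lambda>t. tpow (m - i) 0 t * Y n t) \<tau>)"
      by (intro AC_sum AC_mult AC_tpow1 AC_Int0 L1_tpow2 Lf)
    then show ?thesis
      by (rule AC_cong[rotated]) (simp add: R_def Int0_tpow_separate2[OF Lf])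
  qed
  have L: "L1 (\<lambda>\<tau>. A \<tau> * R \<tau>)" "L1 (\<lambda>\<tau>. Y (s + j) 0 * (A \<tau> * tpow j \<tau> 0))" for j
    using A RC by (auto intro!: L1_mult_Linf Linf_AC L1_cmult L1_tpow1)
  have "Int0 (\<lambda>\<tau>. tpow \<nu> x \<tau> * (W k \<nu> \<tau> * Y s \<tau>)) x
    = Int0 (\<lambda>\<tau>. (\<Sum>j\<le>m. Y (s + j) 0 * (A \<tau> * tpow j \<tau> 0)) + A \<tau> * R \<tau>) x"
    by (rule Int0_cong) (use x in \<open>simp add: Y1 R_def A_def algebra_simps sum_distrib_left\<close>)
  also have "\<dots> = (\<Sum>j\<le>m. Y (s + j) 0 * Int0 (\<lambda>\<tau>. A \<tau> * tpow j \<tau> 0) x) + Int0 (\<lambda>\<tau>. A \<tau> * R \<tau>) x"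
    using x by (subst Int0_add) (auto simp: Int0_sum Int0_cmult L intro!: L1_sum L)
  finally have 1: "(- 1) ^ \<nu> * Int0 (\<lambda>\<tau>. tpow \<nu> x \<tau> * (W k \<nu> \<tau> * Y s \<tau>)) x
    = (\<Sum>j\<le>m. Y (s + j) 0 * Cpart W k \<nu> j x) + (- 1) ^ \<nu> * Int0 (\<lambda>\<tau>. A \<tau> * R \<tau>) x"
    by (simp add: Cpart_def A_def mult.assoc distrib_left sum_distrib_left mult.left_commute)
  have "Int0 (\<lambda>\<tau>. A \<tau> * R \<tau>) x = Int0 (\<lambda>t. (Int0 (\<lambda>\<tau>. A \<tau> * tpow m \<tau> t) x - Int0 (\<lambda>\<tau>. A \<tau> * tpow m \<tau> t) t) * Y n t) x"
    unfolding R_def by (rule Int0_tpow_swap[OF A Lf x])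
  then have 2: "(- 1) ^ \<nu> * Int0 (\<lambda>\<tau>. A \<tau> * R \<tau>) x = Int0 (\<lambda>t. Kext k \<nu> x t * Y n t) x"
    using False by (simp add: Int0_cmult[symmetric] Kext_def Kfun_def A_def m_def mult.assoc)
  have "(\<Sum>j\<le>m. Y (s + j) 0 * Cpart W k \<nu> j x) = (\<Sum>i\<in>{s..<n}. Y i 0 * Cpart W k \<nu> (i - s) x)"
    by (rule sum.reindex_bij_witness[of _ "\<lambda>i. i - s" "\<lambda>j. s + j"]) (use sm in auto)
  also have "\<dots> = (\<Sum>i<n. Y i 0 * (if \<nu> < k \<and> s \<le> i then Cpart W k \<nu> (i - s) x else 0))"
    using \<nu> by (intro sum.mono_neutral_cong_left) auto
  finally show ?thesis using 1 2 unfolding s_def[symmetric] by simp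
qed

text \<open>Expansion at 1, where all lower derivatives of phi vanish, expresses phi through its top
  derivative on [\<tau>,1]; after the exchange \<tau> runs over [0,x], the Volterra form. Of the
  sign, \<nu> factors come from reversing (\<tau> - s)^\<nu> and one from the orientation of the
  remainder.\<close>

lemma phi_side:
  assumes \<Phi>: "deriv_chain (Suc n) \<Phi>" "L1 (\<Phi> (Suc n))" "\<And>j. j \<le> n \<Longrightarrow> \<Phi> j 1 = 0"
    and h: "L1 h" and \<nu>: "\<nu> \<le> n"
  shows "Int0 (\<lambda>\<tau>. h \<tau> * \<Phi> (n - \<nu>) \<tau>) 1
    = (- 1) ^ Suc \<nu> * Int0 (\<lambda>x. \<Phi> (Suc n) x * Int0 (\<lambda>\<tau>. tpow \<nu> x \<tau> * h \<tau>) x) 1"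
proof -
  define \<psi> where "\<psi> = \<Phi> (Suc n)"
  have \<psi>: "L1 \<psi>" using \<Phi> by (simp add: \<psi>_def)
  have eq: "\<Phi> (n - \<nu>) \<tau> = (- 1) ^ Suc \<nu> * (Int0 (\<lambda>s. \<psi> s * tpow \<nu> s \<tau>) 1 - Int0 (\<lambda>s. \<psi> s * tpow \<nu> s \<tau>) \<tau>)"
    if "\<tau> \<in> {0..1}" for \<tau>
  proof -
    have "deriv_chain (Suc \<nu>) (\<lambda>j. \<Phi> (n - \<nu> + j))" using \<nu> by (intro deriv_chain_shift[OF \<Phi>(1)]) auto
    from deriv_chain_taylor[OF this, of 1 \<tau>]
    have "\<Phi> (n - \<nu>) \<tau> = Int0 (\<lambda>s. tpow \<nu> \<tau> s * \<psi> s) \<tau> - Int0 (\<lambda>s. tpow \<nu> \<tau> s * \<psi> s) 1"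
      using \<Phi>(3) \<nu> that by (simp add: \<psi>_def)
    moreover have "Int0 (\<lambda>s. tpow \<nu> \<tau> s * \<psi> s) z = (- 1) ^ \<nu> * Int0 (\<lambda>s. \<psi> s * tpow \<nu> s \<tau>) z" for z
      by (subst Int0_cmult[symmetric], rule Int0_cong, subst tpow_swap) (simp add: mult_ac)
    ultimately show ?thesis by (simp add: algebra_simps)
  qed
  have "Int0 (\<lambda>\<tau>. h \<tau> * \<Phi> (n - \<nu>) \<tau>) 1
    = Int0 (\<lambda>\<tau>. (- 1) ^ Suc \<nu> * ((Int0 (\<lambda>s. \<psi> s * tpow \<nu> s \<tau>) 1 - Int0 (\<lambda>s. \<psi> s * tpow \<nu> s \<tau>) \<tau>) * h \<tau>)) 1"
    by (rule Int0_cong) (simp add: eq)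
  also have "\<dots> = (- 1) ^ Suc \<nu> * Int0 (\<lambda>x. \<psi> x * Int0 (\<lambda>\<tau>. tpow \<nu> x \<tau> * h \<tau>) x) 1"
    unfolding Int0_cmult by (subst Int0_tpow_swap[OF \<psi> h]) auto
  finally show ?thesis by (simp add: \<psi>_def)
qed

end

section \<open>Regularity of the coefficients of the initial values\<close>

lemma sum_rev_atMost: "(\<Sum>i\<le>k. g i) = (\<Sum>i\<le>(k::nat). g (k - i) :: complex)"
  by (rule sum.reindex_bij_witness[of _ "\<lambda>i. k - i" "\<lambda>i. k - i"]) auto

lemma Wsob_1_L1_I:
  assumes "AC g" "is_deriv g h" shows "Wsob 1 L1 g"
  unfolding Wsob_def
  using assms L1_derivative_of_AC[OF assms] by (intro exI[of _ "\<lambda>j. if j = 0 then g else h"]) auto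

lemma (in kernel_coeffs) Wsob_initial_coeff: "Wsob 1 L1 (initial_coeff n W i)"
proof -
  \<comment> \<open>Membership in \<open>Wsob 1 L1\<close> asks for a derivative too. Absolute
    continuity and existence of an a.e. derivative are carried along together; integrability of the
    derivative then follows.\<close>
  define good where "good = (\<lambda>g. AC g \<and> (\<exists>h. is_deriv g h))"
  have good_mult: "good (\<lambda>x. f x * g x)" if "good f" "good g" for f g
    using that AC_mult is_deriv_mult unfolding good_def by blast
  have good_sum: "good (\<lambda>x. \<Sum>i\<in>S. f i x)" if "\<And>i. i \<in> S \<Longrightarrow> good (f i)" for S :: "nat set" and f
  proof -
    have "\<forall>i\<in>S. \<exists>h. is_deriv (f i) h" using that unfolding good_def by blast
    then obtain f' where "\<forall>i\<in>S. is_deriv (f i) (f' i)" using bchoice[of S "\<lambda>i h. is_deriv (f i) h"] by blast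
    then show ?thesis using AC_sum[of S f] is_deriv_sum[of S f f'] that unfolding good_def by blast
  qed
  have good_const: "good (\<lambda>x. c)" for c using AC_const is_deriv_const unfolding good_def by blast
  have good_tpow2: "good (tpow m x)" for m x
  proof (cases m)
    case 0 then show ?thesis using good_const[of 1] by (simp add: tpow_def[abs_def])
  next
    case (Suc m') then show ?thesis using AC_tpow2 is_deriv_tpow2 unfolding good_def by blast
  qed
  have good_tpow1: "good (\<lambda>x. tpow m x t)" for m t
  proof -
    have "good (\<lambda>x. (- 1) ^ m * tpow m t x)" by (intro good_mult good_const good_tpow2)
    then show ?thesis by (simp add: tpow_swap[of m _ t])
  qed
  have good_Int0: "good (Int0 h)" if "L1 h" for h
    using AC_Int0[OF that] is_deriv_Int0[OF that] unfolding good_def by blast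
  have good_cong: "good g" if "good f" "\<And>x. x \<in> {0..1} \<Longrightarrow> f x = g x" for f g
    using that AC_cong[of f g] is_deriv_cong[of f _ g] unfolding good_def by (metis (mono_tags, lifting) always_eventually)
  have C: "good (Cpart W k \<nu> j)" if "k \<le> n" "\<nu> < k" for k \<nu> j
  proof -
    define B where "B = (\<lambda>\<tau>. W k \<nu> \<tau> * tpow j \<tau> 0)"
    have B: "L1 B" unfolding B_def using that by (intro L1_tpow1 W_L1) auto
    have "good (\<lambda>x. (- 1) ^ \<nu> * (\<Sum>i\<le>\<nu>. tpow i x 0 * Int0 (\<lambda>t. tpow (\<nu> - i) 0 t * B t) x))"
      by (intro good_mult good_sum good_const good_tpow1 good_Int0 L1_tpow2 B)
    then show ?thesis
    proof (rule good_cong)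
      fix x :: real assume x: "x \<in> {0..1}"
      have "Cpart W k \<nu> j x = (- 1) ^ \<nu> * Int0 (\<lambda>\<tau>. tpow \<nu> x \<tau> * B \<tau>) x" by (simp add: Cpart_def B_def)
      also have "Int0 (\<lambda>\<tau>. tpow \<nu> x \<tau> * B \<tau>) x = (\<Sum>i\<le>\<nu>. tpow i x 0 * Int0 (\<lambda>t. tpow (\<nu> - i) 0 t * B t) x)"
        using x by (intro Int0_tpow_separate2[OF B]) simp
      finally show "(- 1) ^ \<nu> * (\<Sum>i\<le>\<nu>. tpow i x 0 * Int0 (\<lambda>t. tpow (\<nu> - i) 0 t * B t) x) = Cpart W k \<nu> j x" ..
    qed
  qed
  have "good (\<lambda>x. \<Sum>k\<le>n. \<Sum>\<nu><k. if n - k + \<nu> \<le> i then Cpart W k \<nu> (i - (n - k + \<nu>)) x else 0)"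
  proof (intro good_sum)
    fix k \<nu> assume "k \<in> {..n}" "\<nu> \<in> {..<k}"
    then show "good (\<lambda>x. if n - k + \<nu> \<le> i then Cpart W k \<nu> (i - (n - k + \<nu>)) x else 0)"
      using C good_const[of 0] by (cases "n - k + \<nu> \<le> i") auto
  qed
  then show ?thesis
    using Wsob_1_L1_I unfolding good_def initial_coeff_def[abs_def] by blast
qed

section \<open>The differential expression\<close>

locale expression_coeffs =
  fixes n :: nat and q0 :: "real \<Rightarrow> complex" and q p :: "nat \<Rightarrow> fnl" and P Q :: "nat \<Rightarrow> real \<Rightarrow> complex"
  assumes q0_AC: "AC q0" and prims: "prims n q0 q p P Q"
begin

text \<open>Integrability of Q 0 is not part of \<open>prims\<close>; it holds because Q 0 is a
  derivative of the absolutely continuous q0.\<close>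

lemma L1_P: "k \<le> n \<Longrightarrow> L1 (P k)" and L1_Q: "k \<le> n \<Longrightarrow> L1 (Q k)"
  using prims L1_derivative_of_AC[OF q0_AC, of "Q 0"] unfolding prims_def
  by (auto, cases "k = 0") auto

lemma L1_leib_coeff:
  assumes k: "k \<le> n" shows "L1 (leib_coeff P Q k \<nu>)"
proof -
  have "L1 (\<lambda>t. a * P k t + b * Q k t)" for a b using k by (intro L1_add L1_cmult L1_P L1_Q)
  from this[of 1 "- \<i>"] this[of "of_nat (k choose \<nu>)" "\<i> * (of_nat ((k - 1) choose \<nu>) - (if \<nu> = 0 then 0 else of_nat ((k - 1) choose (\<nu> - 1))))"]
  show ?thesis unfolding leib_coeff_def[abs_def] by (cases "k = 0") simp_all
qed

sublocale kernel_coeffs n "leib_coeff P Q"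
  by unfold_locales (rule L1_leib_coeff)

lemma Kker_eq_K: "Kker n P Q = K"
  by (intro ext) (simp add: Kker_eq_sum_Kpart K_def)

context
  fixes y \<phi> :: "real \<Rightarrow> complex"
  assumes y: "Wsob n Linf y" and \<phi>: "W0inf (n + 1) \<phi>"
begin

definition Y where "Y = (\<lambda>j. (wder ^^ j) y)"
definition \<Phi> where "\<Phi> = (\<lambda>j. (wder ^^ j) \<phi>)"

lemma Y_chain: "deriv_chain n Y" "Linf (Y n)" and Y_Linf: "j \<le> n \<Longrightarrow> Linf (Y j)"
  using Wsob_Linf_wder[OF y] deriv_chain_Linf by (auto simp: Y_def)

lemma \<Phi>_chain: "deriv_chain (Suc n) \<Phi>" "Linf (\<Phi> (Suc n))"
  and \<Phi>_zero: "j \<le> n \<Longrightarrow> \<Phi> j 0 = 0 \<and> \<Phi> j 1 = 0"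
  using W0inf_wder[OF \<phi>] by (auto simp: \<Phi>_def)

lemma \<Phi>_Linf: "j \<le> Suc n \<Longrightarrow> Linf (\<Phi> j)"
  by (rule deriv_chain_Linf[OF \<Phi>_chain])

text \<open>The total order 2n - k is fixed; \<nu> says how it is shared between phi and y.\<close>

definition T where "T S k \<nu> = (LINT x:{0..1}|lebesgue. S x * (\<Phi> (n - \<nu>) x * Y (n - k + \<nu>) x))"

lemma T_L1:
  assumes "L1 S" "k \<le> n" "\<nu> \<le> k" shows "L1 (\<lambda>x. S x * (\<Phi> (n - \<nu>) x * Y (n - k + \<nu>) x))"
  using assms by (intro L1_mult_Linf Linf_mult \<Phi>_Linf Y_Linf) auto

lemma T_cmult: "T (\<lambda>x. c * S x) k \<nu> = c * T S k \<nu>"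
  unfolding T_def mult.assoc by simp

lemma T_add:
  assumes "L1 S" "L1 S'" "k \<le> n" "\<nu> \<le> k"
  shows "T (\<lambda>x. S x + S' x) k \<nu> = T S k \<nu> + T S' k \<nu>"
  using Int0_add[OF T_L1[OF assms(1,3,4)] T_L1[OF assms(2,3,4)], of 1]
  by (simp add: T_def Int0_def distrib_right)

text \<open>The signs of the n - k outer derivatives and of the k derivatives inside p_k combine to
  (-1)^n for every k. Reversing the sum makes the index count derivatives falling on y instead of
  phi.\<close>

lemma p_term:
  assumes k: "k \<le> n"
  shows "(fder ^^ (n - k)) (fmul (p k) ((wder ^^ (n - k)) y)) \<phi>
    = (- 1) ^ n * (\<Sum>\<nu>\<le>k. of_nat (k choose \<nu>) * T (P k) k \<nu>)"
proof -
  define F where "F = (\<lambda>j. \<Phi> (n - k + j))"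
  define G where "G = (\<lambda>j. Y (n - k + j))"
  have F: "deriv_chain k F" "Linf (F k)" "\<And>j. j < k \<Longrightarrow> F j 0 = 0 \<and> F j 1 = 0"
    and G: "deriv_chain k G" "Linf (G k)"
  proof -
    show "deriv_chain k F" "deriv_chain k G"
      unfolding F_def G_def using k by (intro deriv_chain_shift[OF \<Phi>_chain(1)] deriv_chain_shift[OF Y_chain(1)]; simp)+
  qed (use k \<Phi>_zero in \<open>auto simp: F_def G_def intro: \<Phi>_Linf Y_Linf\<close>)
  have "p k (\<lambda>x. F 0 x * G 0 x) = gder k (P k) (\<lambda>x. F 0 x * G 0 x)"
    using prims k W0inf_mult(1)[OF F G] by (auto simp: prims_def)
  also have "\<dots> = (- 1) ^ k * (\<Sum>i\<le>k. of_nat (k choose i) * (LINT x:{0..1}|lebesgue. P k x * (F i x * G (k - i) x)))"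
    by (rule gder_mult[OF F G L1_P[OF k]])
  also have "(\<Sum>i\<le>k. of_nat (k choose i) * (LINT x:{0..1}|lebesgue. P k x * (F i x * G (k - i) x)))
     = (\<Sum>\<nu>\<le>k. of_nat (k choose \<nu>) * T (P k) k \<nu>)"
    by (subst sum_rev_atMost, intro sum.cong refl)
       (use k in \<open>auto simp: T_def F_def G_def binomial_symmetric[symmetric]\<close>)
  finally show ?thesis
    using k by (simp add: fder_pow fmul_def F_def G_def \<Phi>_def Y_def mult.assoc[symmetric] power_add[symmetric])
qed

text \<open>Both terms apply a functional of order k - 1; the derivative missing to k sits on y in
  the first and on phi in the second. So \<nu> is the Leibniz index plus one in the first and the
  index itself in the second, and one more outer derivative gives opposite signs: hence the
  difference of two binomial coefficients.\<close>

lemma q_term: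
  assumes k: "k \<in> {1..n}"
  shows "(fder ^^ (n - k)) (fmul (q k) ((wder ^^ (n - k + 1)) y)) \<phi>
       + (fder ^^ (n - k + 1)) (fmul (q k) ((wder ^^ (n - k)) y)) \<phi>
    = (- 1) ^ n * (\<Sum>\<nu>\<le>k. (of_nat ((k - 1) choose \<nu>) - (if \<nu> = 0 then 0 else of_nat ((k - 1) choose (\<nu> - 1)))) * T (Q k) k \<nu>)"
proof -
  obtain m where m: "k = Suc m" using k by (cases k) auto
  have Qk: "L1 (Q k)" using L1_Q k by simp
  have qk: "q k g = gder m (Q k) g" if "W0inf m g" for g using prims k that m by (auto simp: prims_def)
  have sgn: "(- 1) ^ (n - k) * (- 1) ^ m = - ((- 1) ^ n :: complex)" "(- 1) ^ (n - k + 1) * (- 1) ^ m = ((- 1) ^ n :: complex)"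
  proof -
    have "(- 1) ^ (n - k + 1) * (- 1) ^ m = ((- 1) ^ (n - k + 1 + m) :: complex)" by (simp add: power_add)
    also have "n - k + 1 + m = n" using k m by auto
    finally show "(- 1) ^ (n - k + 1) * (- 1) ^ m = ((- 1) ^ n :: complex)" .
    then have "- ((- 1) ^ (n - k) * (- 1) ^ m) = ((- 1) ^ n :: complex)" by simp
    then show "(- 1) ^ (n - k) * (- 1) ^ m = - ((- 1) ^ n :: complex)" by (metis minus_minus)
  qed
  have 1: "(fder ^^ (n - k)) (fmul (q k) ((wder ^^ (n - k + 1)) y)) \<phi>
    = - ((- 1) ^ n * (\<Sum>\<nu>\<le>k. (if \<nu> = 0 then 0 else of_nat ((k - 1) choose (\<nu> - 1))) * T (Q k) k \<nu>))"
  proof -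
    define F where "F = (\<lambda>j. \<Phi> (n - k + j))"
    define G where "G = (\<lambda>j. Y (n - k + 1 + j))"
    have F: "deriv_chain m F" "Linf (F m)" "\<And>j. j < m \<Longrightarrow> F j 0 = 0 \<and> F j 1 = 0"
      and G: "deriv_chain m G" "Linf (G m)"
    proof -
      show "deriv_chain m F" "deriv_chain m G"
        unfolding F_def G_def using k m by (intro deriv_chain_shift[OF \<Phi>_chain(1)] deriv_chain_shift[OF Y_chain(1)]; simp)+
    qed (use k m \<Phi>_zero in \<open>auto simp: F_def G_def intro: \<Phi>_Linf Y_Linf\<close>)
    have "q k (\<lambda>x. F 0 x * G 0 x)
      = (- 1) ^ m * (\<Sum>i\<le>m. of_nat (m choose i) * (LINT x:{0..1}|lebesgue. Q k x * (F i x * G (m - i) x)))"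
      using qk[OF W0inf_mult(1)[OF F G]] gder_mult[OF F G Qk] by simp
    also have "(\<Sum>i\<le>m. of_nat (m choose i) * (LINT x:{0..1}|lebesgue. Q k x * (F i x * G (m - i) x)))
       = (\<Sum>i\<le>m. of_nat (m choose i) * T (Q k) k (Suc i))"
    proof (subst sum_rev_atMost, intro sum.cong refl)
      fix i assume i: "i \<in> {..m}"
      have "n - k + (m - i) = n - Suc i" "n - k + 1 + (m - (m - i)) = n - k + Suc i" using k m i by auto
      then show "of_nat (m choose (m - i)) * (LINT x:{0..1}|lebesgue. Q k x * (F (m - i) x * G (m - (m - i)) x))
        = of_nat (m choose i) * T (Q k) k (Suc i)"
        using i by (simp add: T_def F_def G_def binomial_symmetric[symmetric])
    qed
    also have "\<dots> = (\<Sum>\<nu>\<le>k. (if \<nu> = 0 then 0 else of_nat ((k - 1) choose (\<nu> - 1))) * T (Q k) k \<nu>)"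
      unfolding m by (subst sum.atMost_Suc_shift) simp
    finally have "(- 1) ^ (n - k) * q k (\<lambda>x. F 0 x * G 0 x) = ((- 1) ^ (n - k) * (- 1) ^ m) * (\<Sum>\<nu>\<le>k. (if \<nu> = 0 then 0 else of_nat ((k - 1) choose (\<nu> - 1))) * T (Q k) k \<nu>)"
      by (simp only: mult.assoc)
    then show ?thesis unfolding sgn by (simp add: fder_pow fmul_def F_def G_def \<Phi>_def Y_def)
  qed
  have 2: "(fder ^^ (n - k + 1)) (fmul (q k) ((wder ^^ (n - k)) y)) \<phi>
    = (- 1) ^ n * (\<Sum>\<nu>\<le>k. of_nat ((k - 1) choose \<nu>) * T (Q k) k \<nu>)"
  proof -
    define F where "F = (\<lambda>j. \<Phi> (n - k + 1 + j))"
    define G where "G = (\<lambda>j. Y (n - k + j))"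
    have F: "deriv_chain m F" "Linf (F m)" "\<And>j. j < m \<Longrightarrow> F j 0 = 0 \<and> F j 1 = 0"
      and G: "deriv_chain m G" "Linf (G m)"
    proof -
      show "deriv_chain m F" "deriv_chain m G"
        unfolding F_def G_def using k m by (intro deriv_chain_shift[OF \<Phi>_chain(1)] deriv_chain_shift[OF Y_chain(1)]; simp)+
    qed (use k m \<Phi>_zero in \<open>auto simp: F_def G_def intro: \<Phi>_Linf Y_Linf\<close>)
    have "q k (\<lambda>x. F 0 x * G 0 x)
      = (- 1) ^ m * (\<Sum>i\<le>m. of_nat (m choose i) * (LINT x:{0..1}|lebesgue. Q k x * (F i x * G (m - i) x)))"
      using qk[OF W0inf_mult(1)[OF F G]] gder_mult[OF F G Qk] by simp
    also have "(\<Sum>i\<le>m. of_nat (m choose i) * (LINT x:{0..1}|lebesgue. Q k x * (F i x * G (m - i) x)))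
       = (\<Sum>i\<le>m. of_nat (m choose i) * T (Q k) k i)"
    proof (subst sum_rev_atMost, intro sum.cong refl)
      fix i assume i: "i \<in> {..m}"
      have "n - k + 1 + (m - i) = n - i" "n - k + (m - (m - i)) = n - k + i" using k m i by auto
      then show "of_nat (m choose (m - i)) * (LINT x:{0..1}|lebesgue. Q k x * (F (m - i) x * G (m - (m - i)) x))
        = of_nat (m choose i) * T (Q k) k i"
        using i by (simp add: T_def F_def G_def binomial_symmetric[symmetric])
    qed
    also have "\<dots> = (\<Sum>\<nu>\<le>k. of_nat ((k - 1) choose \<nu>) * T (Q k) k \<nu>)"
      unfolding m by simp
    finally have "(- 1) ^ (n - k + 1) * q k (\<lambda>x. F 0 x * G 0 x) = ((- 1) ^ (n - k + 1) * (- 1) ^ m) * (\<Sum>\<nu>\<le>k. of_nat ((k - 1) choose \<nu>) * T (Q k) k \<nu>)"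
      by (simp only: mult.assoc)
    then show ?thesis unfolding sgn fder_pow fmul_def F_def G_def \<Phi>_def Y_def by (simp only: add_0_right)
  qed
  show ?thesis unfolding 1 2 by (simp add: left_diff_distrib sum_subtractf right_diff_distrib)
qed

text \<open>As y^(n+1) is only a generalized derivative, it is transferred to q0 phi^(n). The
  product rule gives q0 phi^(n+1), which doubles the second term and produces the 2 in 2 i q0, and
  q0' phi^(n), which enters the kernel.\<close>

lemma q0_term:
  "(fder ^^ n) (fmul (fder (fnl_of ((wder ^^ n) y))) q0) \<phi> + (fder ^^ (n + 1)) (fmul (fnl_of q0) ((wder ^^ n) y)) \<phi>
    = (- 1) ^ (n + 1) * (2 * Int0 (\<lambda>x. q0 x * Y n x * \<Phi> (Suc n) x) 1 + T (Q 0) 0 0)"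
proof -
  have L: "L1 (\<lambda>x. q0 x * Y n x * \<Phi> (Suc n) x)"
    by (intro Linf_imp_L1 Linf_mult Linf_AC q0_AC Y_Linf \<Phi>_Linf) auto
  have LT: "L1 (\<lambda>x. Q 0 x * (\<Phi> (n - 0) x * Y (n - 0 + 0) x))" by (intro T_L1 L1_Q) auto
  have "is_deriv (\<lambda>x. \<Phi> n x * q0 x) (\<lambda>x. \<Phi> n x * Q 0 x + \<Phi> (Suc n) x * q0 x)"
    using \<Phi>_chain(1) prims by (intro is_deriv_mult) (auto simp: deriv_chain_def prims_def)
  from wder_eq_AE[OF this]
  have "AE x\<in>{0..1} in lebesgue.
      q0 x * Y n x * \<Phi> (Suc n) x + Q 0 x * (\<Phi> (n - 0) x * Y (n - 0 + 0) x) = Y n x * wder (\<lambda>x. \<Phi> n x * q0 x) x"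
    by eventually_elim (auto simp: algebra_simps)
  then have "(LINT x:{0..1}|lebesgue. Y n x * wder (\<lambda>x. \<Phi> n x * q0 x) x)
     = Int0 (\<lambda>x. q0 x * Y n x * \<Phi> (Suc n) x + Q 0 x * (\<Phi> (n - 0) x * Y (n - 0 + 0) x)) 1"
    unfolding Int0_def by (intro L1_LINT_cong_AE[symmetric] L1_add L LT) auto
  also have "\<dots> = Int0 (\<lambda>x. q0 x * Y n x * \<Phi> (Suc n) x) 1 + T (Q 0) 0 0"
    by (subst Int0_add[OF L LT]) (auto simp: T_def Int0_def)
  finally have 1: "(fder ^^ n) (fmul (fder (fnl_of ((wder ^^ n) y))) q0) \<phi>
     = (- 1) ^ (n + 1) * (Int0 (\<lambda>x. q0 x * Y n x * \<Phi> (Suc n) x) 1 + T (Q 0) 0 0)"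
    by (simp add: fder_pow fmul_def fder_def fnl_of_def \<Phi>_def Y_def algebra_simps)
  have 2: "(fder ^^ (n + 1)) (fmul (fnl_of q0) ((wder ^^ n) y)) \<phi> = (- 1) ^ (n + 1) * Int0 (\<lambda>x. q0 x * Y n x * \<Phi> (Suc n) x) 1"
    unfolding fder_pow[of "n + 1"] fmul_def fnl_of_def Int0_def \<Phi>_def Y_def by (simp add: mult_ac)
  show ?thesis unfolding 1 2 by (simp add: algebra_simps)
qed

text \<open>The term with q0' carries (-1)^(n+1), against (-1)^n for all other integrals
  \<open>T\<close>; this is the origin of the minus sign in \<open>leib_coeff\<close> at k =
  0.\<close>

lemma ell_expand:
  "ell n q0 q p y \<phi> = (- 1) ^ (n + 1) * (2 * \<i> * Int0 (\<lambda>x. q0 x * Y n x * \<Phi> (Suc n) x) 1)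
     + (- 1) ^ n * (\<Sum>k\<le>n. \<Sum>\<nu>\<le>k. T (leib_coeff P Q k \<nu>) k \<nu>)"
proof -
  define c where "c = (\<lambda>k \<nu>. of_nat ((k - 1) choose \<nu>) - (if \<nu> = 0 then 0 else of_nat ((k - 1) choose (\<nu> - 1))) :: complex)"
  have T0: "T (leib_coeff P Q 0 0) 0 0 = T (P 0) 0 0 - \<i> * T (Q 0) 0 0"
    using T_add[OF L1_P[of 0] L1_cmult[OF L1_Q[of 0], of "- \<i>"], of 0 0]
    by (simp add: leib_coeff_def[abs_def] T_cmult[of "- \<i>" "Q 0", simplified])
  have Tk: "T (leib_coeff P Q k \<nu>) k \<nu> = of_nat (k choose \<nu>) * T (P k) k \<nu> + \<i> * (c k \<nu> * T (Q k) k \<nu>)"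
    if "k \<in> {1..n}" "\<nu> \<le> k" for k \<nu>
  proof -
    have "k \<noteq> 0" "k \<le> n" using that by auto
    then have "T (leib_coeff P Q k \<nu>) k \<nu> = T (\<lambda>t. of_nat (k choose \<nu>) * P k t + (\<i> * c k \<nu>) * Q k t) k \<nu>"
      by (simp add: leib_coeff_def[abs_def] c_def)
    also have "\<dots> = of_nat (k choose \<nu>) * T (P k) k \<nu> + \<i> * (c k \<nu> * T (Q k) k \<nu>)"
      using \<open>k \<le> n\<close> that by (subst T_add) (auto intro!: L1_cmult L1_P L1_Q simp: T_cmult mult.assoc)
    finally show ?thesis .
  qed
  have spl: "(\<Sum>k\<le>n. g k) = g 0 + (\<Sum>k\<in>{1..n}. g k)" for g :: "nat \<Rightarrow> complex"
    by (simp add: atMost_atLeast0 sum.atLeast_Suc_atMost)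
  have "(\<Sum>k\<le>n. \<Sum>\<nu>\<le>k. T (leib_coeff P Q k \<nu>) k \<nu>)
      = T (P 0) 0 0 - \<i> * T (Q 0) 0 0 + (\<Sum>k\<in>{1..n}. \<Sum>\<nu>\<le>k. of_nat (k choose \<nu>) * T (P k) k \<nu> + \<i> * (c k \<nu> * T (Q k) k \<nu>))"
    by (subst spl) (simp add: T0 Tk)
  also have "\<dots> = (\<Sum>k\<le>n. \<Sum>\<nu>\<le>k. of_nat (k choose \<nu>) * T (P k) k \<nu>)
      + \<i> * ((\<Sum>k\<in>{1..n}. \<Sum>\<nu>\<le>k. c k \<nu> * T (Q k) k \<nu>) - T (Q 0) 0 0)"
    by (subst spl) (simp add: sum.distrib sum_distrib_left algebra_simps)
  finally have S: "(\<Sum>k\<le>n. \<Sum>\<nu>\<le>k. T (leib_coeff P Q k \<nu>) k \<nu>) = \<dots>" .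
  have "ell n q0 q p y \<phi> = \<i> * ((- 1) ^ (n + 1) * (2 * Int0 (\<lambda>x. q0 x * Y n x * \<Phi> (Suc n) x) 1 + T (Q 0) 0 0)
      + (\<Sum>k\<in>{1..n}. (- 1) ^ n * (\<Sum>\<nu>\<le>k. c k \<nu> * T (Q k) k \<nu>)))
      + (\<Sum>k\<le>n. (- 1) ^ n * (\<Sum>\<nu>\<le>k. of_nat (k choose \<nu>) * T (P k) k \<nu>))"
  proof -
    have "(\<Sum>k\<in>{1..n}. (fder ^^ (n - k)) (fmul (q k) ((wder ^^ (n - k + 1)) y)) \<phi>
                      + (fder ^^ (n - k + 1)) (fmul (q k) ((wder ^^ (n - k)) y)) \<phi>)
        = (\<Sum>k\<in>{1..n}. (- 1) ^ n * (\<Sum>\<nu>\<le>k. c k \<nu> * T (Q k) k \<nu>))"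
      unfolding c_def by (intro sum.cong refl q_term)
    moreover have "(\<Sum>k\<le>n. (fder ^^ (n - k)) (fmul (p k) ((wder ^^ (n - k)) y)) \<phi>)
        = (\<Sum>k\<le>n. (- 1) ^ n * (\<Sum>\<nu>\<le>k. of_nat (k choose \<nu>) * T (P k) k \<nu>))"
      by (intro sum.cong refl p_term) simp
    ultimately show ?thesis unfolding ell_def q0_term by (simp only:)
  qed
  then show ?thesis unfolding S by (simp add: sum_distrib_left[symmetric] algebra_simps)
qed

lemma ell_representation:
  "ell n q0 q p y \<phi> = (- 1) ^ (n + 1) * (LINT x:{0..1}|lebesgue.
      (Bop q0 (Kker n P Q) ((wder ^^ n) y) x + (\<Sum>\<nu><n. (wder ^^ \<nu>) y 0 * initial_coeff n (leib_coeff P Q) \<nu> x))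
        * (wder ^^ (n + 1)) \<phi> x)"
proof -
  let ?W = "leib_coeff P Q"
  define \<psi> where "\<psi> = \<Phi> (Suc n)"
  \<comment> \<open>The factor that remains beside phi^(n+1) once phi has been expanded at 1.
    Separation of variables makes it absolutely continuous in x.\<close>
  define V where "V = (\<lambda>k \<nu> x. (- 1) ^ \<nu> * Int0 (\<lambda>\<tau>. tpow \<nu> x \<tau> * (?W k \<nu> \<tau> * Y (n - k + \<nu>) \<tau>)) x)"
  have LW: "L1 (\<lambda>\<tau>. ?W k \<nu> \<tau> * Y (n - k + \<nu>) \<tau>)" if "k \<le> n" "\<nu> \<le> k" for k \<nu>
    using that by (intro L1_mult_Linf W_L1 Y_Linf) auto
  have V_AC: "AC (V k \<nu>)" if "k \<le> n" "\<nu> \<le> k" for k \<nu>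
  proof -
    have "AC (\<lambda>x. (- 1) ^ \<nu> * (\<Sum>i\<le>\<nu>. tpow i x 0 * Int0 (\<lambda>t. tpow (\<nu> - i) 0 t * (?W k \<nu> t * Y (n - k + \<nu>) t)) x))"
      by (intro AC_mult AC_const AC_sum AC_tpow1 AC_Int0 L1_tpow2 LW that)
    then show ?thesis by (rule AC_cong[rotated]) (simp add: V_def Int0_tpow_separate2[OF LW[OF that], where m = \<nu>])
  qed
  have \<psi>: "Linf \<psi>" unfolding \<psi>_def by (rule \<Phi>_chain)
  have VL: "L1 (\<lambda>x. V k \<nu> x * \<psi> x)" if "k \<le> n" "\<nu> \<le> k" for k \<nu>
    using that by (intro Linf_imp_L1 Linf_mult Linf_AC V_AC \<psi>)
  \<comment> \<open>The factor (-1)^\<nu> is part of V; the minus sign left over turns (-1)^n into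
    (-1)^(n+1).\<close>
  have "T (?W k \<nu>) k \<nu> = - Int0 (\<lambda>x. V k \<nu> x * \<psi> x) 1" if "k \<le> n" "\<nu> \<le> k" for k \<nu>
  proof -
    have "T (?W k \<nu>) k \<nu> = Int0 (\<lambda>\<tau>. (?W k \<nu> \<tau> * Y (n - k + \<nu>) \<tau>) * \<Phi> (n - \<nu>) \<tau>) 1"
      unfolding T_def Int0_def by (simp add: mult_ac)
    also have "\<dots> = (- 1) ^ Suc \<nu> * Int0 (\<lambda>x. \<psi> x * Int0 (\<lambda>\<tau>. tpow \<nu> x \<tau> * (?W k \<nu> \<tau> * Y (n - k + \<nu>) \<tau>)) x) 1"
      unfolding \<psi>_def using that \<Phi>_zero by (intro phi_side LW Linf_imp_L1 \<Phi>_chain) auto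
    also have "\<dots> = - Int0 (\<lambda>x. V k \<nu> x * \<psi> x) 1"
    proof -
      have "Int0 (\<lambda>x. V k \<nu> x * \<psi> x) 1 = Int0 (\<lambda>x. (- 1) ^ \<nu> * (\<psi> x * Int0 (\<lambda>\<tau>. tpow \<nu> x \<tau> * (?W k \<nu> \<tau> * Y (n - k + \<nu>) \<tau>)) x)) 1"
        by (rule Int0_cong) (simp add: V_def mult_ac)
      then show ?thesis by (simp add: Int0_cmult)
    qed
    finally show ?thesis .
  qed
  then have "(\<Sum>k\<le>n. \<Sum>\<nu>\<le>k. T (?W k \<nu>) k \<nu>) = - (\<Sum>k\<le>n. \<Sum>\<nu>\<le>k. Int0 (\<lambda>x. V k \<nu> x * \<psi> x) 1)"
    by (simp add: sum_negf)
  also have "(\<Sum>k\<le>n. \<Sum>\<nu>\<le>k. Int0 (\<lambda>x. V k \<nu> x * \<psi> x) 1) = Int0 (\<lambda>x. (\<Sum>k\<le>n. \<Sum>\<nu>\<le>k. V k \<nu> x * \<psi> x)) 1"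
    using VL by (subst Int0_sum) (auto intro!: L1_sum Int0_sum[symmetric] sum.cong)
  finally have S: "(\<Sum>k\<le>n. \<Sum>\<nu>\<le>k. T (?W k \<nu>) k \<nu>) = - \<dots>" .
  have L: "L1 (\<lambda>x. 2 * \<i> * (q0 x * Y n x * \<psi> x))" "L1 (\<lambda>x. \<Sum>k\<le>n. \<Sum>\<nu>\<le>k. V k \<nu> x * \<psi> x)"
    subgoal by (intro L1_cmult Linf_imp_L1 Linf_mult Linf_AC[OF q0_AC] Y_Linf order_refl \<psi>)
    subgoal using VL by (intro L1_sum) auto
    done
  have "ell n q0 q p y \<phi> = (- 1) ^ (n + 1) * (Int0 (\<lambda>x. 2 * \<i> * (q0 x * Y n x * \<psi> x)) 1
     + Int0 (\<lambda>x. \<Sum>k\<le>n. \<Sum>\<nu>\<le>k. V k \<nu> x * \<psi> x) 1)"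
    unfolding ell_expand S Int0_cmult \<psi>_def by (simp add: algebra_simps)
  also have "\<dots> = (- 1) ^ (n + 1) * Int0 (\<lambda>x. 2 * \<i> * (q0 x * Y n x * \<psi> x) + (\<Sum>k\<le>n. \<Sum>\<nu>\<le>k. V k \<nu> x * \<psi> x)) 1"
    by (subst Int0_add[OF L]) auto
  also have "Int0 (\<lambda>x. 2 * \<i> * (q0 x * Y n x * \<psi> x) + (\<Sum>k\<le>n. \<Sum>\<nu>\<le>k. V k \<nu> x * \<psi> x)) 1
    = Int0 (\<lambda>x. (Bop q0 (Kker n P Q) (Y n) x + (\<Sum>i<n. Y i 0 * initial_coeff n ?W i x)) * \<psi> x) 1"
  proof (rule Int0_cong)
    fix x :: real assume x: "x \<in> {0..1}"
    have "(\<Sum>k\<le>n. \<Sum>\<nu>\<le>k. V k \<nu> x) = (\<Sum>k\<le>n. \<Sum>\<nu>\<le>k. Int0 (\<lambda>t. Kext k \<nu> x t * Y n t) x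
      + (\<Sum>i<n. Y i 0 * (if \<nu> < k \<and> n - k + \<nu> \<le> i then Cpart ?W k \<nu> (i - (n - k + \<nu>)) x else 0)))"
      unfolding V_def by (intro sum.cong refl y_side Y_chain x) auto
    also have "\<dots> = Int0 (\<lambda>t. K x t * Y n t) x
      + (\<Sum>k\<le>n. \<Sum>\<nu>\<le>k. \<Sum>i<n. Y i 0 * (if \<nu> < k \<and> n - k + \<nu> \<le> i then Cpart ?W k \<nu> (i - (n - k + \<nu>)) x else 0))"
      by (simp add: sum.distrib Int0_K[OF x Y_chain(2)])
    also have "(\<Sum>k\<le>n. \<Sum>\<nu>\<le>k. \<Sum>i<n. Y i 0 * (if \<nu> < k \<and> n - k + \<nu> \<le> i then Cpart ?W k \<nu> (i - (n - k + \<nu>)) x else 0))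
      = (\<Sum>k\<le>n. \<Sum>i<n. \<Sum>\<nu>\<le>k. Y i 0 * (if \<nu> < k \<and> n - k + \<nu> \<le> i then Cpart ?W k \<nu> (i - (n - k + \<nu>)) x else 0))"
      by (intro sum.cong refl sum.swap)
    also have "\<dots> = (\<Sum>i<n. \<Sum>k\<le>n. \<Sum>\<nu>\<le>k. Y i 0 * (if \<nu> < k \<and> n - k + \<nu> \<le> i then Cpart ?W k \<nu> (i - (n - k + \<nu>)) x else 0))"
      by (rule sum.swap)
    also have "\<dots> = (\<Sum>i<n. Y i 0 * initial_coeff n ?W i x)"
      unfolding initial_coeff_def sum_distrib_left
      by (intro sum.cong refl sum.mono_neutral_cong_right) auto
    finally have VV: "(\<Sum>k\<le>n. \<Sum>\<nu>\<le>k. V k \<nu> x) = Int0 (\<lambda>t. K x t * Y n t) x + (\<Sum>i<n. Y i 0 * initial_coeff n ?W i x)" .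
    have "(\<Sum>k\<le>n. \<Sum>\<nu>\<le>k. V k \<nu> x * \<psi> x) = (\<Sum>k\<le>n. \<Sum>\<nu>\<le>k. V k \<nu> x) * \<psi> x"
      by (simp add: sum_distrib_right)
    then show "2 * \<i> * (q0 x * Y n x * \<psi> x) + (\<Sum>k\<le>n. \<Sum>\<nu>\<le>k. V k \<nu> x * \<psi> x)
      = (Bop q0 (Kker n P Q) (Y n) x + (\<Sum>i<n. Y i 0 * initial_coeff n ?W i x)) * \<psi> x"
      by (simp add: VV Bop_def Kker_eq_K Int0_def[symmetric] algebra_simps)
  qed
  finally show ?thesis by (simp add: Int0_def Y_def \<psi>_def \<Phi>_def)
qed

end

end

section \<open>Functions annihilated by all test derivatives\<close>

lemma tpow_sum_eq_0:
  assumes S: "infinite S" and z: "\<And>x. x \<in> S \<Longrightarrow> (\<Sum>j\<le>m. c j * tpow j x 0) = 0" and j: "j \<le> m"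
  shows "c j = 0"
proof (rule ccontr)
  assume "c j \<noteq> 0"
  then have "\<exists>k\<le>m. c k / fact k \<noteq> 0" using j by (intro exI[of _ j]) auto
  then have fin: "finite {z. (\<Sum>i\<le>m. c i / fact i * z ^ i) = 0}" using polyfun_rootbound[of m "\<lambda>k. c k / fact k"] by blast
  have "complex_of_real ` S \<subseteq> {z. (\<Sum>i\<le>m. c i / fact i * z ^ i) = 0}"
    using z by (auto simp: tpow_def)
  then have "finite (complex_of_real ` S)" using fin finite_subset by blast
  then show False using S by (auto dest!: finite_imageD simp: inj_on_def)
qed

lemma Int0_norm_eq_0:
  assumes g: "L1 (g :: real \<Rightarrow> complex)" and x: "x \<in> {0..1}"
    and z: "Int0 (\<lambda>t. complex_of_real (norm (g t))) x = 0"
  shows "AE t\<in>{0..x} in lebesgue. g t = 0"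
proof -
  have i: "integrable lebesgue (\<lambda>t. indicator {0..x} t *\<^sub>R norm (g t))"
    using L1_subinterval[OF L1_norm[OF g], of 0 x] x by (simp add: set_integrable_def)
  have "(\<integral>t. indicator {0..x} t *\<^sub>R norm (g t) \<partial>lebesgue) = 0"
    using z unfolding Int0_def set_integral_complex_of_real by (simp add: set_lebesgue_integral_def)
  then have "AE t in lebesgue. indicator {0..x} t *\<^sub>R norm (g t) = 0"
    using integral_nonneg_eq_0_iff_AE[OF i] by simp
  then show ?thesis by eventually_elim auto
qed

text \<open>The bounded multiplier that turns g into its modulus: a function orthogonal to it
  vanishes, which is how integral identities become pointwise ones.\<close>

lemma Linf_cnj_sgn:
  assumes "L1 g" shows "Linf (\<lambda>t. cnj (sgn (g t)))"
  unfolding Linf_def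
proof
  define h where "h = (\<lambda>t. indicator {0..1} t *\<^sub>R g t)"
  have h: "h \<in> borel_measurable lebesgue"
    using L1_measurable[OF assms] by (simp add: set_borel_measurable_def h_def)
  have "(\<lambda>t. cnj (sgn (h t))) \<in> borel_measurable lebesgue"
    unfolding sgn_div_norm
    by (intro borel_measurable_continuous_on[where f = cnj] continuous_intros borel_measurable_scaleR borel_measurable_inverse measurable_compose[OF h borel_measurable_norm] h)
  moreover have "(\<lambda>t. cnj (sgn (h t))) = (\<lambda>t. indicator {0..1} t *\<^sub>R cnj (sgn (g t)))"
    by (auto simp: indicator_def h_def)
  ultimately show "set_borel_measurable lebesgue {0..1} (\<lambda>t. cnj (sgn (g t)))"
    by (simp add: set_borel_measurable_def)
  show "\<exists>M. AE x\<in>{0..1} in lebesgue. norm (cnj (sgn (g x))) \<le> M"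
    by (intro exI[of _ 1]) (auto simp: norm_sgn)
qed

lemma mult_cnj_sgn: "z * cnj (sgn z) = complex_of_real (norm z)"
proof (cases "z = 0")
  case False
  have "z * cnj (sgn z) = (z * cnj z) /\<^sub>R norm z"
    by (simp add: sgn_div_norm)
  also have "\<dots> = complex_of_real (norm z)"
    using False by (simp add: complex_norm_square[symmetric] power2_eq_square scaleR_conv_of_real)
  finally show ?thesis .
qed auto

text \<open>In the induction step, some \<psi>0 has k-th moment 1 and vanishing lower moments, since otherwise the
  induction hypothesis would make x^k a polynomial of degree less than k.\<close>

lemma annihilator_of_moments:
  assumes "L1 F"
    and "\<And>\<psi>. Linf \<psi> \<Longrightarrow> (\<And>j. j < k \<Longrightarrow> Int0 (\<lambda>x. tpow j x 0 * \<psi> x) 1 = 0) \<Longrightarrow> Int0 (\<lambda>x. F x * \<psi> x) 1 = 0"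
  shows "\<exists>c. AE x\<in>{0..1} in lebesgue. F x = (\<Sum>j<k. c j * tpow j x 0)"
  using assms
proof (induction k arbitrary: F)
  case 0
  have "Int0 (\<lambda>x. F x * cnj (sgn (F x))) 1 = 0" using 0 Linf_cnj_sgn by auto
  then have "AE t\<in>{0..1} in lebesgue. F t = 0"
    unfolding mult_cnj_sgn by (intro Int0_norm_eq_0 0) auto
  then show ?case by simp
next
  case (Suc k)
  have Lt: "Linf (\<lambda>x. tpow j x 0)" for j by (intro Linf_AC AC_tpow1)
  have "\<exists>\<psi>0. Linf \<psi>0 \<and> (\<forall>j<k. Int0 (\<lambda>x. tpow j x 0 * \<psi>0 x) 1 = 0) \<and> Int0 (\<lambda>x. tpow k x 0 * \<psi>0 x) 1 \<noteq> 0"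
  proof (rule ccontr)
    assume "\<not> ?thesis"
    then have "\<exists>c. AE x\<in>{0..1} in lebesgue. tpow k x 0 = (\<Sum>j<k. c j * tpow j x 0)"
      by (intro Suc.IH Linf_imp_L1[OF Lt]) blast
    then obtain c where c: "AE x\<in>{0..1} in lebesgue. tpow k x 0 = (\<Sum>j<k. c j * tpow j x 0)" by blast
    define d where "d = (\<lambda>j. if j = k then 1 else - c j)"
    have "(\<Sum>j\<le>k. d j * tpow j x 0) = 0" if x: "x \<in> {0..1}" for x
    proof -
      have "tpow k x 0 = (\<Sum>j<k. c j * tpow j x 0)"
        by (rule continuous_AE_imp_eq[OF _ _ c x]) (intro AC_continuous_on AC_sum AC_mult AC_const AC_tpow1)+
      then show ?thesis by (simp add: lessThan_Suc_atMost[symmetric] d_def sum_negf)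
    qed
    then have "d k = 0" by (intro tpow_sum_eq_0[of "{0..1}" d k k]) (auto simp: infinite_Icc)
    then show False by (simp add: d_def)
  qed
  then obtain \<psi>0 where \<psi>0: "Linf \<psi>0" "\<And>j. j < k \<Longrightarrow> Int0 (\<lambda>x. tpow j x 0 * \<psi>0 x) 1 = 0"
    "Int0 (\<lambda>x. tpow k x 0 * \<psi>0 x) 1 \<noteq> 0" by blast
  define \<mu> where "\<mu> = Int0 (\<lambda>x. tpow k x 0 * \<psi>0 x) 1"
  \<comment> \<open>The only possible coefficient of \<open>tpow k\<close>: subtracting A *
    \<open>tpow k\<close> makes F orthogonal to \<psi>0.\<close>
  define A where "A = Int0 (\<lambda>x. F x * \<psi>0 x) 1 / \<mu>"
  have lin: "Int0 (\<lambda>x. G x * (\<psi> x + b * \<psi>0 x)) 1 = Int0 (\<lambda>x. G x * \<psi> x) 1 + b * Int0 (\<lambda>x. G x * \<psi>0 x) 1"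
    if "L1 G" "Linf \<psi>" for G \<psi> b
  proof -
    have "Int0 (\<lambda>x. G x * \<psi> x + b * (G x * \<psi>0 x)) 1 = Int0 (\<lambda>x. G x * \<psi> x) 1 + Int0 (\<lambda>x. b * (G x * \<psi>0 x)) 1"
      using that \<psi>0 by (intro Int0_add L1_cmult L1_mult_Linf) auto
    then show ?thesis by (simp add: Int0_cmult algebra_simps)
  qed
  have "\<exists>c. AE x\<in>{0..1} in lebesgue. F x + (- A) * tpow k x 0 = (\<Sum>j<k. c j * tpow j x 0)"
  proof (rule Suc.IH)
    show L: "L1 (\<lambda>x. F x + (- A) * tpow k x 0)" by (intro L1_add Suc.prems L1_cmult Linf_imp_L1 Lt)
    fix \<psi> assume \<psi>: "Linf \<psi>" "\<And>j. j < k \<Longrightarrow> Int0 (\<lambda>x. tpow j x 0 * \<psi> x) 1 = 0"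
    \<comment> \<open>Chosen to cancel the k-th moment of \<psi>; the lower moments stay zero
      because those of \<psi>0 vanish.\<close>
    define b where "b = - (Int0 (\<lambda>x. tpow k x 0 * \<psi> x) 1 / \<mu>)"
    have "Int0 (\<lambda>x. F x * (\<psi> x + b * \<psi>0 x)) 1 = 0"
    proof (rule Suc.prems(2))
      show "Linf (\<lambda>x. \<psi> x + b * \<psi>0 x)" by (intro Linf_add Linf_mult Linf_const \<psi> \<psi>0)
      fix j assume "j < Suc k"
      then show "Int0 (\<lambda>x. tpow j x 0 * (\<psi> x + b * \<psi>0 x)) 1 = 0"
        unfolding lin[OF Linf_imp_L1[OF Lt] \<psi>(1)] using \<psi> \<psi>0
        by (cases "j = k") (auto simp: b_def \<mu>_def)
    qed
    then have 1: "Int0 (\<lambda>x. F x * \<psi> x) 1 = A * Int0 (\<lambda>x. tpow k x 0 * \<psi> x) 1"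
      unfolding lin[OF Suc.prems(1) \<psi>(1)] by (simp add: A_def b_def)
    have "Int0 (\<lambda>x. (F x + (- A) * tpow k x 0) * \<psi> x) 1 = Int0 (\<lambda>x. F x * \<psi> x + (- A) * (tpow k x 0 * \<psi> x)) 1"
      by (rule Int0_cong) (simp add: algebra_simps)
    also have "\<dots> = Int0 (\<lambda>x. F x * \<psi> x) 1 + Int0 (\<lambda>x. (- A) * (tpow k x 0 * \<psi> x)) 1"
      using \<psi> Suc.prems(1) Linf_imp_L1[OF Lt] by (intro Int0_add L1_cmult L1_mult_Linf) auto
    finally show "Int0 (\<lambda>x. (F x + (- A) * tpow k x 0) * \<psi> x) 1 = 0"
      unfolding Int0_cmult 1 by simp
  qed
  then obtain c where c: "AE x\<in>{0..1} in lebesgue. F x + (- A) * tpow k x 0 = (\<Sum>j<k. c j * tpow j x 0)" by blast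
  have "AE x\<in>{0..1} in lebesgue. F x = (\<Sum>j<Suc k. (if j = k then A else c j) * tpow j x 0)"
    using c by eventually_elim (auto simp: algebra_simps)
  then show ?case by (rule exI[of _ "\<lambda>j. if j = k then A else c j"])
qed

text \<open>Supplies functions with a prescribed n-th derivative and vanishing initial values, both
  as arguments y and as test functions.\<close>

lemma deriv_chain_iterated_Int0:
  assumes "L1 f" shows "deriv_chain n (\<lambda>j. (Int0 ^^ (n - j)) f)"
  unfolding deriv_chain_def
proof (intro allI impI)
  fix j assume j: "j < n"
  have L: "L1 ((Int0 ^^ m) f)" for m
    using assms by (induction m) (auto intro: Linf_imp_L1 Linf_AC AC_Int0)
  have "n - j = Suc (n - Suc j)" using j by simp
  then show "AC ((Int0 ^^ (n - j)) f) \<and> is_deriv ((Int0 ^^ (n - j)) f) ((Int0 ^^ (n - Suc j)) f)"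
    using AC_Int0[OF L] is_deriv_Int0[OF L] by simp
qed

text \<open>The iterated primitive vanishes at 0 by construction, and by Taylor's formula its
  derivatives at 1 are combinations of moments of \<psi>. So every bounded function orthogonal to
  the polynomials of degree at most n is an (n+1)-st derivative of a test function.\<close>

lemma test_function_of_moments:
  assumes \<psi>: "Linf \<psi>" and m: "\<And>j. j \<le> n \<Longrightarrow> Int0 (\<lambda>x. tpow j x 0 * \<psi> x) 1 = 0"
  shows "\<exists>\<phi>. W0inf (Suc n) \<phi> \<and> (AE x\<in>{0..1} in lebesgue. (wder ^^ Suc n) \<phi> x = \<psi> x)"
proof -
  define D where "D = (\<lambda>j. (Int0 ^^ (Suc n - j)) \<psi>)"
  have D: "deriv_chain (Suc n) D" unfolding D_def by (rule deriv_chain_iterated_Int0[OF Linf_imp_L1[OF \<psi>]])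
  have Dn: "D (Suc n) = \<psi>" by (simp add: D_def)
  have D0: "D j 0 = 0" if "j \<le> n" for j
    using that by (simp add: D_def Suc_diff_le)
  have D1: "D j 1 = 0" if j: "j \<le> n" for j
  proof -
    have "deriv_chain (Suc (n - j)) (\<lambda>i. D (j + i))" using j by (intro deriv_chain_shift[OF D]) auto
    from deriv_chain_taylor[OF this, of 0 1] have "D j 1 = Int0 (\<lambda>t. tpow (n - j) 1 t * \<psi> t) 1"
      using j D0 Dn by simp
    also have "\<dots> = (\<Sum>i\<le>n - j. tpow i 1 0 * Int0 (\<lambda>t. tpow (n - j - i) 0 t * \<psi> t) 1)"
      by (rule Int0_tpow_separate2[OF Linf_imp_L1[OF \<psi>]]) simp
    also have "\<dots> = 0"
    proof (intro sum.neutral ballI)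
      fix i
      have "Int0 (\<lambda>t. tpow (n - j - i) 0 t * \<psi> t) 1 = Int0 (\<lambda>t. (- 1) ^ (n - j - i) * (tpow (n - j - i) t 0 * \<psi> t)) 1"
        by (rule Int0_cong, subst tpow_swap) (simp add: mult_ac)
      also have "\<dots> = 0" unfolding Int0_cmult using m[of "n - j - i"] by simp
      finally show "tpow i 1 0 * Int0 (\<lambda>t. tpow (n - j - i) 0 t * \<psi> t) 1 = 0" by simp
    qed
    finally show ?thesis .
  qed
  have "W0inf (Suc n) (D 0)"
    unfolding W0inf_def using D D0 D1 Dn \<psi> by (intro exI[of _ D]) (auto simp: deriv_chain_def)
  moreover have "AE x\<in>{0..1} in lebesgue. (wder ^^ Suc n) (D 0) x = \<psi> x"
    using wder_chain(2)[OF D] Dn by simp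
  ultimately show ?thesis by blast
qed

section \<open>Independence of the kernel of the primitives\<close>

context kernel_coeffs
begin

text \<open>\<open>y_side\<close> is read backwards: f is the n-th derivative of an iterated
  primitive with zero initial values, so integration against the kernel equals an integral whose
  dependence on x can be separated.\<close>

lemma AC_Int0_K:
  assumes f: "Linf f" shows "AC (\<lambda>x. Int0 (\<lambda>t. K x t * f t) x)"
proof -
  define D where "D = (\<lambda>j. (Int0 ^^ (n - j)) f)"
  have D: "deriv_chain n D" unfolding D_def by (rule deriv_chain_iterated_Int0[OF Linf_imp_L1[OF f]])
  have Dn: "D n = f" by (simp add: D_def)
  have D0: "D j 0 = 0" if "j < n" for j
    using that by (cases "n - j") (auto simp: D_def)
  have eq: "Int0 (\<lambda>t. Kext k \<nu> x t * f t) x = (- 1) ^ \<nu> * Int0 (\<lambda>\<tau>. tpow \<nu> x \<tau> * (W k \<nu> \<tau> * D (n - k + \<nu>) \<tau>)) x"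
    if "k \<le> n" "\<nu> \<le> k" "x \<in> {0..1}" for k \<nu> x
    using y_side[of D k \<nu> x] D Dn f that D0 by simp
  have AC1: "AC (\<lambda>x. Int0 (\<lambda>t. Kext k \<nu> x t * f t) x)" if k: "k \<le> n" "\<nu> \<le> k" for k \<nu>
  proof -
    define B where "B = (\<lambda>\<tau>. W k \<nu> \<tau> * D (n - k + \<nu>) \<tau>)"
    have B: "L1 B" unfolding B_def
      using k by (intro L1_mult_Linf W_L1 deriv_chain_Linf[OF D f[folded Dn]]) auto
    have "AC (\<lambda>x. (- 1) ^ \<nu> * (\<Sum>i\<le>\<nu>. tpow i x 0 * Int0 (\<lambda>t. tpow (\<nu> - i) 0 t * B t) x))"
      by (intro AC_mult AC_const AC_sum AC_tpow1 AC_Int0 L1_tpow2 B)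
    then show ?thesis
    proof (rule AC_cong[rotated])
      fix x :: real assume x: "x \<in> {0..1}"
      have "Int0 (\<lambda>\<tau>. tpow \<nu> x \<tau> * B \<tau>) x = (\<Sum>i\<le>\<nu>. tpow i x 0 * Int0 (\<lambda>t. tpow (\<nu> - i) 0 t * B t) x)"
        using x by (intro Int0_tpow_separate2[OF B]) simp
      then show "(- 1) ^ \<nu> * (\<Sum>i\<le>\<nu>. tpow i x 0 * Int0 (\<lambda>t. tpow (\<nu> - i) 0 t * B t) x) = Int0 (\<lambda>t. Kext k \<nu> x t * f t) x"
        using eq[OF k x] by (simp add: B_def)
    qed
  qed
  have "AC (\<lambda>x. \<Sum>k\<le>n. \<Sum>\<nu>\<le>k. Int0 (\<lambda>t. Kext k \<nu> x t * f t) x)"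
    by (intro AC_sum AC1) auto
  then show ?thesis by (rule AC_cong[rotated]) (simp add: Int0_K f)
qed

lemma Int0_K_cong_AE:
  assumes "Linf f" "Linf g" "AE x\<in>{0..1} in lebesgue. f x = g x" "x \<in> {0..1}"
  shows "Int0 (\<lambda>t. K x t * f t) x = Int0 (\<lambda>t. K x t * g t) x"
  unfolding Int0_K[OF assms(4,1)] Int0_K[OF assms(4,2)]
proof (intro sum.cong refl Int0_cong_AE)
  fix k \<nu> assume "k \<in> {..n}" "\<nu> \<in> {..k}"
  then show "L1 (\<lambda>t. Kext k \<nu> x t * f t)" using assms by (intro L1_mult_Linf L1_Kext) auto
  show "AE t\<in>{0..1} in lebesgue. Kext k \<nu> x t * f t = Kext k \<nu> x t * g t"
    using assms(3) by eventually_elim auto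
qed (use assms in auto)

text \<open>On the diagonal parts t enters as a fixed value of an integrable function, so continuity
  in x holds at every t. It extends identities from rational x to all x.\<close>

lemma continuous_on_K:
  assumes t: "0 \<le> t"
  shows "continuous_on {t..1} (\<lambda>x. K x t)"
proof -
  have "continuous_on {t..1} (\<lambda>x. Kext k \<nu> x t)" if k: "k \<le> n" "\<nu> \<le> k" for k \<nu>
  proof (cases "\<nu> = k")
    case True
    then show ?thesis unfolding Kext_def tpow_def by (auto intro!: continuous_intros)
  next
    case False
    define B where "B = (\<lambda>\<tau>. W k \<nu> \<tau> * tpow (k - 1 - \<nu>) \<tau> t)"
    have B: "L1 B" unfolding B_def using k by (intro L1_tpow1 W_L1)
    have sep: "Int0 (\<lambda>\<tau>. tpow \<nu> x \<tau> * B \<tau>) z = (\<Sum>i\<le>\<nu>. tpow i x 0 * Int0 (\<lambda>\<tau>. tpow (\<nu> - i) 0 \<tau> * B \<tau>) z)"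
      if "z \<le> 1" for x z by (rule Int0_tpow_separate2[OF B that])
    have "AC (\<lambda>x. (- 1) ^ \<nu> * ((\<Sum>i\<le>\<nu>. tpow i x 0 * Int0 (\<lambda>\<tau>. tpow (\<nu> - i) 0 \<tau> * B \<tau>) x)
        + (- 1) * (\<Sum>i\<le>\<nu>. tpow i x 0 * Int0 (\<lambda>\<tau>. tpow (\<nu> - i) 0 \<tau> * B \<tau>) t)))"
      by (intro AC_mult AC_const AC_add AC_sum AC_tpow1 AC_Int0 L1_tpow2 B)
    then have "continuous_on {t..1} (\<lambda>x. (- 1) ^ \<nu> * ((\<Sum>i\<le>\<nu>. tpow i x 0 * Int0 (\<lambda>\<tau>. tpow (\<nu> - i) 0 \<tau> * B \<tau>) x)
        + (- 1) * (\<Sum>i\<le>\<nu>. tpow i x 0 * Int0 (\<lambda>\<tau>. tpow (\<nu> - i) 0 \<tau> * B \<tau>) t)))"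
      by (rule continuous_on_subset[OF AC_continuous_on]) (use t in auto)
    then show ?thesis
    proof (rule continuous_on_eq)
      fix x assume x: "x \<in> {t..1}"
      have "Kext k \<nu> x t = (- 1) ^ \<nu> * (Int0 (\<lambda>\<tau>. tpow \<nu> x \<tau> * B \<tau>) x - Int0 (\<lambda>\<tau>. tpow \<nu> x \<tau> * B \<tau>) t)"
        using False by (simp add: Kext_def Kfun_def B_def mult.assoc)
      also have "\<dots> = (- 1) ^ \<nu> * ((\<Sum>i\<le>\<nu>. tpow i x 0 * Int0 (\<lambda>\<tau>. tpow (\<nu> - i) 0 \<tau> * B \<tau>) x)
        + (- 1) * (\<Sum>i\<le>\<nu>. tpow i x 0 * Int0 (\<lambda>\<tau>. tpow (\<nu> - i) 0 \<tau> * B \<tau>) t))"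
        using sep[of x x] sep[of t x] x by simp
      finally show "(- 1) ^ \<nu> * ((\<Sum>i\<le>\<nu>. tpow i x 0 * Int0 (\<lambda>\<tau>. tpow (\<nu> - i) 0 \<tau> * B \<tau>) x)
        + (- 1) * (\<Sum>i\<le>\<nu>. tpow i x 0 * Int0 (\<lambda>\<tau>. tpow (\<nu> - i) 0 \<tau> * B \<tau>) t)) = Kext k \<nu> x t" ..
    qed
  qed
  then have "continuous_on {t..1} (\<lambda>x. \<Sum>k\<le>n. \<Sum>\<nu>\<le>k. Kext k \<nu> x t)"
    by (intro continuous_on_sum) auto
  then show ?thesis by (rule continuous_on_eq) (use t K_eq_Kext in auto)
qed

end

text \<open>For data vanishing near 0 the difference of the two Volterra operators is a polynomial that vanishes near 0.\<close>

lemma Int0_K_independent: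
  assumes E: "expression_coeffs n q0 q p P Q" and E': "expression_coeffs n q0 q p P' Q'"
    and f: "Linf f" and s: "0 < s" "s \<le> 1" and fs: "\<And>t. t \<in> {0..s} \<Longrightarrow> f t = 0" and x: "x \<in> {0..1}"
  shows "Int0 (\<lambda>t. Kker n P Q x t * f t) x = Int0 (\<lambda>t. Kker n P' Q' x t * f t) x"
proof -
  interpret A: expression_coeffs n q0 q p P Q by (rule E)
  interpret B: expression_coeffs n q0 q p P' Q' by (rule E')
  define H where "H = (\<lambda>x. Int0 (\<lambda>t. A.K x t * f t) x + (- 1) * Int0 (\<lambda>t. B.K x t * f t) x)"
  have H: "AC H" unfolding H_def by (intro AC_add AC_mult AC_const A.AC_Int0_K B.AC_Int0_K f)
  \<comment> \<open>\<open>D 0\<close> is the n-fold primitive of f; its initial values of order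
    below n vanish, so the part C drops out of the representation.\<close>
  define D where "D = (\<lambda>j. (Int0 ^^ (n - j)) f)"
  have D: "deriv_chain n D" unfolding D_def by (rule deriv_chain_iterated_Int0[OF Linf_imp_L1[OF f]])
  have Dn: "D n = f" by (simp add: D_def)
  have D0: "D j 0 = 0" if "j < n" for j using that by (cases "n - j") (auto simp: D_def)
  have y: "Wsob n Linf (D 0)" unfolding Wsob_def
    using D Dn f by (intro exI[of _ D]) (auto simp: deriv_chain_def)
  define g where "g = (wder ^^ n) (D 0)"
  have g: "Linf g" unfolding g_def by (rule Wsob_Linf_wder[OF y])
  have gf: "AE x\<in>{0..1} in lebesgue. g x = f x"
    unfolding g_def using wder_chain(2)[OF D] Dn by simp
  have y0: "(wder ^^ j) (D 0) 0 = 0" if "j < n" for j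
    using wder_chain(1)[OF D _ that, of "D 0" 0] D0 that by simp
  have "\<exists>c. AE x\<in>{0..1} in lebesgue. H x = (\<Sum>j<Suc n. c j * tpow j x 0)"
  proof (rule annihilator_of_moments)
    show "L1 H" using H by (intro Linf_imp_L1 Linf_AC)
    fix \<psi> assume \<psi>: "Linf \<psi>" and "\<And>j. j < Suc n \<Longrightarrow> Int0 (\<lambda>x. tpow j x 0 * \<psi> x) 1 = 0"
    then obtain \<phi> where \<phi>: "W0inf (Suc n) \<phi>" "AE x\<in>{0..1} in lebesgue. (wder ^^ Suc n) \<phi> x = \<psi> x"
      using test_function_of_moments[OF \<psi>, of n] by auto
    \<comment> \<open>The left side is formed from q0, q and p alone, so two choices of primitives
      give Volterra terms that agree when tested with \<psi>.\<close>
    have rep: "ell n q0 q p (D 0) \<phi> = (- 1) ^ (n + 1) * (Int0 (\<lambda>x. 2 * \<i> * q0 x * f x * \<psi> x) 1 + Int0 (\<lambda>x. Int0 (\<lambda>t. Kker n R S x t * f t) x * \<psi> x) 1)"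
      if "expression_coeffs n q0 q p R S" for R S
    proof -
      interpret C: expression_coeffs n q0 q p R S by (rule that)
      have L: "L1 (\<lambda>x. 2 * \<i> * q0 x * f x * \<psi> x)" "L1 (\<lambda>x. Int0 (\<lambda>t. C.K x t * f t) x * \<psi> x)"
        by (intro Linf_imp_L1 Linf_mult Linf_const Linf_AC[OF C.q0_AC] Linf_AC[OF C.AC_Int0_K] f \<psi>)+
      have "AE x\<in>{0..1} in lebesgue. 2 * \<i> * q0 x * f x * \<psi> x + Int0 (\<lambda>t. C.K x t * f t) x * \<psi> x
        = (Bop q0 (Kker n R S) g x + (\<Sum>\<nu><n. (wder ^^ \<nu>) (D 0) 0 * initial_coeff n (leib_coeff R S) \<nu> x)) * (wder ^^ (n + 1)) \<phi> x"
        using gf \<phi>(2)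
      proof eventually_elim
        case (elim x)
        show ?case
        proof
          assume x: "x \<in> {0..1}"
          have "Int0 (\<lambda>t. C.K x t * g t) x = Int0 (\<lambda>t. C.K x t * f t) x"
            by (rule C.Int0_K_cong_AE[OF g f gf x])
          then show "2 * \<i> * q0 x * f x * \<psi> x + Int0 (\<lambda>t. C.K x t * f t) x * \<psi> x
            = (Bop q0 (Kker n R S) g x + (\<Sum>\<nu><n. (wder ^^ \<nu>) (D 0) 0 * initial_coeff n (leib_coeff R S) \<nu> x)) * (wder ^^ (n + 1)) \<phi> x"
            using elim x by (simp add: Bop_def C.Kker_eq_K Int0_def[symmetric] y0 distrib_right)
        qed
      qed
      then have "(LINT x:{0..1}|lebesgue. (Bop q0 (Kker n R S) g x + (\<Sum>\<nu><n. (wder ^^ \<nu>) (D 0) 0 * initial_coeff n (leib_coeff R S) \<nu> x)) * (wder ^^ (n + 1)) \<phi> x)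
        = Int0 (\<lambda>x. 2 * \<i> * q0 x * f x * \<psi> x + Int0 (\<lambda>t. C.K x t * f t) x * \<psi> x) 1"
        unfolding Int0_def by (intro L1_LINT_cong_AE[symmetric] L1_add L[unfolded Int0_def]) auto
      also have "\<dots> = Int0 (\<lambda>x. 2 * \<i> * q0 x * f x * \<psi> x) 1 + Int0 (\<lambda>x. Int0 (\<lambda>t. C.K x t * f t) x * \<psi> x) 1"
        by (rule Int0_add[OF L]) simp
      finally show ?thesis
        using C.ell_representation[OF y, of \<phi>] \<phi>(1) by (simp add: g_def C.Kker_eq_K)
    qed
    have L: "L1 (\<lambda>x. Int0 (\<lambda>t. A.K x t * f t) x * \<psi> x)" "L1 (\<lambda>x. Int0 (\<lambda>t. B.K x t * f t) x * \<psi> x)"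
      by (intro Linf_imp_L1 Linf_mult Linf_AC[OF A.AC_Int0_K] Linf_AC[OF B.AC_Int0_K] f \<psi>)+
    have eq: "Int0 (\<lambda>x. Int0 (\<lambda>t. A.K x t * f t) x * \<psi> x) 1 = Int0 (\<lambda>x. Int0 (\<lambda>t. B.K x t * f t) x * \<psi> x) 1"
      using rep[OF E] rep[OF E'] by (simp add: A.Kker_eq_K B.Kker_eq_K)
    have "Int0 (\<lambda>x. H x * \<psi> x) 1 = Int0 (\<lambda>x. Int0 (\<lambda>t. A.K x t * f t) x * \<psi> x + (- 1) * (Int0 (\<lambda>t. B.K x t * f t) x * \<psi> x)) 1"
      by (rule Int0_cong) (simp add: H_def algebra_simps)
    also have "\<dots> = Int0 (\<lambda>x. Int0 (\<lambda>t. A.K x t * f t) x * \<psi> x) 1 + Int0 (\<lambda>x. (- 1) * (Int0 (\<lambda>t. B.K x t * f t) x * \<psi> x)) 1"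
      by (intro Int0_add L1_cmult L) simp
    finally show "Int0 (\<lambda>x. H x * \<psi> x) 1 = 0" unfolding Int0_cmult eq by simp
  qed
  then obtain c where c: "AE x\<in>{0..1} in lebesgue. H x = (\<Sum>j\<le>n. c j * tpow j x 0)"
    unfolding lessThan_Suc_atMost by blast
  have Hp: "H x = (\<Sum>j\<le>n. c j * tpow j x 0)" if "x \<in> {0..1}" for x
    by (rule continuous_AE_imp_eq[OF _ _ c that]) (intro AC_continuous_on H AC_sum AC_mult AC_const AC_tpow1)+
  have H0: "H x = 0" if "x \<in> {0..s}" for x
  proof -
    have "Int0 (\<lambda>t. M x t * f t) x = Int0 (\<lambda>t. 0 * 0) x" for M :: "real \<Rightarrow> real \<Rightarrow> complex"
      by (rule Int0_cong) (use fs that in auto)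
    then show ?thesis unfolding H_def by simp
  qed
  have "c j = 0" if "j \<le> n" for j
    by (rule tpow_sum_eq_0[of "{0..s}" c n, OF _ _ that]) (use s H0 Hp in \<open>auto simp: infinite_Icc\<close>)
  then have "H x = 0" using Hp[OF x] by simp
  then show ?thesis by (simp add: H_def A.Kker_eq_K B.Kker_eq_K)
qed

text \<open>Equality of the integrals for all bounded f vanishing near 0 gives equality of the
  kernels, but with an exceptional set of t depending on x. Countably many rational x have a common
  exceptional set, and continuity in x covers the rest.\<close>

lemma Kker_independent:
  assumes E: "expression_coeffs n q0 q p P Q" and E': "expression_coeffs n q0 q p P' Q'"
  shows "AE t\<in>{0..1} in lebesgue. (\<forall>x\<in>{t..1}. Kker n P Q x t = Kker n P' Q' x t)"
proof -
  interpret A: expression_coeffs n q0 q p P Q by (rule E)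
  interpret B: expression_coeffs n q0 q p P' Q' by (rule E')
  have fixed: "AE t\<in>{0..x} in lebesgue. A.K x t = B.K x t" if x: "x \<in> {0..1}" for x
  proof -
    define G where "G = (\<lambda>t. (\<Sum>k\<le>n. \<Sum>\<nu>\<le>k. A.Kext k \<nu> x t) + (- 1) * (\<Sum>k\<le>n. \<Sum>\<nu>\<le>k. B.Kext k \<nu> x t))"
    have G: "L1 G" unfolding G_def using x by (intro L1_add L1_cmult L1_sum A.L1_Kext B.L1_Kext) auto
    have GK: "G t = A.K x t - B.K x t" if "t \<in> {0..x}" for t
      using that x by (simp add: G_def A.K_eq_Kext B.K_eq_Kext)
    have tail: "AE t\<in>{0..x} in lebesgue. s < t \<longrightarrow> G t = 0" if s: "0 < s" "s \<le> 1" for s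
    proof -
      \<comment> \<open>The truncation at s makes the test function f vanish near 0; afterwards s
        runs through 1/(m+1).\<close>
      define g where "g = (\<lambda>t. indicator {s<..} t *\<^sub>R G t)"
      define f where "f = (\<lambda>t. cnj (sgn (g t)))"
      have gL: "L1 g" unfolding g_def
      proof (rule L1_I_bounded[OF _ L1_norm[OF G]])
        define h where "h = (\<lambda>t. indicator {0..1} t *\<^sub>R G t)"
        have h: "h \<in> borel_measurable lebesgue"
          using L1_measurable[OF G] by (simp add: set_borel_measurable_def h_def)
        have "(\<lambda>t. indicator {s<..} t *\<^sub>R h t) \<in> borel_measurable lebesgue"
          by (intro borel_measurable_scaleR borel_measurable_indicator h) simp
        moreover have "(\<lambda>t. indicator {s<..} t *\<^sub>R h t) = (\<lambda>t. indicator {0..1} t *\<^sub>R (indicator {s<..} t *\<^sub>R G t))"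
          by (auto simp: indicator_def h_def)
        ultimately show "set_borel_measurable lebesgue {0..1} (\<lambda>t. indicator {s<..} t *\<^sub>R G t)"
          by (simp add: set_borel_measurable_def)
      qed (auto simp: indicator_def)
      have f: "Linf f" unfolding f_def by (rule Linf_cnj_sgn[OF gL])
      have "Int0 (\<lambda>t. Kker n P Q x t * f t) x = Int0 (\<lambda>t. Kker n P' Q' x t * f t) x"
        by (rule Int0_K_independent[OF E E' f s _ x]) (auto simp: f_def g_def)
      then have "Int0 (\<lambda>t. (\<Sum>k\<le>n. \<Sum>\<nu>\<le>k. A.Kext k \<nu> x t) * f t) x = Int0 (\<lambda>t. (\<Sum>k\<le>n. \<Sum>\<nu>\<le>k. B.Kext k \<nu> x t) * f t) x"
        using Int0_cong[of x "\<lambda>t. A.K x t * f t" "\<lambda>t. (\<Sum>k\<le>n. \<Sum>\<nu>\<le>k. A.Kext k \<nu> x t) * f t"]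
          Int0_cong[of x "\<lambda>t. B.K x t * f t" "\<lambda>t. (\<Sum>k\<le>n. \<Sum>\<nu>\<le>k. B.Kext k \<nu> x t) * f t"] x
        by (simp add: A.Kker_eq_K B.Kker_eq_K A.K_eq_Kext B.K_eq_Kext)
      moreover have "Int0 (\<lambda>t. G t * f t) x = Int0 (\<lambda>t. (\<Sum>k\<le>n. \<Sum>\<nu>\<le>k. A.Kext k \<nu> x t) * f t + (- 1) * ((\<Sum>k\<le>n. \<Sum>\<nu>\<le>k. B.Kext k \<nu> x t) * f t)) x"
        by (rule Int0_cong) (simp add: G_def algebra_simps)
      moreover have "\<dots> = Int0 (\<lambda>t. (\<Sum>k\<le>n. \<Sum>\<nu>\<le>k. A.Kext k \<nu> x t) * f t) x + Int0 (\<lambda>t. (- 1) * ((\<Sum>k\<le>n. \<Sum>\<nu>\<le>k. B.Kext k \<nu> x t) * f t)) x"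
        using x by (intro Int0_add L1_cmult L1_mult_Linf f L1_sum A.L1_Kext B.L1_Kext) auto
      ultimately have "Int0 (\<lambda>t. G t * f t) x = 0" by (simp only: Int0_cmult) simp
      moreover have "G t * f t = complex_of_real (norm (g t))" for t
        using mult_cnj_sgn[of "G t"] by (cases "s < t") (auto simp: f_def g_def)
      ultimately have "AE t\<in>{0..x} in lebesgue. g t = 0"
        by (intro Int0_norm_eq_0[OF gL x]) simp
      then show ?thesis by eventually_elim (auto simp: g_def)
    qed
    have "AE t in lebesgue. \<forall>m::nat. t \<in> {0..x} \<longrightarrow> inverse (real (Suc m)) < t \<longrightarrow> G t = 0"
      unfolding AE_all_countable by (intro allI tail) (auto simp: inverse_le_1_iff)
    moreover have "AE t in lebesgue. t \<notin> {0::real}"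
      by (rule AE_not_in) (simp flip: negligible_iff_null_sets)
    ultimately show ?thesis
    proof eventually_elim
      case (elim t)
      show ?case
      proof
        assume t: "t \<in> {0..x}"
        then have "t > 0" using elim(2) by auto
        then obtain m where "inverse (real (Suc m)) < t" using reals_Archimedean by blast
        then show "A.K x t = B.K x t" using elim(1) t GK[OF t] by auto
      qed
    qed
  qed
  have "AE t in lebesgue. \<forall>x\<in>\<rat> \<inter> {0..1}. t \<in> {0..x} \<longrightarrow> A.K x t = B.K x t"
    using fixed by (subst AE_ball_countable) (auto intro: countable_Int1 countable_rat)
  \<comment> \<open>For t < 1 the rationals of (t,1) are dense in [t,1]; at t = 1 there would be
    none.\<close>
  moreover have "AE t in lebesgue. t \<notin> {1::real}"
    by (rule AE_not_in) (simp flip: negligible_iff_null_sets)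
  ultimately show ?thesis
  proof eventually_elim
    case (elim t)
    show ?case
    proof (intro impI ballI)
      fix x assume t: "t \<in> {0..1}" and x: "x \<in> {t..1}"
      have t1: "t < 1" using t elim(2) by auto
      define S where "S = {t<..<1} \<inter> \<rat>"
      have cl: "closure S = {t..1}"
        unfolding S_def using closure_open_Int_superset[of "{t<..<1}" "\<rat>"] t1 by (simp add: Rats_closure_real)
      have "A.K x t - B.K x t = 0"
      proof (rule continuous_constant_on_closure[of S "\<lambda>x. A.K x t - B.K x t" 0 x])
        show "continuous_on (closure S) (\<lambda>x. A.K x t - B.K x t)"
          unfolding cl using t by (intro continuous_intros A.continuous_on_K B.continuous_on_K) auto
        show "A.K z t - B.K z t = 0" if "z \<in> S" for z
          using elim(1) t that by (auto simp: S_def)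
        show "x \<in> closure S" using x cl by simp
      qed
      then show "Kker n P Q x t = Kker n P' Q' x t" by (simp add: A.Kker_eq_K B.Kker_eq_K)
    qed
  qed
qed

section \<open>Volterra operators of the second kind\<close>

lemma is_deriv_power:
  assumes "is_deriv f f'" shows "is_deriv (\<lambda>x. f x ^ Suc m) (\<lambda>x. of_nat (Suc m) * (f x ^ m * f' x))"
proof (induction m)
  case 0 then show ?case using assms by simp
next
  case (Suc m)
  have "is_deriv (\<lambda>x. f x * f x ^ Suc m) (\<lambda>x. f x * (of_nat (Suc m) * (f x ^ m * f' x)) + f' x * f x ^ Suc m)"
    by (rule is_deriv_mult[OF assms Suc])
  then show ?case by (rule is_deriv_cong) (simp_all add: algebra_simps)
qed

lemma L1_complex_of_real: "L1 b \<Longrightarrow> L1 (\<lambda>t. complex_of_real (b t))"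
  unfolding L1_def set_integrable_def scaleR_conv_of_real of_real_mult[symmetric] complex_of_real_integrable_eq
  by simp

text \<open>The integrand is the derivative of \<beta>^(m+1)/(m+1)!. The detour through complex
  functions serves to apply the fundamental theorem in the form proved above.\<close>

lemma LINT_power_primitive:
  fixes b :: "real \<Rightarrow> real"
  assumes b: "L1 b" and x: "x \<in> {0..1}"
  defines "\<beta> \<equiv> \<lambda>x. LINT t:{0..x}|lebesgue. b t"
  shows "L1 (\<lambda>t. b t * (\<beta> t ^ m / fact m))"
    and "(LINT t:{0..x}|lebesgue. b t * (\<beta> t ^ m / fact m)) = \<beta> x ^ Suc m / fact (Suc m)"
proof -
  define A where "A = (\<lambda>t. complex_of_real (b t))"
  have A: "L1 A" unfolding A_def by (rule L1_complex_of_real[OF b])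
  have IA: "Int0 A x = complex_of_real (\<beta> x)" for x
    unfolding Int0_def A_def \<beta>_def by (rule set_integral_complex_of_real)
  have "is_deriv (\<lambda>x. (1 / fact (Suc m)) * Int0 A x ^ Suc m) (\<lambda>x. (1 / fact (Suc m)) * (of_nat (Suc m) * (Int0 A x ^ m * A x)))"
    by (intro is_deriv_cmult is_deriv_power is_deriv_Int0 A)
  then have d: "is_deriv (\<lambda>x. (1 / fact (Suc m)) * Int0 A x ^ Suc m) (\<lambda>t. complex_of_real (b t * (\<beta> t ^ m / fact m)))"
  proof (rule is_deriv_cong)
    have "(1 / fact (Suc m)) * (of_nat (Suc m) * (Int0 A t ^ m * A t)) = complex_of_real (b t * (\<beta> t ^ m / fact m))" for t
      unfolding IA by (simp add: A_def divide_simps del: of_nat_Suc)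
    then show "AE t\<in>{0..1} in lebesgue. (1 / fact (Suc m)) * (of_nat (Suc m) * (Int0 A t ^ m * A t)) = complex_of_real (b t * (\<beta> t ^ m / fact m))"
      by simp
  qed auto
  have a: "AC (\<lambda>x. (1 / fact (Suc m)) * Int0 A x ^ Suc m)" by (intro AC_mult AC_const AC_power AC_Int0 A)
  have "L1 (\<lambda>t. complex_of_real (b t * (\<beta> t ^ m / fact m)))" by (rule L1_derivative_of_AC[OF a d])
  then show "L1 (\<lambda>t. b t * (\<beta> t ^ m / fact m))"
    unfolding L1_def set_integrable_def scaleR_conv_of_real of_real_mult[symmetric] complex_of_real_integrable_eq by simp
  have "complex_of_real (LINT t:{0..x}|lebesgue. b t * (\<beta> t ^ m / fact m)) = Int0 (\<lambda>t. complex_of_real (b t * (\<beta> t ^ m / fact m))) x"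
    unfolding Int0_def by (rule set_integral_complex_of_real[symmetric])
  also have "\<dots> = complex_of_real (\<beta> x ^ Suc m / fact (Suc m))"
    unfolding AC_FTC[OF a d x] Int0_at_0 IA by simp
  finally show "(LINT t:{0..x}|lebesgue. b t * (\<beta> t ^ m / fact m)) = \<beta> x ^ Suc m / fact (Suc m)"
    unfolding of_real_eq_iff .
qed

text \<open>The Volterra structure is reduced to an estimate: V f x is controlled by f on [0,x]
  through the weight b. Integrability of \<open>b t * w t\<close> belongs to the hypotheses of the
  bound because a non-integrable integrand would give its right side the default value 0.\<close>

locale volterra =
  fixes V :: "(real \<Rightarrow> complex) \<Rightarrow> real \<Rightarrow> complex" and b :: "real \<Rightarrow> real"
  assumes V_Linf: "Linf f \<Longrightarrow> Linf (V f)"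
    and V_lin: "Linf f \<Longrightarrow> Linf g \<Longrightarrow> x \<in> {0..1} \<Longrightarrow> V (\<lambda>t. f t + c * g t) x = V f x + c * V g x"
    and b_L1: "L1 b" and b_nonneg: "0 \<le> b t"
    and V_bound: "Linf f \<Longrightarrow> L1 (\<lambda>t. b t * w t) \<Longrightarrow> AE t\<in>{0..1} in lebesgue. norm (f t) \<le> w t \<Longrightarrow>
        x \<in> {0..1} \<Longrightarrow> norm (V f x) \<le> (LINT t:{0..x}|lebesgue. b t * w t)"
begin

definition \<beta> where "\<beta> x = (LINT t:{0..x}|lebesgue. b t)"

lemma \<beta>_nonneg: "0 \<le> \<beta> x"
  unfolding \<beta>_def set_lebesgue_integral_def by (rule integral_nonneg_AE) (simp add: b_nonneg)

lemma \<beta>_le: assumes "x \<in> {0..1}" shows "\<beta> x \<le> \<beta> 1"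
  unfolding \<beta>_def set_lebesgue_integral_def
  using L1_subinterval[OF b_L1, of 0] assms
  by (intro integral_mono) (auto simp: set_integrable_def indicator_def b_nonneg)

text \<open>Each application of V integrates the bound once against b, which raises the power of
  \<beta> by one and supplies the next factor of the factorial.\<close>

lemma V_power_bound:
  assumes f: "Linf f" and le: "AE t\<in>{0..1} in lebesgue. norm (f t) \<le> M * (\<beta> t ^ m / fact m)" and x: "x \<in> {0..1}"
  shows "norm (V f x) \<le> M * (\<beta> x ^ Suc m / fact (Suc m))"
proof -
  note p = LINT_power_primitive[OF b_L1 x, folded \<beta>_def, of m]
  have "L1 (\<lambda>t. M * (b t * (\<beta> t ^ m / fact m)))" using p(1) by (rule L1_cmult)
  then have "norm (V f x) \<le> (LINT t:{0..x}|lebesgue. b t * (M * (\<beta> t ^ m / fact m)))"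
    by (intro V_bound[OF f _ le x]) (simp add: mult_ac)
  also have "\<dots> = (LINT t:{0..x}|lebesgue. M * (b t * (\<beta> t ^ m / fact m)))" by (simp add: mult_ac)
  also have "\<dots> = M * (\<beta> x ^ Suc m / fact (Suc m))" unfolding set_integral_mult_right p(2) ..
  finally show ?thesis .
qed

lemma V_const_bound:
  assumes "Linf f" "AE t\<in>{0..1} in lebesgue. norm (f t) \<le> M" "x \<in> {0..1}"
  shows "norm (V f x) \<le> M * \<beta> x"
  using V_power_bound[of f M 0 x] assms by simp

lemma power_fact_tendsto_0: "(\<lambda>m. c * (z ^ m / fact m)) \<longlonglongrightarrow> (0::real)"
  using tendsto_mult[OF tendsto_const[of c] summable_LIMSEQ_zero[OF summable_exp[of z]]]
  by (simp add: divide_inverse mult.commute)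

text \<open>A solution satisfies d = - V d, so its bound improves from m to m + 1 indefinitely and
  tends to 0. The countably many exceptional null sets are merged before the limit is taken.\<close>

lemma V_injective:
  assumes d: "Linf d" and z: "AE x\<in>{0..1} in lebesgue. d x + V d x = 0"
  shows "AE x\<in>{0..1} in lebesgue. d x = 0"
proof -
  obtain M where M: "AE x\<in>{0..1} in lebesgue. norm (d x) \<le> M" using d by (auto simp: Linf_iff)
  have "AE x\<in>{0..1} in lebesgue. norm (d x) \<le> M * (\<beta> x ^ m / fact m)" for m
  proof (induction m)
    case 0 then show ?case using M by simp
  next
    case (Suc m)
    show ?case using z
    proof eventually_elim
      case (elim x)
      show ?case
      proof
        assume x: "x \<in> {0..1}"
        then have "d x = - V d x" using elim by (simp add: eq_neg_iff_add_eq_0)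
        then show "norm (d x) \<le> M * (\<beta> x ^ Suc m / fact (Suc m))" using V_power_bound[OF d Suc x] by simp
      qed
    qed
  qed
  then have "AE x in lebesgue. \<forall>m. x \<in> {0..1} \<longrightarrow> norm (d x) \<le> M * (\<beta> x ^ m / fact m)"
    unfolding AE_all_countable by blast
  then show ?thesis
  proof eventually_elim
    case (elim x)
    show ?case
    proof
      assume "x \<in> {0..1}"
      then have "norm (d x) \<le> 0" using elim by (intro LIMSEQ_le_const[OF power_fact_tendsto_0[of M "\<beta> x"]]) auto
      then show "d x = 0" by simp
    qed
  qed
qed

lemma V_surjective:
  assumes g: "Linf g"
  shows "\<exists>f. Linf f \<and> (AE x\<in>{0..1} in lebesgue. f x + V f x = g x)"
proof -
  obtain M where M: "AE x\<in>{0..1} in lebesgue. norm (g x) \<le> M" using g by (auto simp: Linf_iff)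
  \<comment> \<open>Changing g on a null set bounds it everywhere, so the Neumann series converges
    at every point of [0,1]. The maximum lets the default value 0 of h respect the bound.\<close>
  define M' where "M' = max M 0"
  define h where "h = (\<lambda>x. if norm (g x) \<le> M' then g x else 0)"
  have hg: "AE x\<in>{0..1} in lebesgue. g x = h x"
    using M by eventually_elim (auto simp: h_def M'_def)
  have h: "Linf h" by (rule Linf_cong_AE[OF g hg])
  have hM: "norm (h x) \<le> M'" for x by (auto simp: h_def M'_def)
  define e where "e = rec_nat h (\<lambda>_ f x. - V f x)"
  have e0: "e 0 = h" and eS: "e (Suc m) x = - V (e m) x" for m x by (simp_all add: e_def)
  have eL: "Linf (e m)" for m
  proof (induction m)
    case 0 then show ?case by (simp add: e0 h)
  next
    case (Suc m)
    have "Linf (\<lambda>x. (- 1) * V (e m) x)" by (intro Linf_mult Linf_const V_Linf Suc)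
    then show ?case by (simp add: e_def)
  qed
  have eb: "norm (e m x) \<le> M' * (\<beta> x ^ m / fact m)" if "x \<in> {0..1}" for m x
    using that
  proof (induction m arbitrary: x)
    case 0 then show ?case using hM by (simp add: e0)
  next
    case (Suc m)
    show ?case unfolding eS norm_minus_cancel
      by (rule V_power_bound[OF eL]) (use Suc in auto)
  qed
  \<comment> \<open>Replacing \<beta> x by \<beta> 1 gives a majorant independent of x, a multiple
    of the exponential series.\<close>
  define \<sigma> where "\<sigma> = (\<lambda>m. M' * (\<beta> 1 ^ m / fact m))"
  have s\<sigma>: "summable \<sigma>"
    using summable_mult[OF summable_exp[of "\<beta> 1"], of M'] by (simp add: \<sigma>_def divide_inverse mult.commute)
  have e\<sigma>: "norm (e m x) \<le> \<sigma> m" if "x \<in> {0..1}" for m x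
    using eb[OF that, of m] power_mono[OF \<beta>_le[OF that] \<beta>_nonneg, of m]
      mult_left_mono[OF divide_right_mono[of "\<beta> x ^ m" "\<beta> 1 ^ m" "fact m"], of M'] unfolding \<sigma>_def M'_def by (smt (verit) fact_ge_zero)
  have se: "summable (\<lambda>m. e m x)" if "x \<in> {0..1}" for x
    by (rule summable_comparison_test'[OF s\<sigma>]) (use e\<sigma>[OF that] in auto)
  define f where "f = (\<lambda>x. \<Sum>m. e m x)"
  define R where "R = (\<lambda>N. (\<Sum>m. \<sigma> (m + N)))"
  have R0: "R \<longlonglongrightarrow> 0" unfolding R_def by (rule suminf_exist_split2[OF s\<sigma>])
  have rem: "norm (f x - (\<Sum>m<N. e m x)) \<le> R N" if x: "x \<in> {0..1}" for x N
  proof -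
    have "f x - (\<Sum>m<N. e m x) = (\<Sum>m. e (m + N) x)"
      unfolding f_def using suminf_minus_initial_segment[OF se[OF x], of N] by simp
    also have "norm \<dots> \<le> R N" unfolding R_def
      using s\<sigma> e\<sigma>[OF x] by (intro norm_suminf_le summable_ignore_initial_segment)
    finally show ?thesis .
  qed
  have f: "Linf f"
    unfolding Linf_def
  proof
    have "(\<lambda>x. \<Sum>m. indicator {0..1} x *\<^sub>R e m x) \<in> borel_measurable lebesgue"
      using eL by (intro borel_measurable_suminf) (auto simp: Linf_def set_borel_measurable_def)
    moreover have "(\<Sum>m. indicator {0..1} x *\<^sub>R e m x) = indicator {0..1} x *\<^sub>R f x" for x :: real
      by (simp add: f_def indicator_def)
    ultimately show "set_borel_measurable lebesgue {0..1} f" by (simp add: set_borel_measurable_def)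
    show "\<exists>M. AE x\<in>{0..1} in lebesgue. norm (f x) \<le> M"
      using rem[of _ 0] by (intro exI[of _ "R 0"]) auto
  qed
  \<comment> \<open>Only finite linearity of V is available. It maps partial sums to shifted partial
    sums up to sign, and V of the remainder is controlled by the supremum \<open>R N\<close>; V is
    never interchanged with the series.\<close>
  have VS: "Linf (\<lambda>t. \<Sum>m<N. e m t) \<and> (\<forall>x\<in>{0..1}. V (\<lambda>t. f t + (- 1) * (\<Sum>m<N. e m t)) x = V f x + (\<Sum>m<N. e (Suc m) x))" for N
  proof (induction N)
    case 0
    then show ?case using V_lin[OF f Linf_const[of 0], of _ 0] Linf_const[of 0] by simp
  next
    case (Suc N)
    then have S: "Linf (\<lambda>t. \<Sum>m<N. e m t)" by blast
    have "Linf (\<lambda>t. f t + (- 1) * (\<Sum>m<N. e m t))" by (intro Linf_add f Linf_mult Linf_const S)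
    then have "V (\<lambda>t. (f t + (- 1) * (\<Sum>m<N. e m t)) + (- 1) * e N t) x = V f x + (\<Sum>m<Suc N. e (Suc m) x)" if "x \<in> {0..1}" for x
      using V_lin[OF _ eL[of N] that, of "\<lambda>t. f t + (- 1) * (\<Sum>m<N. e m t)" "- 1"] Suc that by (simp add: eS)
    then show ?case using Linf_add[OF S eL[of N]] by (simp add: algebra_simps)
  qed
  have "f x + V f x = h x" if x: "x \<in> {0..1}" for x
  proof -
    have "norm (f x + V f x - h x) \<le> R (Suc N) + R N * \<beta> x" for N
    proof -
      have "Linf (\<lambda>t. f t + (- 1) * (\<Sum>m<N. e m t))" by (intro Linf_add f Linf_mult Linf_const) (use VS in blast)
      then have 1: "norm (V (\<lambda>t. f t + (- 1) * (\<Sum>m<N. e m t)) x) \<le> R N * \<beta> x"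
        using rem by (intro V_const_bound x) auto
      have "(\<Sum>m<Suc N. e m x) = h x + (\<Sum>m<N. e (Suc m) x)"
        by (subst sum.lessThan_Suc_shift) (simp add: e0)
      then have eq: "f x + V f x - h x = (f x - (\<Sum>m<Suc N. e m x)) + V (\<lambda>t. f t + (- 1) * (\<Sum>m<N. e m t)) x"
        using VS x by simp
      show ?thesis unfolding eq by (rule norm_triangle_mono[OF rem[OF x] 1])
    qed
    moreover have "(\<lambda>N. R (Suc N) + R N * \<beta> x) \<longlonglongrightarrow> 0 + 0 * \<beta> x"
      by (intro tendsto_intros R0 LIMSEQ_Suc)
    ultimately have "norm (f x + V f x - h x) \<le> 0" by (intro LIMSEQ_le_const[of _ 0]) auto
    then show ?thesis by simp
  qed
  then have "AE x\<in>{0..1} in lebesgue. f x + V f x = g x"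
    using hg by (auto elim: eventually_mono)
  then show ?thesis using f by blast
qed

end

section \<open>The integral operator with kernel \<open>K\<close> as a Volterra operator\<close>

context kernel_coeffs
begin

lemma Kbound_nonneg: "0 \<le> Kbound n W t"
  unfolding Kbound_def set_lebesgue_integral_def by (intro add_nonneg_nonneg sum_nonneg integral_nonneg_AE) auto

lemma set_integrable_K:
  assumes "Linf f" "x \<in> {0..1}" shows "set_integrable lebesgue {0..x} (\<lambda>t. K x t * f t)"
proof -
  have "L1 (\<lambda>t. (\<Sum>k\<le>n. \<Sum>\<nu>\<le>k. Kext k \<nu> x t) * f t)"
    using assms by (intro L1_mult_Linf L1_sum L1_Kext) auto
  then have "set_integrable lebesgue {0..x} (\<lambda>t. (\<Sum>k\<le>n. \<Sum>\<nu>\<le>k. Kext k \<nu> x t) * f t)"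
    using assms by (intro L1_subinterval) auto
  then show ?thesis
    by (rule set_integrable_cong[THEN iffD1, rotated -1]) (use assms K_eq_Kext in auto)
qed

lemma norm_Int0_K_le:
  assumes f: "Linf f" and w: "L1 (\<lambda>t. Kbound n W t * w t)"
    and le: "AE t\<in>{0..1} in lebesgue. norm (f t) \<le> w t" and x: "x \<in> {0..1}"
  shows "norm (Int0 (\<lambda>t. K x t * f t) x) \<le> (LINT t:{0..x}|lebesgue. Kbound n W t * w t)"
proof -
  note i = set_integrable_K[OF f x]
  have "norm (Int0 (\<lambda>t. K x t * f t) x) \<le> (LINT t:{0..x}|lebesgue. norm (K x t * f t))"
    unfolding Int0_def by (rule set_integral_norm_bound[OF i])
  also have "\<dots> \<le> (LINT t:{0..x}|lebesgue. Kbound n W t * w t)"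
    unfolding set_lebesgue_integral_def
  proof (rule integral_mono_AE)
    show "integrable lebesgue (\<lambda>t. indicator {0..x} t *\<^sub>R norm (K x t * f t))"
      using set_integrable_norm[OF i] by (simp add: set_integrable_def)
    show "integrable lebesgue (\<lambda>t. indicator {0..x} t *\<^sub>R (Kbound n W t * w t))"
      using L1_subinterval[OF w, of 0 x] x by (simp add: set_integrable_def)
    show "AE t in lebesgue. indicator {0..x} t *\<^sub>R norm (K x t * f t) \<le> indicator {0..x} t *\<^sub>R (Kbound n W t * w t)"
      using le
    proof eventually_elim
      case (elim t)
      show ?case
      proof (cases "t \<in> {0..x}")
        case True
        then have "norm (K x t) * norm (f t) \<le> Kbound n W t * w t"
          using elim x norm_K_le[of t x] Kbound_nonneg by (intro mult_mono) auto
        then show ?thesis using True by (simp add: norm_mult)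
      qed simp
    qed
  qed
  finally show ?thesis .
qed

lemma Int0_K_lin:
  assumes "Linf f" "Linf g" "x \<in> {0..1}"
  shows "Int0 (\<lambda>t. K x t * (f t + c * g t)) x = Int0 (\<lambda>t. K x t * f t) x + c * Int0 (\<lambda>t. K x t * g t) x"
proof -
  have "Int0 (\<lambda>t. K x t * f t + c * (K x t * g t)) x = Int0 (\<lambda>t. K x t * f t) x + Int0 (\<lambda>t. c * (K x t * g t)) x"
    unfolding Int0_def by (intro set_integral_add set_integrable_mult_right set_integrable_K assms)
  then show ?thesis by (simp add: Int0_cmult algebra_simps)
qed

lemma volterra_K:
  assumes r: "Linf r" and R: "R \<ge> 0" "\<And>x. x \<in> {0..1} \<Longrightarrow> norm (r x) \<le> R"
  shows "volterra (\<lambda>f x. r x * Int0 (\<lambda>t. K x t * f t) x) (\<lambda>t. R * Kbound n W t)"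
proof
  show "Linf (\<lambda>x. r x * Int0 (\<lambda>t. K x t * f t) x)" if "Linf f" for f
    by (intro Linf_mult r Linf_AC AC_Int0_K that)
  show "r x * Int0 (\<lambda>t. K x t * (f t + c * g t)) x = r x * Int0 (\<lambda>t. K x t * f t) x + c * (r x * Int0 (\<lambda>t. K x t * g t) x)"
    if "Linf f" "Linf g" "x \<in> {0..1}" for f g x c
    unfolding Int0_K_lin[OF that] by (simp add: algebra_simps)
  show "L1 (\<lambda>t. R * Kbound n W t)" by (intro L1_cmult L1_Kbound)
  show "0 \<le> R * Kbound n W t" for t using R Kbound_nonneg by simp
  show "norm (r x * Int0 (\<lambda>t. K x t * f t) x) \<le> (LINT t:{0..x}|lebesgue. R * Kbound n W t * w t)"
    if f: "Linf f" and w: "L1 (\<lambda>t. R * Kbound n W t * w t)"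
      and le: "AE t\<in>{0..1} in lebesgue. norm (f t) \<le> w t" and x: "x \<in> {0..1}" for f w x
  \<comment> \<open>Integrability of \<open>Kbound n W t * w t\<close> is obtained from the
    hypothesis by dividing by R.\<close>
  proof (cases "R = 0")
    case True
    then show ?thesis using R(2)[OF x] by (simp add: set_lebesgue_integral_def)
  next
    case False
    then have "L1 (\<lambda>t. Kbound n W t * w t)"
      using L1_cmult[OF w, of "1 / R"] by (simp add: mult.assoc)
    from norm_Int0_K_le[OF f this le x]
    have "norm (r x) * norm (Int0 (\<lambda>t. K x t * f t) x) \<le> R * (LINT t:{0..x}|lebesgue. Kbound n W t * w t)"
      using R x by (intro mult_mono) auto
    then show ?thesis by (simp add: norm_mult mult.assoc)
  qed
qed

end

section \<open>Bijectivity of B\<close>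

lemma AC_inverse_2i:
  assumes "AC (\<lambda>x. 1 / q0 x)" shows "AC (\<lambda>x. 1 / (2 * \<i> * q0 x))"
  using AC_mult[OF AC_const[of "1 / (2 * \<i>)"] assms] by (simp only: times_divide_times_eq mult_1)

context expression_coeffs
begin

lemma Bop_eq: "Bop q0 (Kker n P Q) f x = 2 * \<i> * q0 x * f x + Int0 (\<lambda>t. K x t * f t) x"
  by (simp add: Bop_def Kker_eq_K Int0_def)

lemma Linf_Bop: "Linf f \<Longrightarrow> Linf (Bop q0 (Kker n P Q) f)"
proof -
  assume f: "Linf f"
  have "Linf (\<lambda>x. 2 * \<i> * q0 x)" by (intro Linf_mult Linf_const Linf_AC[OF q0_AC])
  from Linf_add[OF Linf_mult[OF this f] Linf_AC[OF AC_Int0_K[OF f]]] show ?thesis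
    unfolding Bop_eq[abs_def] .
qed

context
  assumes nz: "\<forall>x\<in>{0..1}. q0 x \<noteq> 0" and inv_AC: "AC (\<lambda>x. 1 / q0 x)"
begin

text \<open>B is identity plus Volterra operator followed by multiplication by 2 i q0, whose inverse
  is bounded. Bijectivity thus reduces to the abstract Volterra results.\<close>

lemma Bop_factor:
  assumes "x \<in> {0..1}"
  shows "Bop q0 (Kker n P Q) f x = 2 * \<i> * q0 x * (f x + 1 / (2 * \<i> * q0 x) * Int0 (\<lambda>t. K x t * f t) x)"
  using nz assms by (simp add: Bop_eq distrib_left)

lemma ex_volterra:
  "\<exists>b. volterra (\<lambda>f x. 1 / (2 * \<i> * q0 x) * Int0 (\<lambda>t. K x t * f t) x) b"
proof -
  note r = AC_inverse_2i[OF inv_AC]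
  obtain R where R: "R > 0" "\<And>x. x \<in> {0..1} \<Longrightarrow> norm (1 / (2 * \<i> * q0 x)) \<le> R" using AC_bounded[OF r] by blast
  then show ?thesis using volterra_K[OF Linf_AC[OF r], of R] by auto
qed

lemma Bop_injective:
  assumes f: "Linf f" and g: "Linf g"
    and eq: "AE x\<in>{0..1} in lebesgue. Bop q0 (Kker n P Q) f x = Bop q0 (Kker n P Q) g x"
  shows "AE x\<in>{0..1} in lebesgue. f x = g x"
proof -
  obtain b where "volterra (\<lambda>f x. 1 / (2 * \<i> * q0 x) * Int0 (\<lambda>t. K x t * f t) x) b" using ex_volterra by blast
  then interpret V: volterra "\<lambda>f x. 1 / (2 * \<i> * q0 x) * Int0 (\<lambda>t. K x t * f t) x" b .
  define d where "d = (\<lambda>x. f x + (- 1) * g x)"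
  have d: "Linf d" unfolding d_def by (intro Linf_add f Linf_mult Linf_const g)
  have "AE x\<in>{0..1} in lebesgue. d x + 1 / (2 * \<i> * q0 x) * Int0 (\<lambda>t. K x t * d t) x = 0"
    using eq
  proof eventually_elim
    case (elim x)
    show ?case
    proof
      assume x: "x \<in> {0..1}"
      have "f x + 1 / (2 * \<i> * q0 x) * Int0 (\<lambda>t. K x t * f t) x = g x + 1 / (2 * \<i> * q0 x) * Int0 (\<lambda>t. K x t * g t) x"
        using elim x nz unfolding Bop_factor[OF x] by simp
      then show "d x + 1 / (2 * \<i> * q0 x) * Int0 (\<lambda>t. K x t * d t) x = 0"
        unfolding d_def Int0_K_lin[OF f g x] by (simp add: algebra_simps)
    qed
  qed
  from V.V_injective[OF d this] show ?thesis by eventually_elim (auto simp: d_def)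
qed

lemma Bop_surjective:
  assumes g: "Linf g"
  shows "\<exists>f. Linf f \<and> (AE x\<in>{0..1} in lebesgue. Bop q0 (Kker n P Q) f x = g x)"
proof -
  obtain b where "volterra (\<lambda>f x. 1 / (2 * \<i> * q0 x) * Int0 (\<lambda>t. K x t * f t) x) b" using ex_volterra by blast
  then interpret V: volterra "\<lambda>f x. 1 / (2 * \<i> * q0 x) * Int0 (\<lambda>t. K x t * f t) x" b .
  have "Linf (\<lambda>x. 1 / (2 * \<i> * q0 x) * g x)" by (intro Linf_mult Linf_AC AC_inverse_2i inv_AC g)
  from V.V_surjective[OF this] obtain f where f: "Linf f"
    "AE x\<in>{0..1} in lebesgue. f x + 1 / (2 * \<i> * q0 x) * Int0 (\<lambda>t. K x t * f t) x = 1 / (2 * \<i> * q0 x) * g x" by blast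
  from f(2) have "AE x\<in>{0..1} in lebesgue. Bop q0 (Kker n P Q) f x = g x"
  proof eventually_elim
    case (elim x)
    then show ?case using nz by (auto simp only: Bop_factor) simp
  qed
  then show ?thesis using f(1) by blast
qed

end

end

theorem theorem5:
  fixes n :: nat
    and q0 :: "real \<Rightarrow> complex"
    and q p :: "nat \<Rightarrow> fnl"
  assumes n_pos: "n \<ge> 1"
    and q0_AC: "AC q0"
    and q0_nz: "\<forall>x\<in>{0..1}. q0 x \<noteq> 0"
    and q0_inv_AC: "AC (\<lambda>x. 1 / q0 x)"
    and q_reg: "\<forall>k\<in>{1..n}. Wneg (k - 1) (q k)"
    and p_reg: "\<forall>k\<le>n. Wneg k (p k)"
  shows "\<exists>(a :: real \<Rightarrow> real) (u :: nat \<Rightarrow> real \<Rightarrow> complex).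
     L1 a \<and> (\<forall>\<nu><n. Wsob 1 L1 (u \<nu>)) \<and>
     (\<forall>P Q. prims n q0 q p P Q \<longrightarrow>
        (AE t in lebesgue. t \<in> {0..1} \<longrightarrow> (\<forall>x\<in>{t..1}. norm (Kker n P Q x t) \<le> a t)) \<and>
        (\<forall>f. Linf f \<longrightarrow> Linf (Bop q0 (Kker n P Q) f)) \<and>
        (\<forall>f g. Linf f \<longrightarrow> Linf g \<longrightarrow>
           (AE x in lebesgue. x \<in> {0..1} \<longrightarrow> Bop q0 (Kker n P Q) f x = Bop q0 (Kker n P Q) g x) \<longrightarrow>
           (AE x in lebesgue. x \<in> {0..1} \<longrightarrow> f x = g x)) \<and>
        (\<forall>g. Linf g \<longrightarrow> (\<exists>f. Linf f \<and>
           (AE x in lebesgue. x \<in> {0..1} \<longrightarrow> Bop q0 (Kker n P Q) f x = g x))) \<and>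
        (\<forall>y. Wsob n Linf y \<longrightarrow> (\<forall>\<phi>. W0inf (n + 1) \<phi> \<longrightarrow>
           ell n q0 q p y \<phi> =
             (-1) ^ (n + 1) * (LINT x:{0..1}|lebesgue.
                (Bop q0 (Kker n P Q) ((wder ^^ n) y) x + (\<Sum>\<nu><n. (wder ^^ \<nu>) y 0 * u \<nu> x))
                * (wder ^^ (n + 1)) \<phi> x)))) \<and>
     (\<forall>P Q P' Q'. prims n q0 q p P Q \<longrightarrow> prims n q0 q p P' Q' \<longrightarrow>
        (AE t in lebesgue. t \<in> {0..1} \<longrightarrow>
           (\<forall>x\<in>{t..1}. Kker n P Q x t = Kker n P' Q' x t)))"
\<comment> \<open>Without any family of primitives all claims about them hold vacuously and zero
  data do; otherwise one family is fixed.\<close>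
proof (cases "\<exists>P Q. prims n q0 q p P Q")
  case False
  have "Wsob 1 L1 (\<lambda>x. 0)" by (rule Wsob_1_L1_I[OF AC_const is_deriv_const])
  then show ?thesis
    using False by (intro exI[of _ "\<lambda>t. 0"] exI[of _ "\<lambda>\<nu> x. 0"]) (auto intro: L1_const)
next
  case True
  then obtain P0 Q0 where "prims n q0 q p P0 Q0" by blast
  then have E0: "expression_coeffs n q0 q p P0 Q0"
    using q0_AC by (simp add: expression_coeffs_def)
  interpret A: expression_coeffs n q0 q p P0 Q0 by (rule E0)
  \<comment> \<open>The dominating function and the u_\<nu> must be the same for all P and Q. They
    are taken from P0 and Q0; other kernels inherit the bound at almost every t.\<close>
  have main: "(AE t in lebesgue. t \<in> {0..1} \<longrightarrow> (\<forall>x\<in>{t..1}. norm (Kker n P Q x t) \<le> Kbound n (leib_coeff P0 Q0) t)) \<and>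
        (\<forall>f. Linf f \<longrightarrow> Linf (Bop q0 (Kker n P Q) f)) \<and>
        (\<forall>f g. Linf f \<longrightarrow> Linf g \<longrightarrow>
           (AE x in lebesgue. x \<in> {0..1} \<longrightarrow> Bop q0 (Kker n P Q) f x = Bop q0 (Kker n P Q) g x) \<longrightarrow>
           (AE x in lebesgue. x \<in> {0..1} \<longrightarrow> f x = g x)) \<and>
        (\<forall>g. Linf g \<longrightarrow> (\<exists>f. Linf f \<and>
           (AE x in lebesgue. x \<in> {0..1} \<longrightarrow> Bop q0 (Kker n P Q) f x = g x))) \<and>
        (\<forall>y. Wsob n Linf y \<longrightarrow> (\<forall>\<phi>. W0inf (n + 1) \<phi> \<longrightarrow>
           ell n q0 q p y \<phi> =
             (-1) ^ (n + 1) * (LINT x:{0..1}|lebesgue.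
                (Bop q0 (Kker n P Q) ((wder ^^ n) y) x
                  + (\<Sum>\<nu><n. (wder ^^ \<nu>) y 0 * initial_coeff n (leib_coeff P0 Q0) \<nu> x))
                * (wder ^^ (n + 1)) \<phi> x)))"
    if PQ: "prims n q0 q p P Q" for P Q
  proof -
    have E: "expression_coeffs n q0 q p P Q"
      using q0_AC PQ by (simp add: expression_coeffs_def)
    interpret C: expression_coeffs n q0 q p P Q by (rule E)
    have KK: "AE t in lebesgue. t \<in> {0..1} \<longrightarrow> (\<forall>x\<in>{t..1}. Kker n P Q x t = Kker n P0 Q0 x t)"
      by (rule Kker_independent[OF E E0])
    then have "AE t in lebesgue. t \<in> {0..1} \<longrightarrow> (\<forall>x\<in>{t..1}. norm (Kker n P Q x t) \<le> Kbound n (leib_coeff P0 Q0) t)"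
      by eventually_elim (use A.norm_K_le in \<open>auto simp: A.Kker_eq_K\<close>)
    moreover have "ell n q0 q p y \<phi> =
             (-1) ^ (n + 1) * (LINT x:{0..1}|lebesgue.
                (Bop q0 (Kker n P Q) ((wder ^^ n) y) x
                  + (\<Sum>\<nu><n. (wder ^^ \<nu>) y 0 * initial_coeff n (leib_coeff P0 Q0) \<nu> x))
                * (wder ^^ (n + 1)) \<phi> x)"
      if y: "Wsob n Linf y" and \<phi>: "W0inf (n + 1) \<phi>" for y \<phi>
    proof -
      note f = Wsob_Linf_wder(2)[OF y]
      \<comment> \<open>Equality at every x, not merely almost every one: for each x the two kernels
        agree at almost every t in [0,x].\<close>
      have "Bop q0 (Kker n P Q) ((wder ^^ n) y) x = Bop q0 (Kker n P0 Q0) ((wder ^^ n) y) x" if x: "x \<in> {0..1}" for x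
      proof -
        have "(\<integral>t. indicator {0..x} t *\<^sub>R (C.K x t * (wder ^^ n) y t) \<partial>lebesgue)
          = (\<integral>t. indicator {0..x} t *\<^sub>R (A.K x t * (wder ^^ n) y t) \<partial>lebesgue)"
        proof (rule integral_cong_AE)
          show "(\<lambda>t. indicator {0..x} t *\<^sub>R (C.K x t * (wder ^^ n) y t)) \<in> borel_measurable lebesgue"
            "(\<lambda>t. indicator {0..x} t *\<^sub>R (A.K x t * (wder ^^ n) y t)) \<in> borel_measurable lebesgue"
            using C.set_integrable_K[OF f x] A.set_integrable_K[OF f x] by (auto simp: set_integrable_def)
          show "AE t in lebesgue. indicator {0..x} t *\<^sub>R (C.K x t * (wder ^^ n) y t)
              = indicator {0..x} t *\<^sub>R (A.K x t * (wder ^^ n) y t)"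
            using KK by eventually_elim (use x in \<open>auto simp: indicator_def A.Kker_eq_K C.Kker_eq_K\<close>)
        qed
        then show ?thesis
          by (simp add: A.Bop_eq C.Bop_eq Int0_def set_lebesgue_integral_def)
      qed
      then show ?thesis
        unfolding A.ell_representation[OF y \<phi>]
        by (intro arg_cong[where f = "\<lambda>z. (- 1) ^ (n + 1) * z"] set_lebesgue_integral_cong) auto
    qed
    ultimately show ?thesis
      using C.Linf_Bop C.Bop_injective[OF q0_nz q0_inv_AC] C.Bop_surjective[OF q0_nz q0_inv_AC] by blast
  qed
  have indep: "AE t in lebesgue. t \<in> {0..1} \<longrightarrow> (\<forall>x\<in>{t..1}. Kker n P Q x t = Kker n P' Q' x t)"
    if "prims n q0 q p P Q" "prims n q0 q p P' Q'" for P Q P' Q'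
    using that q0_AC by (intro Kker_independent) (simp_all add: expression_coeffs_def)
  show ?thesis
    by (intro exI[of _ "Kbound n (leib_coeff P0 Q0)"] exI[of _ "initial_coeff n (leib_coeff P0 Q0)"] conjI
        allI impI A.L1_Kbound A.Wsob_initial_coeff main[THEN conjunct1] main[THEN conjunct2] indep)
qed

end
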